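(* Let $\overrightarrow{Q}$ be a $\mathbb{Z}_2$-coloured quiver with path algebra $P(\overrightarrow{Q})$. Let $F:\mathrm{SRep}(\overrightarrow{Q})\to\mathrm{SMod}(P(\overrightarrow{Q}))$ be the functor defined as usual by $F(X)=\bigoplus_{i\in Q_0}X(i)$, with the action of each arrow $e$ given by the map $x_e$. Let $G:\mathrm{SMod}(P(\overrightarrow{Q}))\to\mathrm{SRep}(\overrightarrow{Q})$ be the functor defined as usual by $G(M)=X_M$, where $X_M(i)=v_iM$ and $x_e$ is given by the action of $e:v_{s(e)}M\to v_{t(e)}M$. Then the functors $F$ and $G$ are inverse and provide an equivalence of categories between $\mathrm{SRep}(\overrightarrow{Q})$ and $\mathrm{SMod}(P(\overrightarrow{Q}))$.
   Context: Fix a field $\mathbb{K}$. A $\mathbb{Z}_2$-coloured quiver $\overrightarrow{Q}$ has a vertex set $Q_0$, an arrow set $Q_1$, source and target maps $s,t:Q_1\to Q_0$, and a parity function $p:Q_0\to\mathbb{Z}_2$. **Super-representations.** An object $X$ of $\mathrm{SRep}(\overrightarrow{Q})$ is a finite-dimensional $\mathbb{Z}_2$-graded vector space $X(i)=X_0(i)\oplus X_1(i)$ for each $i\in Q_0$ and, for every arrow $e$, a homogeneous linear map $x_e:X(s(e))\to X(t(e))$ of degree $p(s(e))+p(t(e))$. A morphism $\Phi:X\to Y$ is a collection of homogeneous linear maps $\phi_i:X(i)\to Y(i)$ (maps of degree $0$ and of degree $1$ are both allowed) with $\phi_{t(e)}x_e=y_e\phi_{s(e)}$ for all arrows $e$.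 **Path algebra.** $P(\overrightarrow{Q})$ is the associative $\mathbb{K}$-algebra spanned by the paths in $\overrightarrow{Q}$, generated by the arrows $e\in Q_1$ and elements $v_i$, $i\in Q_0$ (thought of as the path of length $0$ from $i$ to $i$), with multiplication given by concatenation of paths and unit $1=\sum_{i\in Q_0}v_i$. It is $\mathbb{Z}_2$-graded by $p(v_i)=0$, $p(e)=p(s(e))+p(t(e))$ for arrows, and $p(e_{i_n}e_{i_{n-1}}\cdots e_{i_1})=\sum_k p(e_{i_k})$ for paths. **Super-modules.** An object of $\mathrm{SMod}(P(\overrightarrow{Q}))$ (a super-module over $P(\overrightarrow{Q})$) is a module over $P(\overrightarrow{Q})$ which is a $\mathbb{Z}_2$-graded vector space $M=M_0\oplus M_1$ such that for any arrow $e$ the action $e:M\to M$ has degree $p(e)$. A morphism $M\to N$ is a linear map $\Phi:M\to N$ compatible with the action of $P(\overrightarrow{Q})$, i.e. $\Phi(q.x)=q.\Phi(x)$ for any path $q$.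
   Formalization: Super-modules are taken finite-dimensional with each v_i acting in degree 0, and morphisms are matched in three ways (span of homogeneous families with all module maps; vertexwise homogeneous; one common degree), as G is otherwise undefined; Q_0 is finite. *)

theory Defs
  imports
    "HOL-Library.Z2"
    "HOL-Library.FuncSet"
    "Graph_Theory.Arc_Walk"
    "Jordan_Normal_Form.Missing_VectorSpace"
begin

section \<open>Categories\<close>

text \<open>Morphisms are HOL values that need not determine their source and target; composition and
  the action of a functor on morphisms therefore take the objects as arguments.
  \<open>Comp C X Y Z g f\<close> is the composite of \<open>f : X \<rightarrow> Y\<close> followed by \<open>g : Y \<rightarrow> Z\<close>.\<close>

record ('o, 'm) cat =
  Ob :: "'o set"
  Hom :: "'o \<Rightarrow> 'o \<Rightarrow> 'm set"
  Comp :: "'o \<Rightarrow> 'o \<Rightarrow> 'o \<Rightarrow> 'm \<Rightarrow> 'm \<Rightarrow> 'm"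
  Ident :: "'o \<Rightarrow> 'm"

locale category =
  fixes C :: "('o, 'm) cat"
  assumes Ident_in_Hom: "X \<in> Ob C \<Longrightarrow> Ident C X \<in> Hom C X X"
    and Comp_in_Hom:
      "\<lbrakk>X \<in> Ob C; Y \<in> Ob C; Z \<in> Ob C; f \<in> Hom C X Y; g \<in> Hom C Y Z\<rbrakk>
        \<Longrightarrow> Comp C X Y Z g f \<in> Hom C X Z"
    and Comp_Ident_right:
      "\<lbrakk>X \<in> Ob C; Y \<in> Ob C; f \<in> Hom C X Y\<rbrakk> \<Longrightarrow> Comp C X X Y f (Ident C X) = f"
    and Comp_Ident_left:
      "\<lbrakk>X \<in> Ob C; Y \<in> Ob C; f \<in> Hom C X Y\<rbrakk> \<Longrightarrow> Comp C X Y Y (Ident C Y) f = f"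
    and Comp_assoc:
      "\<lbrakk>W \<in> Ob C; X \<in> Ob C; Y \<in> Ob C; Z \<in> Ob C;
        f \<in> Hom C W X; g \<in> Hom C X Y; h \<in> Hom C Y Z\<rbrakk>
        \<Longrightarrow> Comp C W Y Z h (Comp C W X Y g f) = Comp C W X Z (Comp C X Y Z h g) f"

record ('o, 'm, 'o2, 'm2) cat_functor =
  on_ob :: "'o \<Rightarrow> 'o2"
  on_hom :: "'o \<Rightarrow> 'o \<Rightarrow> 'm \<Rightarrow> 'm2"

locale category_functor = C: category C + D: category D
  for C :: "('o, 'm) cat" and D :: "('o2, 'm2) cat" +
  fixes F :: "('o, 'm, 'o2, 'm2) cat_functor"
  assumes on_ob_closed: "X \<in> Ob C \<Longrightarrow> on_ob F X \<in> Ob D"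
    and on_hom_closed:
      "\<lbrakk>X \<in> Ob C; Y \<in> Ob C; f \<in> Hom C X Y\<rbrakk> \<Longrightarrow> on_hom F X Y f \<in> Hom D (on_ob F X) (on_ob F Y)"
    and on_hom_Ident: "X \<in> Ob C \<Longrightarrow> on_hom F X X (Ident C X) = Ident D (on_ob F X)"
    and on_hom_Comp:
      "\<lbrakk>X \<in> Ob C; Y \<in> Ob C; Z \<in> Ob C; f \<in> Hom C X Y; g \<in> Hom C Y Z\<rbrakk>
        \<Longrightarrow> on_hom F X Z (Comp C X Y Z g f) =
            Comp D (on_ob F X) (on_ob F Y) (on_ob F Z) (on_hom F Y Z g) (on_hom F X Y f)"

definition id_functor :: "('o, 'm, 'o, 'm) cat_functor" where
  "id_functor = \<lparr>on_ob = (\<lambda>X. X), on_hom = (\<lambda>X Y f. f)\<rparr>"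

definition comp_functor ::
    "('o2, 'm2, 'o3, 'm3) cat_functor \<Rightarrow> ('o, 'm, 'o2, 'm2) cat_functor
      \<Rightarrow> ('o, 'm, 'o3, 'm3) cat_functor" where
  "comp_functor G F =
    \<lparr>on_ob = (\<lambda>X. on_ob G (on_ob F X)),
     on_hom = (\<lambda>X Y f. on_hom G (on_ob F X) (on_ob F Y) (on_hom F X Y f))\<rparr>"

definition iso_in :: "('o, 'm) cat \<Rightarrow> 'o \<Rightarrow> 'o \<Rightarrow> 'm \<Rightarrow> bool" where
  "iso_in C X Y f \<longleftrightarrow> f \<in> Hom C X Y \<and>
    (\<exists>g \<in> Hom C Y X. Comp C X Y X g f = Ident C X \<and> Comp C Y X Y f g = Ident C Y)"

definition naturally_isomorphic ::
    "('o, 'm) cat \<Rightarrow> ('o2, 'm2) cat \<Rightarrow> ('o, 'm, 'o2, 'm2) cat_functor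
      \<Rightarrow> ('o, 'm, 'o2, 'm2) cat_functor \<Rightarrow> bool" where
  "naturally_isomorphic C D S T \<longleftrightarrow>
    (\<exists>\<eta>. (\<forall>X \<in> Ob C. iso_in D (on_ob S X) (on_ob T X) (\<eta> X)) \<and>
      (\<forall>X \<in> Ob C. \<forall>Y \<in> Ob C. \<forall>f \<in> Hom C X Y.
        Comp D (on_ob S X) (on_ob S Y) (on_ob T Y) (\<eta> Y) (on_hom S X Y f) =
        Comp D (on_ob S X) (on_ob T X) (on_ob T Y) (on_hom T X Y f) (\<eta> X)))"

definition inverse_equivalences ::
    "('o, 'm) cat \<Rightarrow> ('o2, 'm2) cat \<Rightarrow> ('o, 'm, 'o2, 'm2) cat_functor
      \<Rightarrow> ('o2, 'm2, 'o, 'm) cat_functor \<Rightarrow> bool" where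
  "inverse_equivalences C D F G \<longleftrightarrow>
    category_functor C D F \<and> category_functor D C G \<and>
    naturally_isomorphic C C id_functor (comp_functor G F) \<and>
    naturally_isomorphic D D (comp_functor F G) id_functor"


section \<open>Super vector spaces\<close>

record ('k, 'v) super_space = "('k, 'v) module" +
  grade :: "bit \<Rightarrow> 'v set"

locale super_vectorspace = vectorspace K V
  for K :: "('k, 'r) ring_scheme" and V :: "('k, 'v, 'x) super_space_scheme" +
  assumes grade_subspace: "subspace K (grade V d) V"
    and grade_sum: "carrier V = submodule_sum (grade V 0) (grade V 1)"
    and grade_disjoint: "grade V 0 \<inter> grade V 1 = {\<zero>\<^bsub>V\<^esub>}"

definition fd_super_vectorspace ::
    "('k, 'r) ring_scheme \<Rightarrow> ('k, 'v, 'x) super_space_scheme \<Rightarrow> bool" where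
  "fd_super_vectorspace K V \<longleftrightarrow> super_vectorspace K V \<and> vectorspace.fin_dim K V"

definition has_degree ::
    "('k, 'v, 'x) super_space_scheme \<Rightarrow> ('k, 'w, 'y) super_space_scheme \<Rightarrow> bit
      \<Rightarrow> ('v \<Rightarrow> 'w) \<Rightarrow> bool" where
  "has_degree V W d f \<longleftrightarrow> (\<forall>a. f ` grade V a \<subseteq> grade W (a + d))"


section \<open>Paths and the path algebra\<close>

text \<open>A coloured quiver is a multidigraph \<open>Q\<close> (source \<open>tail\<close>, target \<open>head\<close>) together with
  \<open>p :: 'q \<Rightarrow> bit\<close>. The path \<open>e\<^sub>n \<cdots> e\<^sub>1\<close> from \<open>u\<close> to \<open>v\<close> is \<open>(u, [e\<^sub>1, \<dots>, e\<^sub>n], v)\<close>: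
  the list is in walking order, whereas products are written right to left.\<close>

type_synonym ('q, 'e) path = "'q \<times> 'e list \<times> 'q"

definition paths :: "('q, 'e) pre_digraph \<Rightarrow> ('q, 'e) path set" where
  "paths Q = {(u, es, v). pre_digraph.awalk Q u es v}"

definition trivial_path :: "'q \<Rightarrow> ('q, 'e) path" where
  "trivial_path i = (i, [], i)"

definition arrow_path :: "('q, 'e) pre_digraph \<Rightarrow> 'e \<Rightarrow> ('q, 'e) path" where
  "arrow_path Q e = (tail Q e, [e], head Q e)"

definition path_source :: "('q, 'e) path \<Rightarrow> 'q" where
  "path_source w = fst w"

definition path_target :: "('q, 'e) path \<Rightarrow> 'q" where
  "path_target w = snd (snd w)"

text \<open>\<open>path_concat x y\<close> is the path \<open>xy\<close> (first \<open>y\<close>, then \<open>x\<close>), meaningful if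
  \<open>path_source x = path_target y\<close>.\<close>

definition path_concat :: "('q, 'e) path \<Rightarrow> ('q, 'e) path \<Rightarrow> ('q, 'e) path" where
  "path_concat x y = (path_source y, fst (snd y) @ fst (snd x), path_target x)"

definition path_parity :: "('q, 'e) pre_digraph \<Rightarrow> ('q \<Rightarrow> bit) \<Rightarrow> ('q, 'e) path \<Rightarrow> bit" where
  "path_parity Q p w = (\<Sum>e \<leftarrow> fst (snd w). p (tail Q e) + p (head Q e))"

definition support :: "('k, 'r) ring_scheme \<Rightarrow> ('w \<Rightarrow> 'k) \<Rightarrow> 'w set" where
  "support K a = {w. a w \<noteq> \<zero>\<^bsub>K\<^esub>}"

definition basis_elt :: "('k, 'r) ring_scheme \<Rightarrow> 'w \<Rightarrow> 'w \<Rightarrow> 'k" where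
  "basis_elt K w = (\<lambda>w'. if w' = w then \<one>\<^bsub>K\<^esub> else \<zero>\<^bsub>K\<^esub>)"

text \<open>The product of two paths that do not match is \<open>0\<close>. The field \<open>one\<close> is
  \<open>\<Sum>\<^sub>i v\<^sub>i\<close>, an element of the carrier because there are finitely many vertices.\<close>

definition path_algebra ::
    "('k, 'r) ring_scheme \<Rightarrow> ('q, 'e) pre_digraph \<Rightarrow> ('k, ('q, 'e) path \<Rightarrow> 'k) module" where
  "path_algebra K Q =
    \<lparr>carrier = {a. (\<forall>w. a w \<in> carrier K) \<and> support K a \<subseteq> paths Q \<and> finite (support K a)},
     mult = (\<lambda>a b w. finsum K (\<lambda>(x, y). a x \<otimes>\<^bsub>K\<^esub> b y)
                {(x, y). x \<in> support K a \<and> y \<in> support K b \<and>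
                  path_source x = path_target y \<and> path_concat x y = w}),
     one = (\<lambda>w. if w \<in> trivial_path ` verts Q then \<one>\<^bsub>K\<^esub> else \<zero>\<^bsub>K\<^esub>),
     zero = (\<lambda>w. \<zero>\<^bsub>K\<^esub>),
     add = (\<lambda>a b w. a w \<oplus>\<^bsub>K\<^esub> b w),
     smult = (\<lambda>c a w. c \<otimes>\<^bsub>K\<^esub> a w)\<rparr>"

definition vertex_elt :: "('k, 'r) ring_scheme \<Rightarrow> 'q \<Rightarrow> ('q, 'e) path \<Rightarrow> 'k" where
  "vertex_elt K i = basis_elt K (trivial_path i)"

definition arrow_elt ::
    "('k, 'r) ring_scheme \<Rightarrow> ('q, 'e) pre_digraph \<Rightarrow> 'e \<Rightarrow> ('q, 'e) path \<Rightarrow> 'k" where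
  "arrow_elt K Q e = basis_elt K (arrow_path Q e)"


section \<open>Super-representations\<close>

text \<open>Maps between carriers are normalised to be \<^const>\<open>extensional\<close>, and families indexed by the
  vertices likewise, so that equality of morphisms is equality of HOL functions.\<close>

record ('q, 'e, 'k, 'v) srep =
  space :: "'q \<Rightarrow> ('k, 'v) super_space"
  amap :: "'e \<Rightarrow> 'v \<Rightarrow> 'v"

definition srep_objects ::
    "('k, 'r) ring_scheme \<Rightarrow> ('q, 'e) pre_digraph \<Rightarrow> ('q \<Rightarrow> bit) \<Rightarrow> ('q, 'e, 'k, 'v) srep set" where
  "srep_objects K Q p = {X.
    (\<forall>i \<in> verts Q. fd_super_vectorspace K (space X i)) \<and>
    (\<forall>e \<in> arcs Q. amap X e \<in> module_hom K (space X (tail Q e)) (space X (head Q e)) \<and>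
       has_degree (space X (tail Q e)) (space X (head Q e)) (p (tail Q e) + p (head Q e)) (amap X e))}"

definition srep_intertwiners ::
    "('k, 'r) ring_scheme \<Rightarrow> ('q, 'e) pre_digraph \<Rightarrow> ('q, 'e, 'k, 'v) srep \<Rightarrow> ('q, 'e, 'k, 'v) srep
      \<Rightarrow> ('q \<Rightarrow> 'v \<Rightarrow> 'v) set" where
  "srep_intertwiners K Q X Y = {\<phi> \<in> extensional (verts Q).
    (\<forall>i \<in> verts Q. \<phi> i \<in> module_hom K (space X i) (space Y i) \<inter> extensional (carrier (space X i))) \<and>
    (\<forall>e \<in> arcs Q. \<forall>x \<in> carrier (space X (tail Q e)).
       \<phi> (head Q e) (amap X e x) = amap Y e (\<phi> (tail Q e) x))}"

definition srep_homog ::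
    "('k, 'r) ring_scheme \<Rightarrow> ('q, 'e) pre_digraph \<Rightarrow> ('q, 'e, 'k, 'v) srep \<Rightarrow> ('q, 'e, 'k, 'v) srep
      \<Rightarrow> ('q \<Rightarrow> 'v \<Rightarrow> 'v) set" where
  "srep_homog K Q X Y = {\<phi> \<in> srep_intertwiners K Q X Y.
    \<forall>i \<in> verts Q. \<exists>d. has_degree (space X i) (space Y i) d (\<phi> i)}"

text \<open>The same, with one common degree for all \<open>\<phi>\<^sub>i\<close>.\<close>

definition srep_homog_common ::
    "('k, 'r) ring_scheme \<Rightarrow> ('q, 'e) pre_digraph \<Rightarrow> ('q, 'e, 'k, 'v) srep \<Rightarrow> ('q, 'e, 'k, 'v) srep
      \<Rightarrow> ('q \<Rightarrow> 'v \<Rightarrow> 'v) set" where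
  "srep_homog_common K Q X Y = {\<phi> \<in> srep_intertwiners K Q X Y.
    \<exists>d. \<forall>i \<in> verts Q. has_degree (space X i) (space Y i) d (\<phi> i)}"

text \<open>Homogeneous maps are not closed under addition. The Hom space is the linear span of the
  homogeneous morphisms (these are closed under scalars, so closure under sums suffices), as is
  usual in super linear algebra.\<close>

inductive_set srep_hom ::
    "('k, 'r) ring_scheme \<Rightarrow> ('q, 'e) pre_digraph \<Rightarrow> ('q, 'e, 'k, 'v) srep \<Rightarrow> ('q, 'e, 'k, 'v) srep
      \<Rightarrow> ('q \<Rightarrow> 'v \<Rightarrow> 'v) set"
  for K :: "('k, 'r) ring_scheme" and Q :: "('q, 'e) pre_digraph"
    and X Y :: "('q, 'e, 'k, 'v) srep" where
  homog: "\<phi> \<in> srep_homog K Q X Y \<Longrightarrow> \<phi> \<in> srep_hom K Q X Y"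
| sum: "\<lbrakk>\<phi> \<in> srep_hom K Q X Y; \<psi> \<in> srep_hom K Q X Y\<rbrakk> \<Longrightarrow>
    (\<lambda>i \<in> verts Q. \<lambda>x \<in> carrier (space X i). \<phi> i x \<oplus>\<^bsub>space Y i\<^esub> \<psi> i x) \<in> srep_hom K Q X Y"

type_synonym ('q, 'e, 'k, 'v) srep_cat = "(('q, 'e, 'k, 'v) srep, 'q \<Rightarrow> 'v \<Rightarrow> 'v) cat"

definition srep_category ::
    "('k, 'r) ring_scheme \<Rightarrow> ('q, 'e) pre_digraph \<Rightarrow> ('q \<Rightarrow> bit)
      \<Rightarrow> (('q, 'e, 'k, 'v) srep \<Rightarrow> ('q, 'e, 'k, 'v) srep \<Rightarrow> ('q \<Rightarrow> 'v \<Rightarrow> 'v) set)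
      \<Rightarrow> ('q, 'e, 'k, 'v) srep_cat" where
  "srep_category K Q p H =
    \<lparr>Ob = srep_objects K Q p,
     Hom = H,
     Comp = (\<lambda>X Y Z \<psi> \<phi>. \<lambda>i \<in> verts Q. compose (carrier (space X i)) (\<psi> i) (\<phi> i)),
     Ident = (\<lambda>X. \<lambda>i \<in> verts Q. \<lambda>x \<in> carrier (space X i). x)\<rparr>"

definition SRep ::
    "('k, 'r) ring_scheme \<Rightarrow> ('q, 'e) pre_digraph \<Rightarrow> ('q \<Rightarrow> bit)
      \<Rightarrow> ('q, 'e, 'k, 'v) srep_cat" where
  "SRep K Q p = srep_category K Q p (srep_hom K Q)"

definition SRep_homog ::
    "('k, 'r) ring_scheme \<Rightarrow> ('q, 'e) pre_digraph \<Rightarrow> ('q \<Rightarrow> bit)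
      \<Rightarrow> ('q, 'e, 'k, 'v) srep_cat" where
  "SRep_homog K Q p = srep_category K Q p (srep_homog K Q)"

definition SRep_homog_common ::
    "('k, 'r) ring_scheme \<Rightarrow> ('q, 'e) pre_digraph \<Rightarrow> ('q \<Rightarrow> bit)
      \<Rightarrow> ('q, 'e, 'k, 'v) srep_cat" where
  "SRep_homog_common K Q p = srep_category K Q p (srep_homog_common K Q)"


section \<open>Super-modules\<close>

record ('k, 'c, 'v) smod = "('k, 'v) super_space" +
  act :: "'c \<Rightarrow> 'v \<Rightarrow> 'v"

text \<open>A unital left module over a not necessarily commutative unital \<open>K\<close>-algebra \<open>A\<close>, on a given
  \<open>K\<close>-vector space. (The library's \<^const>\<open>module\<close> requires a commutative ring of scalars.)\<close>

locale algebra_left_module = vectorspace K M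
  for K :: "('k, 'r) ring_scheme" and A :: "('k, 'c, 's) module_scheme"
    and M :: "('k, 'c, 'v) smod" +
  assumes act_closed: "\<lbrakk>a \<in> carrier A; x \<in> carrier M\<rbrakk> \<Longrightarrow> act M a x \<in> carrier M"
    and act_add_right: "\<lbrakk>a \<in> carrier A; x \<in> carrier M; y \<in> carrier M\<rbrakk>
      \<Longrightarrow> act M a (x \<oplus>\<^bsub>M\<^esub> y) = act M a x \<oplus>\<^bsub>M\<^esub> act M a y"
    and act_add_left: "\<lbrakk>a \<in> carrier A; b \<in> carrier A; x \<in> carrier M\<rbrakk>
      \<Longrightarrow> act M (a \<oplus>\<^bsub>A\<^esub> b) x = act M a x \<oplus>\<^bsub>M\<^esub> act M b x"
    and act_smult: "\<lbrakk>c \<in> carrier K; a \<in> carrier A; x \<in> carrier M\<rbrakk>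
      \<Longrightarrow> act M (c \<odot>\<^bsub>A\<^esub> a) x = c \<odot>\<^bsub>M\<^esub> act M a x"
    and act_mult: "\<lbrakk>a \<in> carrier A; b \<in> carrier A; x \<in> carrier M\<rbrakk>
      \<Longrightarrow> act M (a \<otimes>\<^bsub>A\<^esub> b) x = act M a (act M b x)"
    and act_one: "x \<in> carrier M \<Longrightarrow> act M \<one>\<^bsub>A\<^esub> x = x"

text \<open>Super-modules are finite-dimensional, to match the super-representations. The idempotents
  \<open>v\<^sub>i\<close> are generators of degree \<open>0\<close> and act with that degree; otherwise \<open>v\<^sub>i M\<close> would not be a graded
  subspace.\<close>

definition smod_objects ::
    "('k, 'r) ring_scheme \<Rightarrow> ('q, 'e) pre_digraph \<Rightarrow> ('q \<Rightarrow> bit)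
      \<Rightarrow> ('k, ('q, 'e) path \<Rightarrow> 'k, 'v) smod set" where
  "smod_objects K Q p = {M.
    fd_super_vectorspace K M \<and> algebra_left_module K (path_algebra K Q) M \<and>
    (\<forall>i \<in> verts Q. has_degree M M (path_parity Q p (trivial_path i)) (act M (vertex_elt K i))) \<and>
    (\<forall>e \<in> arcs Q. has_degree M M (path_parity Q p (arrow_path Q e)) (act M (arrow_elt K Q e)))}"

definition smod_hom ::
    "('k, 'r) ring_scheme \<Rightarrow> ('q, 'e) pre_digraph \<Rightarrow> ('k, ('q, 'e) path \<Rightarrow> 'k, 'v) smod
      \<Rightarrow> ('k, ('q, 'e) path \<Rightarrow> 'k, 'v) smod \<Rightarrow> ('v \<Rightarrow> 'v) set" where
  "smod_hom K Q M N = {\<Phi> \<in> module_hom K M N \<inter> extensional (carrier M).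
    \<forall>w \<in> paths Q. \<forall>x \<in> carrier M. \<Phi> (act M (basis_elt K w) x) = act N (basis_elt K w) (\<Phi> x)}"

definition vertex_space ::
    "('k, 'r) ring_scheme \<Rightarrow> ('k, ('q, 'e) path \<Rightarrow> 'k, 'v) smod \<Rightarrow> 'q \<Rightarrow> ('k, 'v) super_space" where
  "vertex_space K M i =
    \<lparr>carrier = act M (vertex_elt K i) ` carrier M,
     mult = mult M, one = one M, zero = zero M, add = add M, smult = smult M,
     grade = (\<lambda>d. grade M d \<inter> act M (vertex_elt K i) ` carrier M)\<rparr>"

text \<open>Module maps that are homogeneous on each \<open>v\<^sub>i M\<close>, the degree being allowed to depend on \<open>i\<close>.\<close>

definition smod_homog ::
    "('k, 'r) ring_scheme \<Rightarrow> ('q, 'e) pre_digraph \<Rightarrow> ('k, ('q, 'e) path \<Rightarrow> 'k, 'v) smod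
      \<Rightarrow> ('k, ('q, 'e) path \<Rightarrow> 'k, 'v) smod \<Rightarrow> ('v \<Rightarrow> 'v) set" where
  "smod_homog K Q M N = {\<Phi> \<in> smod_hom K Q M N.
    \<forall>i \<in> verts Q. \<exists>d. has_degree (vertex_space K M i) (vertex_space K N i) d \<Phi>}"

definition smod_homog_common ::
    "('k, 'r) ring_scheme \<Rightarrow> ('q, 'e) pre_digraph \<Rightarrow> ('k, ('q, 'e) path \<Rightarrow> 'k, 'v) smod
      \<Rightarrow> ('k, ('q, 'e) path \<Rightarrow> 'k, 'v) smod \<Rightarrow> ('v \<Rightarrow> 'v) set" where
  "smod_homog_common K Q M N = {\<Phi> \<in> smod_hom K Q M N. \<exists>d. has_degree M N d \<Phi>}"

type_synonym ('q, 'e, 'k, 'v) smod_cat = "(('k, ('q, 'e) path \<Rightarrow> 'k, 'v) smod, 'v \<Rightarrow> 'v) cat"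

definition smod_category ::
    "('k, 'r) ring_scheme \<Rightarrow> ('q, 'e) pre_digraph \<Rightarrow> ('q \<Rightarrow> bit)
      \<Rightarrow> (('k, ('q, 'e) path \<Rightarrow> 'k, 'v) smod \<Rightarrow> ('k, ('q, 'e) path \<Rightarrow> 'k, 'v) smod \<Rightarrow> ('v \<Rightarrow> 'v) set)
      \<Rightarrow> ('q, 'e, 'k, 'v) smod_cat" where
  "smod_category K Q p H =
    \<lparr>Ob = smod_objects K Q p,
     Hom = H,
     Comp = (\<lambda>L M N \<Psi> \<Phi>. compose (carrier L) \<Psi> \<Phi>),
     Ident = (\<lambda>M. \<lambda>x \<in> carrier M. x)\<rparr>"

definition SMod ::
    "('k, 'r) ring_scheme \<Rightarrow> ('q, 'e) pre_digraph \<Rightarrow> ('q \<Rightarrow> bit)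
      \<Rightarrow> ('q, 'e, 'k, 'v) smod_cat" where
  "SMod K Q p = smod_category K Q p (smod_hom K Q)"

definition SMod_homog ::
    "('k, 'r) ring_scheme \<Rightarrow> ('q, 'e) pre_digraph \<Rightarrow> ('q \<Rightarrow> bit)
      \<Rightarrow> ('q, 'e, 'k, 'v) smod_cat" where
  "SMod_homog K Q p = smod_category K Q p (smod_homog K Q)"

definition SMod_homog_common ::
    "('k, 'r) ring_scheme \<Rightarrow> ('q, 'e) pre_digraph \<Rightarrow> ('q \<Rightarrow> bit)
      \<Rightarrow> ('q, 'e, 'k, 'v) smod_cat" where
  "SMod_homog_common K Q p = smod_category K Q p (smod_homog_common K Q)"


section \<open>The functors\<close>

text \<open>A universe of vectors closed under families indexed by vertices: it contains the elements of a
  direct sum \<open>\<Oplus>\<^sub>i X(i)\<close> of spaces living in it, so that \<open>F\<close> and \<open>G\<close> can be composed in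
  both orders. The type \<open>'a\<close> of atoms is arbitrary.\<close>

datatype ('q, 'a) vec_univ = Atom 'a | Family (component: "'q \<Rightarrow> ('q, 'a) vec_univ")

text \<open>The record fields \<open>mult\<close> and \<open>one\<close> are inherited from the library's \<open>module\<close> record and play
  no role for vector spaces. An element \<open>a\<close> of the path algebra acts by
  \<open>(a \<cdot> f)(j) = \<Sum> a(w) x\<^sub>w(f(i))\<close>, the sum being over the paths \<open>w : i \<rightarrow> j\<close>, where
  \<open>x\<^sub>w = x\<^bsub>e\<^sub>n\<^esub> \<circ> \<cdots> \<circ> x\<^bsub>e\<^sub>1\<^esub>\<close> for \<open>w = e\<^sub>n \<cdots> e\<^sub>1\<close>.\<close>

definition F_object ::
    "('k, 'r) ring_scheme \<Rightarrow> ('q, 'e) pre_digraph \<Rightarrow> ('q, 'e, 'k, ('q, 'a) vec_univ) srep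
      \<Rightarrow> ('k, ('q, 'e) path \<Rightarrow> 'k, ('q, 'a) vec_univ) smod" where
  "F_object K Q X =
    \<lparr>carrier = Family ` (\<Pi>\<^sub>E i \<in> verts Q. carrier (space X i)),
     mult = (\<lambda>x y. Family (\<lambda>i \<in> verts Q. \<zero>\<^bsub>space X i\<^esub>)),
     one = Family (\<lambda>i \<in> verts Q. \<zero>\<^bsub>space X i\<^esub>),
     zero = Family (\<lambda>i \<in> verts Q. \<zero>\<^bsub>space X i\<^esub>),
     add = (\<lambda>x y. Family (\<lambda>i \<in> verts Q. component x i \<oplus>\<^bsub>space X i\<^esub> component y i)),
     smult = (\<lambda>c x. Family (\<lambda>i \<in> verts Q. c \<odot>\<^bsub>space X i\<^esub> component x i)),
     grade = (\<lambda>d. Family ` (\<Pi>\<^sub>E i \<in> verts Q. grade (space X i) d)),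
     act = (\<lambda>a x. Family (\<lambda>j \<in> verts Q.
       \<Oplus>\<^bsub>space X j\<^esub>w \<in> {w \<in> support K a. path_target w = j}.
         a w \<odot>\<^bsub>space X j\<^esub> fold (amap X) (fst (snd w)) (component x (path_source w))))\<rparr>"

definition F_functor ::
    "('k, 'r) ring_scheme \<Rightarrow> ('q, 'e) pre_digraph
      \<Rightarrow> (('q, 'e, 'k, ('q, 'a) vec_univ) srep, 'q \<Rightarrow> ('q, 'a) vec_univ \<Rightarrow> ('q, 'a) vec_univ,
          ('k, ('q, 'e) path \<Rightarrow> 'k, ('q, 'a) vec_univ) smod,
          ('q, 'a) vec_univ \<Rightarrow> ('q, 'a) vec_univ) cat_functor" where
  "F_functor K Q =
    \<lparr>on_ob = F_object K Q,
     on_hom = (\<lambda>X Y \<phi>. \<lambda>x \<in> carrier (F_object K Q X). Family (\<lambda>i \<in> verts Q. \<phi> i (component x i)))\<rparr>"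

definition G_object ::
    "('k, 'r) ring_scheme \<Rightarrow> ('q, 'e) pre_digraph \<Rightarrow> ('k, ('q, 'e) path \<Rightarrow> 'k, 'v) smod
      \<Rightarrow> ('q, 'e, 'k, 'v) srep" where
  "G_object K Q M =
    \<lparr>space = vertex_space K M,
     amap = (\<lambda>e. act M (arrow_elt K Q e))\<rparr>"

definition G_functor ::
    "('k, 'r) ring_scheme \<Rightarrow> ('q, 'e) pre_digraph
      \<Rightarrow> (('k, ('q, 'e) path \<Rightarrow> 'k, 'v) smod, 'v \<Rightarrow> 'v,
          ('q, 'e, 'k, 'v) srep, 'q \<Rightarrow> 'v \<Rightarrow> 'v) cat_functor" where
  "G_functor K Q =
    \<lparr>on_ob = G_object K Q,
     on_hom = (\<lambda>M N \<Phi>. \<lambda>i \<in> verts Q. restrict \<Phi> (carrier (vertex_space K M i)))\<rparr>"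

end

theory Submission
  imports Defs
begin

text \<open>A module over the path algebra decomposes along the orthogonal idempotents \<open>v\<^sub>i\<close>, whose sum is
  the unit: the embedding \<open>X(i) \<rightarrow> v\<^sub>i F(X)\<close> and the summation map \<open>\<Oplus>\<^sub>i v\<^sub>i M \<rightarrow> M\<close> are the natural
  isomorphisms, both of degree \<open>0\<close>, so the same argument serves for every class of morphisms between the
  homogeneous ones of a common degree and all intertwiners. For the linear span of the homogeneous
  morphisms one needs that every intertwiner is the sum of an even and an odd one.\<close>

section \<open>Linear maps and graded spaces\<close>

text \<open>In general \<open>G(F(X))\<close> differs from \<open>X\<close>: a vector
  \<open>v\<close> of \<open>X(i)\<close> and the family whose only nonzero entry is
  \<open>v\<close> are different elements of \<open>vec_univ\<close>. Hence inverse means inverse up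
  to natural isomorphism. The laborious point is the path algebra itself. Its elements are finitely
  supported functions on paths, so multiplicativity of the action on \<open>F(X)\<close> is the
  rearrangement of a double sum over matching pairs of paths. Coefficients may cancel, so sums run
  over finite sets of paths that contain the supports. For a module \<open>M\<close> the action of
  single paths is enough, because morphisms are tested on paths. The even and odd parts of an
  intertwiner intertwine again because the maps \<open>x_e\<close> and \<open>y_e\<close> of an
  arrow have the same degree: both shift the degree of input and output alike. This is indispensable
  for \<open>G\<close>, which turns an arbitrary module map into an arbitrary intertwiner and has to
  land in the span of the homogeneous ones.\<close>

lemma module_homI:
  assumes "\<And>x. x \<in> carrier M \<Longrightarrow> f x \<in> carrier N"
    and "\<And>x y. \<lbrakk>x \<in> carrier M; y \<in> carrier M\<rbrakk> \<Longrightarrow> f (x \<oplus>\<^bsub>M\<^esub> y) = f x \<oplus>\<^bsub>N\<^esub> f y"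
    and "\<And>c x. \<lbrakk>c \<in> carrier R; x \<in> carrier M\<rbrakk> \<Longrightarrow> f (c \<odot>\<^bsub>M\<^esub> x) = c \<odot>\<^bsub>N\<^esub> f x"
  shows "f \<in> module_hom R M N"
  using assms by (auto simp: module_hom_def)

lemma module_hom_apply_closed: "\<lbrakk>f \<in> module_hom R M N; x \<in> carrier M\<rbrakk> \<Longrightarrow> f x \<in> carrier N"
  by (auto simp: module_hom_def)

lemma module_hom_zero:
  assumes "module R M" "module R N" "f \<in> module_hom R M N"
  shows "f \<zero>\<^bsub>M\<^esub> = \<zero>\<^bsub>N\<^esub>"
proof -
  interpret mod_hom R M N f
    using assms by (simp add: mod_hom_def mod_hom_axioms_def)
  show ?thesis by (rule f0_is_0)
qed

text \<open>For an infinite index set both sums are zero by the convention on \<open>finsum\<close>,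
  and \<open>f\<close> preserves zero; for a finite one this is additivity and induction.\<close>

lemma module_hom_finsum:
  assumes "module R M" "module R N" and f: "f \<in> module_hom R M N"
    and "\<And>a. a \<in> A \<Longrightarrow> g a \<in> carrier M"
  shows "f (finsum M g A) = finsum N (\<lambda>a. f (g a)) A"
proof -
  interpret M: module R M by fact
  interpret N: module R N by fact
  have f0: "f \<zero>\<^bsub>M\<^esub> = \<zero>\<^bsub>N\<^esub>" by (rule module_hom_zero) fact+
  show ?thesis
    using assms(4)
  proof (induction A rule: infinite_finite_induct)
    case (insert a A)
    have g: "g \<in> A \<rightarrow> carrier M" "g a \<in> carrier M"
      using insert.prems by auto
    then have "(\<lambda>a. f (g a)) \<in> A \<rightarrow> carrier N" "f (g a) \<in> carrier N"
      using f by (auto simp: module_hom_def)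
    with insert.hyps g insert.IH insert.prems show ?case
      by (simp add: M.finsum_insert N.finsum_insert module_hom_add[OF f])
  qed (auto simp: f0)
qed

lemma module_hom_comp:
  "\<lbrakk>f \<in> module_hom R L M; g \<in> module_hom R M N\<rbrakk> \<Longrightarrow> (\<lambda>x. g (f x)) \<in> module_hom R L N"
  by (auto simp: module_hom_def Pi_iff)

lemma module_hom_restrict:
  assumes "module R M" "f \<in> module_hom R M N"
  shows "restrict f (carrier M) \<in> module_hom R M N"
proof -
  interpret module R M by fact
  show ?thesis using assms(2) by (auto simp: module_hom_def)
qed

lemma module_hom_sum:
  assumes "module R N" "f \<in> module_hom R M N" "g \<in> module_hom R M N"
  shows "(\<lambda>x. f x \<oplus>\<^bsub>N\<^esub> g x) \<in> module_hom R M N"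
proof -
  interpret N: module R N by fact
  show ?thesis
    using assms(2,3)
    by (intro module_homI)
      (auto simp: module_hom_apply_closed module_hom_add module_hom_smult N.smult_r_distr N.M.a_ac)
qed

text \<open>The fibres of \<open>h\<close> partition \<open>P\<close>; a point of \<open>J\<close>
  outside the image of \<open>h\<close> has an empty fibre and contributes zero.\<close>

lemma (in module) finsum_fibres:
  assumes "finite P" "finite J" "h ` P \<subseteq> J" "\<And>x. x \<in> P \<Longrightarrow> g x \<in> carrier M"
  shows "finsum M g P = finsum M (\<lambda>j. finsum M g {x \<in> P. h x = j}) J"
proof -
  have "P = (\<Union>j\<in>J. {x \<in> P. h x = j})" using assms(3) by auto
  then have "finsum M g P = finsum M g (\<Union>j\<in>J. {x \<in> P. h x = j})" by simp
  also have "\<dots> = finsum M (\<lambda>j. finsum M g {x \<in> P. h x = j}) J"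
    using assms
    by (intro add.finprod_UN_disjoint) (auto simp: pairwise_def disjnt_def)
  finally show ?thesis .
qed

text \<open>The left-hand side has the shape of a product in the path algebra acting on a vector.\<close>

lemma (in module) finsum_convolution:
  assumes fin: "finite S" "\<And>u. finite (T u)"
    and a: "\<And>u. a u \<in> carrier R" and b: "\<And>v. b v \<in> carrier R"
    and x: "\<And>u v. \<lbrakk>u \<in> S; v \<in> T u\<rbrakk> \<Longrightarrow> x (c u v) \<in> carrier M"
  shows "(\<Oplus>\<^bsub>M\<^esub>w\<in>{w. \<exists>u\<in>S. \<exists>v\<in>T u. w = c u v}.
      finsum R (\<lambda>(u, v). a u \<otimes>\<^bsub>R\<^esub> b v) {(u, v). u \<in> S \<and> v \<in> T u \<and> c u v = w} \<odot>\<^bsub>M\<^esub> x w) =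
    (\<Oplus>\<^bsub>M\<^esub>u\<in>S. a u \<odot>\<^bsub>M\<^esub> (\<Oplus>\<^bsub>M\<^esub>v\<in>T u. b v \<odot>\<^bsub>M\<^esub> x (c u v)))"
proof -
  let ?W = "{w. \<exists>u\<in>S. \<exists>v\<in>T u. w = c u v}"
  let ?g = "\<lambda>(u, v). (a u \<otimes>\<^bsub>R\<^esub> b v) \<odot>\<^bsub>M\<^esub> x (c u v)"
  let ?fib = "\<lambda>w. {(u, v). u \<in> S \<and> v \<in> T u \<and> c u v = w}"
  have g: "?g y \<in> carrier M" if "y \<in> Sigma S T" for y
    using that a b x by auto
  have W: "?W = (\<lambda>(u, v). c u v) ` Sigma S T" by auto
  have finW: "finite ?W" unfolding W using fin by (intro finite_imageI finite_SigmaI)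
  have fib: "?fib w = {y \<in> Sigma S T. (case y of (u, v) \<Rightarrow> c u v) = w}" for w by auto
  \<comment> \<open>Each coefficient is a sum over the fibre of \<open>c\<close> above
    \<open>w\<close>. The scalar action distributes over it, and on that fibre \<open>w\<close> may
    be written as \<open>c u v\<close>.\<close>
  have "(\<Oplus>\<^bsub>M\<^esub>w\<in>?W. finsum R (\<lambda>(u, v). a u \<otimes>\<^bsub>R\<^esub> b v) (?fib w) \<odot>\<^bsub>M\<^esub> x w) =
      (\<Oplus>\<^bsub>M\<^esub>w\<in>?W. finsum M ?g (?fib w))"
  proof (rule M.finsum_cong'[OF refl])
    show "(\<lambda>w. finsum M ?g (?fib w)) \<in> ?W \<rightarrow> carrier M"
      using g by (intro funcsetI M.finsum_closed) (auto simp: fib)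
    fix w assume "w \<in> ?W"
    then have "x w \<in> carrier M" using x by auto
    then have "finsum R (\<lambda>(u, v). a u \<otimes>\<^bsub>R\<^esub> b v) (?fib w) \<odot>\<^bsub>M\<^esub> x w =
        (\<Oplus>\<^bsub>M\<^esub>y\<in>?fib w. (case y of (u, v) \<Rightarrow> a u \<otimes>\<^bsub>R\<^esub> b v) \<odot>\<^bsub>M\<^esub> x w)"
      using a b by (intro finsum_smult_r) auto
    also have "\<dots> = finsum M ?g (?fib w)"
      using g by (intro M.finsum_cong') auto
    finally show "finsum R (\<lambda>(u, v). a u \<otimes>\<^bsub>R\<^esub> b v) (?fib w) \<odot>\<^bsub>M\<^esub> x w = finsum M ?g (?fib w)" .
  qed
  \<comment> \<open>Two groupings of the same pairs: the fibres of \<open>c\<close> are glued to all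
    of \<open>Sigma S T\<close>, which is then cut again along the first coordinate.\<close>
  also have "\<dots> = finsum M ?g (Sigma S T)"
    unfolding fib using fin finW g
    by (intro finsum_fibres[symmetric] finite_SigmaI) auto
  also have "\<dots> = (\<Oplus>\<^bsub>M\<^esub>u\<in>S. finsum M ?g {y \<in> Sigma S T. fst y = u})"
    using fin g by (intro finsum_fibres finite_SigmaI) auto
  also have "\<dots> = (\<Oplus>\<^bsub>M\<^esub>u\<in>S. a u \<odot>\<^bsub>M\<^esub> (\<Oplus>\<^bsub>M\<^esub>v\<in>T u. b v \<odot>\<^bsub>M\<^esub> x (c u v)))"
  proof (rule M.finsum_cong'[OF refl])
    show "(\<lambda>u. a u \<odot>\<^bsub>M\<^esub> (\<Oplus>\<^bsub>M\<^esub>v\<in>T u. b v \<odot>\<^bsub>M\<^esub> x (c u v))) \<in> S \<rightarrow> carrier M"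
      using a b x by (intro funcsetI smult_closed M.finsum_closed) auto
    fix u assume u: "u \<in> S"
    then have "{y \<in> Sigma S T. fst y = u} = Pair u ` T u" by auto
    moreover have "finsum M ?g (Pair u ` T u) = (\<Oplus>\<^bsub>M\<^esub>v\<in>T u. ?g (u, v))"
      using u a b x by (intro M.finsum_reindex) (auto simp: inj_on_def)
    moreover have "\<dots> = (\<Oplus>\<^bsub>M\<^esub>v\<in>T u. a u \<odot>\<^bsub>M\<^esub> (b v \<odot>\<^bsub>M\<^esub> x (c u v)))"
      using u a b x by (intro M.finsum_cong') (auto simp: smult_assoc1)
    moreover have "\<dots> = a u \<odot>\<^bsub>M\<^esub> (\<Oplus>\<^bsub>M\<^esub>v\<in>T u. b v \<odot>\<^bsub>M\<^esub> x (c u v))"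
      using u a b x by (intro finsum_smult[symmetric]) auto
    ultimately show "finsum M ?g {y \<in> Sigma S T. fst y = u} =
        a u \<odot>\<^bsub>M\<^esub> (\<Oplus>\<^bsub>M\<^esub>v\<in>T u. b v \<odot>\<^bsub>M\<^esub> x (c u v))"
      by simp
  qed
  finally show ?thesis .
qed

lemma (in module) submodule_finsum_closed:
  assumes "submodule R N M" "\<And>a. a \<in> A \<Longrightarrow> g a \<in> N"
  shows "finsum M g A \<in> N"
proof -
  interpret N: submodule R N M by fact
  show ?thesis
    using assms(2)
  proof (induction A rule: infinite_finite_induct)
    case (insert a A)
    moreover have "g \<in> A \<rightarrow> carrier M" "g a \<in> carrier M"
      using insert.prems N.subset by auto
    ultimately show ?case by (simp add: finsum_insert)
  qed auto
qed

text \<open>Meant for the idempotent \<open>v\<^sub>i\<close>, which maps \<open>M\<close> onto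
  \<open>v\<^sub>i M\<close>.\<close>

lemma vectorspace_surj_fin_dim:
  assumes "vectorspace K V" "vectorspace K W" "T \<in> module_hom K V W"
    and "T ` carrier V = carrier W" "vectorspace.fin_dim K V"
  shows "vectorspace.fin_dim K W"
proof -
  interpret linear_map K V W T
    using assms by (simp add: linear_map_def mod_hom_def mod_hom_axioms_def vectorspace_def)
  show ?thesis using assms by (intro surj_fin_dim)
qed

section \<open>Homogeneous maps and decompositions into homogeneous components\<close>

lemma has_degreeI: "(\<And>a x. x \<in> grade V a \<Longrightarrow> f x \<in> grade W (a + d)) \<Longrightarrow> has_degree V W d f"
  unfolding has_degree_def by blast

lemma has_degreeD: "\<lbrakk>has_degree V W d f; x \<in> grade V a\<rbrakk> \<Longrightarrow> f x \<in> grade W (a + d)"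
  unfolding has_degree_def by blast

text \<open>Breaks the subspace and sum conditions of the locale into pointwise ones, the form in
  which they are checked for the direct sum and for the vertex spaces.\<close>

lemma super_vectorspaceI:
  assumes "vectorspace K V"
    and "\<And>d. grade V d \<subseteq> carrier V" "\<And>d. \<zero>\<^bsub>V\<^esub> \<in> grade V d"
    and "\<And>d x y. \<lbrakk>x \<in> grade V d; y \<in> grade V d\<rbrakk> \<Longrightarrow> x \<oplus>\<^bsub>V\<^esub> y \<in> grade V d"
    and "\<And>d c x. \<lbrakk>c \<in> carrier K; x \<in> grade V d\<rbrakk> \<Longrightarrow> c \<odot>\<^bsub>V\<^esub> x \<in> grade V d"
    and "\<And>x. x \<in> carrier V \<Longrightarrow> \<exists>a\<in>grade V 0. \<exists>b\<in>grade V 1. x = a \<oplus>\<^bsub>V\<^esub> b"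
    and "\<And>x. \<lbrakk>x \<in> grade V 0; x \<in> grade V 1\<rbrakk> \<Longrightarrow> x = \<zero>\<^bsub>V\<^esub>"
  shows "super_vectorspace K V"
proof -
  interpret vectorspace K V by fact
  have "subspace K (grade V d) V" for d
    using assms by (simp add: subspace_def submodule_def module_axioms)
  moreover have "carrier V = submodule_sum (grade V 0) (grade V 1)"
    using assms(6) assms(2) by (fastforce simp: submodule_sum_def image_iff)
  moreover have "grade V 0 \<inter> grade V 1 = {\<zero>\<^bsub>V\<^esub>}"
    using assms(3,7) by blast
  ultimately show ?thesis
    using assms(1) by (simp add: super_vectorspace_def super_vectorspace_axioms_def)
qed

context super_vectorspace
begin

lemma grade_closed: "x \<in> grade V d \<Longrightarrow> x \<in> carrier V"
  and grade_zero: "\<zero>\<^bsub>V\<^esub> \<in> grade V d"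
  and grade_add: "\<lbrakk>x \<in> grade V d; y \<in> grade V d\<rbrakk> \<Longrightarrow> x \<oplus>\<^bsub>V\<^esub> y \<in> grade V d"
  and grade_smult: "\<lbrakk>c \<in> carrier K; x \<in> grade V d\<rbrakk> \<Longrightarrow> c \<odot>\<^bsub>V\<^esub> x \<in> grade V d"
  using grade_subspace[of d] by (auto simp: subspace_def submodule_def)

lemma grade_minus: "x \<in> grade V d \<Longrightarrow> \<ominus>\<^bsub>V\<^esub> x \<in> grade V d"
  using grade_smult[of "\<ominus>\<^bsub>K\<^esub> \<one>\<^bsub>K\<^esub>" x d] grade_closed[of x d]
  by (simp add: smult_minus_1)

text \<open>In \<open>bit\<close> the degree other than \<open>d\<close> is \<open>d + 1\<close>.
  Written in this way, the facts about a decomposition cover both degrees at once.\<close>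

lemma grade_inter: "\<lbrakk>x \<in> grade V d; x \<in> grade V (d + 1)\<rbrakk> \<Longrightarrow> x = \<zero>\<^bsub>V\<^esub>"
  using grade_disjoint by (cases d) auto

lemma grade_decomp:
  assumes "x \<in> carrier V"
  obtains a b where "a \<in> grade V d" "b \<in> grade V (d + 1)" "x = a \<oplus>\<^bsub>V\<^esub> b"
proof -
  obtain a b where ab: "a \<in> grade V 0" "b \<in> grade V 1" "x = a \<oplus>\<^bsub>V\<^esub> b"
    using assms grade_sum by (auto simp: submodule_sum_def)
  \<comment> \<open>For \<open>d = 1\<close> the odd summand has to come first.\<close>
  then have "x = b \<oplus>\<^bsub>V\<^esub> a"
    using M.a_comm grade_closed by blast
  with ab that show ?thesis by (cases d) auto
qed

text \<open>The difference of \<open>a\<close> and \<open>a'\<close> equals that of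
  \<open>b'\<close> and \<open>b\<close>, so it lies in both degrees and vanishes.\<close>

lemma grade_decomp_unique:
  assumes "a \<in> grade V d" "b \<in> grade V (d + 1)" "a' \<in> grade V d" "b' \<in> grade V (d + 1)"
    and eq: "a \<oplus>\<^bsub>V\<^esub> b = a' \<oplus>\<^bsub>V\<^esub> b'"
  shows "a = a'"
proof -
  have c: "a \<in> carrier V" "b \<in> carrier V" "a' \<in> carrier V" "b' \<in> carrier V"
    using assms grade_closed by auto
  have "a \<oplus>\<^bsub>V\<^esub> \<ominus>\<^bsub>V\<^esub> a' = (a \<oplus>\<^bsub>V\<^esub> b) \<oplus>\<^bsub>V\<^esub> (\<ominus>\<^bsub>V\<^esub> a' \<oplus>\<^bsub>V\<^esub> \<ominus>\<^bsub>V\<^esub> b)"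
    using c by (simp add: M.a_ac M.r_neg M.r_neg2)
  also have "\<dots> = (a' \<oplus>\<^bsub>V\<^esub> \<ominus>\<^bsub>V\<^esub> a') \<oplus>\<^bsub>V\<^esub> (b' \<oplus>\<^bsub>V\<^esub> \<ominus>\<^bsub>V\<^esub> b)"
    using c unfolding eq by (simp add: M.a_ac)
  also have "\<dots> = b' \<oplus>\<^bsub>V\<^esub> \<ominus>\<^bsub>V\<^esub> b"
    using c by (simp add: M.r_neg)
  finally have e: "a \<oplus>\<^bsub>V\<^esub> \<ominus>\<^bsub>V\<^esub> a' = b' \<oplus>\<^bsub>V\<^esub> \<ominus>\<^bsub>V\<^esub> b" .
  have "a \<oplus>\<^bsub>V\<^esub> \<ominus>\<^bsub>V\<^esub> a' \<in> grade V d" "b' \<oplus>\<^bsub>V\<^esub> \<ominus>\<^bsub>V\<^esub> b \<in> grade V (d + 1)"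
    by (intro grade_add grade_minus assms)+
  then have "a \<oplus>\<^bsub>V\<^esub> \<ominus>\<^bsub>V\<^esub> a' = \<zero>\<^bsub>V\<^esub>"
    using e grade_inter by metis
  then show ?thesis
    using c by (metis M.minus_equality M.minus_minus M.add.inv_closed)
qed

end

text \<open>The projection onto degree \<open>d\<close> along degree \<open>d + 1\<close>. The
  description determines a value on the carrier only, where the decomposition exists and is
  unique.\<close>

definition grade_proj :: "('k, 'v, 'x) super_space_scheme \<Rightarrow> bit \<Rightarrow> 'v \<Rightarrow> 'v" where
  "grade_proj V d x = (THE a. a \<in> grade V d \<and> (\<exists>b \<in> grade V (d + 1). x = a \<oplus>\<^bsub>V\<^esub> b))"

context super_vectorspace
begin

lemma grade_proj_eq:
  assumes "a \<in> grade V d" "b \<in> grade V (d + 1)"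
  shows "grade_proj V d (a \<oplus>\<^bsub>V\<^esub> b) = a"
  unfolding grade_proj_def
proof (rule the_equality)
  fix a' assume "a' \<in> grade V d \<and> (\<exists>b'\<in>grade V (d + 1). a \<oplus>\<^bsub>V\<^esub> b = a' \<oplus>\<^bsub>V\<^esub> b')"
  then obtain b' where "a' \<in> grade V d" "b' \<in> grade V (d + 1)" "a \<oplus>\<^bsub>V\<^esub> b = a' \<oplus>\<^bsub>V\<^esub> b'"
    by blast
  then show "a' = a" using grade_decomp_unique[of a d b a' b'] assms by simp
qed (use assms in auto)

lemma grade_proj_in: "x \<in> carrier V \<Longrightarrow> grade_proj V d x \<in> grade V d"
  by (metis grade_decomp grade_proj_eq)

lemma grade_proj_closed: "x \<in> carrier V \<Longrightarrow> grade_proj V d x \<in> carrier V"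
  using grade_proj_in grade_closed by blast

lemma grade_proj_decomp:
  assumes "x \<in> carrier V"
  shows "grade_proj V d x \<oplus>\<^bsub>V\<^esub> grade_proj V (d + 1) x = x"
proof -
  obtain a b where ab: "a \<in> grade V d" "b \<in> grade V (d + 1)" "x = a \<oplus>\<^bsub>V\<^esub> b"
    by (rule grade_decomp[OF assms])
  have x: "x = b \<oplus>\<^bsub>V\<^esub> a"
    using ab M.a_comm grade_closed by blast
  \<comment> \<open>Since \<open>d + 1 + 1 = d\<close> in \<open>bit\<close>, the swapped sum is the
    decomposition relative to degree \<open>d + 1\<close>.\<close>
  have "a \<in> grade V (d + 1 + 1)" using ab(1) by (cases d) auto
  then have "grade_proj V (d + 1) x = b"
    unfolding x by (intro grade_proj_eq ab)
  moreover have "grade_proj V d x = a"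
    unfolding ab(3) by (intro grade_proj_eq ab)
  ultimately show ?thesis by (simp add: ab(3))
qed

text \<open>Decompositions add and scale termwise, and \<open>grade_proj_eq\<close> reads off the
  first component of the result.\<close>

lemma grade_proj_hom: "grade_proj V d \<in> module_hom K V V"
proof (rule module_homI)
  fix x y assume xy: "x \<in> carrier V" "y \<in> carrier V"
  obtain a b where ab: "a \<in> grade V d" "b \<in> grade V (d + 1)" "x = a \<oplus>\<^bsub>V\<^esub> b"
    by (rule grade_decomp[OF xy(1)])
  obtain a' b' where ab': "a' \<in> grade V d" "b' \<in> grade V (d + 1)" "y = a' \<oplus>\<^bsub>V\<^esub> b'"
    by (rule grade_decomp[OF xy(2)])
  have c: "a \<in> carrier V" "b \<in> carrier V" "a' \<in> carrier V" "b' \<in> carrier V"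
    using ab ab' grade_closed by auto
  have "x \<oplus>\<^bsub>V\<^esub> y = (a \<oplus>\<^bsub>V\<^esub> a') \<oplus>\<^bsub>V\<^esub> (b \<oplus>\<^bsub>V\<^esub> b')"
    using c by (simp add: ab ab' M.a_ac)
  then show "grade_proj V d (x \<oplus>\<^bsub>V\<^esub> y) = grade_proj V d x \<oplus>\<^bsub>V\<^esub> grade_proj V d y"
    using ab ab' by (simp add: grade_proj_eq grade_add)
next
  fix c x assume cx: "c \<in> carrier K" "x \<in> carrier V"
  obtain a b where ab: "a \<in> grade V d" "b \<in> grade V (d + 1)" "x = a \<oplus>\<^bsub>V\<^esub> b"
    by (rule grade_decomp[OF cx(2)])
  then have "c \<odot>\<^bsub>V\<^esub> x = c \<odot>\<^bsub>V\<^esub> a \<oplus>\<^bsub>V\<^esub> c \<odot>\<^bsub>V\<^esub> b"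
    using cx grade_closed by (simp add: smult_r_distr)
  then show "grade_proj V d (c \<odot>\<^bsub>V\<^esub> x) = c \<odot>\<^bsub>V\<^esub> grade_proj V d x"
    using ab cx by (simp add: grade_proj_eq grade_smult)
qed (rule grade_proj_closed)

lemma grade_proj_id: "x \<in> grade V d \<Longrightarrow> grade_proj V d x = x"
  and grade_proj_other: "x \<in> grade V d \<Longrightarrow> grade_proj V (d + 1) x = \<zero>\<^bsub>V\<^esub>"
  using grade_proj_eq[of x d "\<zero>\<^bsub>V\<^esub>"] grade_proj_eq[of "\<zero>\<^bsub>V\<^esub>" "d + 1" x] grade_closed[of x d]
    grade_zero
  by (cases d; simp)+

end

text \<open>A map of degree \<open>d\<close> sends the two components of \<open>x\<close> to
  components of complementary degrees \<open>a + d\<close> and \<open>a + d + 1\<close>, so by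
  uniqueness it sends the decomposition of \<open>x\<close> to that of \<open>f x\<close>.\<close>

lemma grade_proj_natural:
  assumes V: "super_vectorspace K V" and W: "super_vectorspace K W"
    and f: "f \<in> module_hom K V W" "has_degree V W d f" and x: "x \<in> carrier V"
  shows "f (grade_proj V a x) = grade_proj W (a + d) (f x)"
proof -
  interpret V: super_vectorspace K V by fact
  interpret W: super_vectorspace K W by fact
  have "f x = f (grade_proj V a x) \<oplus>\<^bsub>W\<^esub> f (grade_proj V (a + 1) x)"
    using V.grade_proj_decomp[OF x, of a] module_hom_add[OF f(1)] V.grade_proj_closed[OF x] by metis
  moreover have "f (grade_proj V a x) \<in> grade W (a + d)"
    "f (grade_proj V (a + 1) x) \<in> grade W (a + d + 1)"
    using has_degreeD[OF f(2) V.grade_proj_in[OF x, of a]]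
      has_degreeD[OF f(2) V.grade_proj_in[OF x, of "a + 1"]] by (simp_all only: add_ac)
  ultimately show ?thesis by (simp add: W.grade_proj_eq)
qed

text \<open>The component of degree \<open>d\<close> of \<open>f\<close> in the induced grading of
  the space of linear maps: out of the four blocks of \<open>f\<close> it keeps the two that raise
  the degree by \<open>d\<close>.\<close>

definition degree_part ::
    "('k, 'v, 'x) super_space_scheme \<Rightarrow> ('k, 'w, 'y) super_space_scheme \<Rightarrow> bit
      \<Rightarrow> ('v \<Rightarrow> 'w) \<Rightarrow> 'v \<Rightarrow> 'w" where
  "degree_part V W d f x =
    grade_proj W d (f (grade_proj V 0 x)) \<oplus>\<^bsub>W\<^esub> grade_proj W (1 + d) (f (grade_proj V 1 x))"

context
  fixes K V W f
  assumes V: "super_vectorspace K V" and W: "super_vectorspace K W"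
    and f: "f \<in> module_hom K V W"
begin

interpretation V: super_vectorspace K V by (rule V)
interpretation W: super_vectorspace K W by (rule W)

lemma degree_part_hom: "degree_part V W d f \<in> module_hom K V W"
  unfolding degree_part_def
  by (intro module_hom_sum module_hom_comp[OF _ W.grade_proj_hom] module_hom_comp[OF _ f]
      V.grade_proj_hom W.module_axioms)

text \<open>On a homogeneous vector one of the two inner projections is the identity and the other
  is zero, so just one block acts.\<close>

lemma degree_part_degree: "has_degree V W d (degree_part V W d f)"
proof -
  note fc = module_hom_apply_closed[OF f]
  have f0: "f \<zero>\<^bsub>V\<^esub> = \<zero>\<^bsub>W\<^esub>" by (rule module_hom_zero[OF V.module_axioms W.module_axioms f])
  have p0: "grade_proj W d \<zero>\<^bsub>W\<^esub> = \<zero>\<^bsub>W\<^esub>" for d by (intro W.grade_proj_id W.grade_zero)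
  have "degree_part V W d f x \<in> grade W (a + d)" if "x \<in> grade V a" for x a
  proof (cases a)
    case zero
    then show ?thesis
      using that V.grade_closed[OF that] V.grade_proj_id[of x 0] V.grade_proj_other[of x 0]
      by (simp add: degree_part_def f0 p0 fc W.grade_proj_closed W.grade_proj_in)
  next
    case one
    then show ?thesis
      using that V.grade_closed[OF that] V.grade_proj_id[of x 1] V.grade_proj_other[of x 1]
      by (simp add: degree_part_def f0 p0 fc W.grade_proj_closed W.grade_proj_in)
  qed
  then show ?thesis by (rule has_degreeI)
qed

text \<open>The two parts together contain all four blocks of \<open>f\<close>. Regrouped by the
  degree of the input, the blocks recombine to the images of the two components of
  \<open>x\<close>.\<close>

lemma degree_part_sum:
  assumes x: "x \<in> carrier V"
  shows "degree_part V W 0 f x \<oplus>\<^bsub>W\<^esub> degree_part V W 1 f x = f x"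
proof -
  let ?y = "f (grade_proj V 0 x)" and ?z = "f (grade_proj V 1 x)"
  have c: "?y \<in> carrier W" "?z \<in> carrier W"
    using x by (auto intro: module_hom_apply_closed[OF f] V.grade_proj_closed)
  have "degree_part V W 0 f x \<oplus>\<^bsub>W\<^esub> degree_part V W 1 f x =
      (grade_proj W 0 ?y \<oplus>\<^bsub>W\<^esub> grade_proj W (0 + 1) ?y) \<oplus>\<^bsub>W\<^esub>
      (grade_proj W 0 ?z \<oplus>\<^bsub>W\<^esub> grade_proj W (0 + 1) ?z)"
    using c by (simp add: degree_part_def W.grade_proj_closed W.M.a_ac)
  also have "\<dots> = ?y \<oplus>\<^bsub>W\<^esub> ?z"
    by (simp only: c W.grade_proj_decomp)
  also have "\<dots> = f x"
    using V.grade_proj_decomp[OF x, of 0] module_hom_add[OF f] V.grade_proj_closed[OF x]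
    by (metis add_0)
  finally show ?thesis .
qed

end

text \<open>\<open>g\<close> and \<open>h\<close> have the same degree \<open>c\<close>, so the
  square commutes block by block: source and target degree of a block are both shifted by
  \<open>c\<close> and their difference \<open>d\<close> is preserved. With the maps of an arrow as
  \<open>g\<close> and \<open>h\<close>, the parts of an intertwiner intertwine again.\<close>

lemma degree_part_natural:
  assumes V: "super_vectorspace K V" "super_vectorspace K V'"
    and W: "super_vectorspace K W" "super_vectorspace K W'"
    and f: "f \<in> module_hom K V W" and f': "f' \<in> module_hom K V' W'"
    and g: "g \<in> module_hom K V V'" "has_degree V V' c g"
    and h: "h \<in> module_hom K W W'" "has_degree W W' c h"
    and comm: "\<And>x. x \<in> carrier V \<Longrightarrow> f' (g x) = h (f x)"
    and x: "x \<in> carrier V"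
  shows "degree_part V' W' d f' (g x) = h (degree_part V W d f x)"
proof -
  interpret V: super_vectorspace K V by fact
  interpret V': super_vectorspace K V' by fact
  interpret W: super_vectorspace K W by fact
  interpret W': super_vectorspace K W' by fact
  have gx: "g x \<in> carrier V'" by (rule module_hom_apply_closed[OF g(1) x])
  have fc: "f (grade_proj V a x) \<in> carrier W" for a
    by (intro module_hom_apply_closed[OF f] V.grade_proj_closed x)
  have pf: "grade_proj W b (f (grade_proj V a x)) \<in> carrier W" for a b
    by (intro W.grade_proj_closed fc)
  have key: "grade_proj W' (b + c) (f' (grade_proj V' (a + c) (g x))) =
      h (grade_proj W b (f (grade_proj V a x)))" for a b
  proof -
    have "f' (grade_proj V' (a + c) (g x)) = h (f (grade_proj V a x))"
      using grade_proj_natural[OF V g x, of a] comm[OF V.grade_proj_closed[OF x, of a]] by simp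
    then show ?thesis using grade_proj_natural[OF W h fc] by simp
  qed
  have c: "grade_proj W' b (f' (grade_proj V' a (g x))) \<in> carrier W'" for a b
    by (intro W'.grade_proj_closed module_hom_apply_closed[OF f'] V'.grade_proj_closed gx)
  have "h (degree_part V W d f x) =
      grade_proj W' (d + c) (f' (grade_proj V' (0 + c) (g x))) \<oplus>\<^bsub>W'\<^esub>
      grade_proj W' (1 + d + c) (f' (grade_proj V' (1 + c) (g x)))"
    unfolding key by (simp add: degree_part_def module_hom_add[OF h(1)] pf)
  \<comment> \<open>For \<open>c = 0\<close> this is the definition; for \<open>c = 1\<close> the
    two blocks appear in the opposite order.\<close>
  also have "\<dots> = degree_part V' W' d f' (g x)"
    by (cases c) (auto simp: degree_part_def W'.M.a_comm c add_ac)
  finally show ?thesis by simp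
qed

section \<open>Paths\<close>

lemma path_simps [simp]:
  "path_source (u, es, v) = u" "path_target (u, es, v) = v"
  "path_concat (u, es, v) (u', es', v') = (u', es' @ es, v)"
  "path_source (trivial_path i) = i" "path_target (trivial_path i) = i"
  "path_source (arrow_path Q e) = tail Q e" "path_target (arrow_path Q e) = head Q e"
  "path_source (path_concat x y) = path_source y" "path_target (path_concat x y) = path_target x"
  by (simp_all add: path_source_def path_target_def path_concat_def trivial_path_def arrow_path_def)

lemma path_concat_trivial:
  "path_concat x (trivial_path (path_source x)) = x"
  "path_concat (trivial_path (path_target x)) x = x"
  by (cases x; simp add: trivial_path_def)+

lemma path_parity_trivial [simp]: "path_parity Q p (trivial_path i) = 0"
  and path_parity_arrow [simp]: "path_parity Q p (arrow_path Q e) = p (tail Q e) + p (head Q e)"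
  by (simp_all add: path_parity_def trivial_path_def arrow_path_def)

lemma trivial_path_inject [simp]: "trivial_path i = trivial_path j \<longleftrightarrow> i = j"
  by (simp add: trivial_path_def)

text \<open>The set of arrows may be infinite and cycles are allowed, so the path algebra may be
  infinite-dimensional; finiteness of supports has to be tracked for its elements.\<close>

locale finite_quiver = K: field K + Q: wf_digraph Q
  for K :: "('k, 'r) ring_scheme" and Q :: "('q, 'e) pre_digraph" and p :: "'q \<Rightarrow> bit" +
  assumes finite_verts: "finite (verts Q)"
begin

lemma paths_iff [simp]: "(u, es, v) \<in> paths Q \<longleftrightarrow> Q.awalk u es v"
  by (simp add: paths_def)

lemma path_ends [simp]: "w \<in> paths Q \<Longrightarrow> path_source w \<in> verts Q"
  "w \<in> paths Q \<Longrightarrow> path_target w \<in> verts Q"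
  by (cases w; auto dest: Q.awalk_hd_in_verts Q.awalk_last_in_verts)+

lemma trivial_path_in [simp]: "i \<in> verts Q \<Longrightarrow> trivial_path i \<in> paths Q"
  by (simp add: trivial_path_def Q.awalk_Nil_iff)

lemma arrow_path_in [simp]: "e \<in> arcs Q \<Longrightarrow> arrow_path Q e \<in> paths Q"
  by (simp add: arrow_path_def Q.arc_implies_awalk)

lemma path_concat_in:
  "\<lbrakk>x \<in> paths Q; y \<in> paths Q; path_source x = path_target y\<rbrakk> \<Longrightarrow> path_concat x y \<in> paths Q"
  by (cases x; cases y) (auto intro: Q.awalk_appendI)

lemma support_basis_elt [simp]: "support K (basis_elt K w) = {w}"
  by (auto simp: support_def basis_elt_def)

lemma basis_elt_closed [simp]: "w \<in> paths Q \<Longrightarrow> basis_elt K w \<in> carrier (path_algebra K Q)"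
  by (auto simp: path_algebra_def) (simp add: basis_elt_def)

lemma path_algebra_carrier:
  assumes "a \<in> carrier (path_algebra K Q)"
  shows "a w \<in> carrier K" "support K a \<subseteq> paths Q" "finite (support K a)"
  using assms unfolding path_algebra_def by (cases w; simp)+

lemma not_support: "w \<notin> support K a \<Longrightarrow> a w = \<zero>\<^bsub>K\<^esub>"
  by (simp add: support_def)

lemma path_algebra_carrierI:
  assumes "\<And>w. a w \<in> carrier K" "support K a \<subseteq> S" "finite S" "S \<subseteq> paths Q"
  shows "a \<in> carrier (path_algebra K Q)"
proof -
  have "(\<forall>w. a w \<in> carrier K) \<and> support K a \<subseteq> paths Q \<and> finite (support K a)"
    using assms by (meson finite_subset subset_trans)
  then show ?thesis by (simp add: path_algebra_def)
qed

section \<open>Products in the path algebra\<close>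

lemma path_algebra_mult:
  "(a \<otimes>\<^bsub>path_algebra K Q\<^esub> b) w = finsum K (\<lambda>(u, v). a u \<otimes>\<^bsub>K\<^esub> b v)
    {(u, v). u \<in> support K a \<and> v \<in> support K b \<and> path_source u = path_target v \<and> path_concat u v = w}"
  by (simp add: path_algebra_def)

text \<open>Only an upper bound for the support of the product, since the contributions of different
  factorisations of a path may cancel.\<close>

abbreviation composites :: "(('q, 'e) path \<Rightarrow> 'k) \<Rightarrow> (('q, 'e) path \<Rightarrow> 'k) \<Rightarrow> ('q, 'e) path set" where
  "composites a b \<equiv> {w. \<exists>u\<in>support K a. \<exists>v\<in>support K b. path_source u = path_target v \<and> w = path_concat u v}"

text \<open>A path that is not such a composite has no factorisation, so its coefficient is an empty
  sum.\<close>

lemma support_mult: "support K (a \<otimes>\<^bsub>path_algebra K Q\<^esub> b) \<subseteq> composites a b"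
proof (rule subsetI, rule ccontr)
  fix w assume w: "w \<in> support K (a \<otimes>\<^bsub>path_algebra K Q\<^esub> b)" "w \<notin> composites a b"
  then have "{(u, v). u \<in> support K a \<and> v \<in> support K b \<and> path_source u = path_target v \<and>
      path_concat u v = w} = {}"
    by blast
  then have "(a \<otimes>\<^bsub>path_algebra K Q\<^esub> b) w = \<zero>\<^bsub>K\<^esub>"
    unfolding path_algebra_mult by (simp only: K.finsum_empty)
  with w(1) show False by (simp add: support_def)
qed

lemma finite_composites:
  assumes "a \<in> carrier (path_algebra K Q)" "b \<in> carrier (path_algebra K Q)"
  shows "finite (composites a b)" "composites a b \<subseteq> paths Q"
proof -
  note f = path_algebra_carrier(2,3)[OF assms(1)] path_algebra_carrier(2,3)[OF assms(2)]
  have "composites a b \<subseteq> (\<lambda>(u, v). path_concat u v) ` (support K a \<times> support K b)"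
    by blast
  then show "finite (composites a b)" using f by (meson finite_imageI finite_SigmaI finite_subset)
  show "composites a b \<subseteq> paths Q" using f path_concat_in by blast
qed

lemma path_algebra_mult_closed:
  assumes a: "a \<in> carrier (path_algebra K Q)" and b: "b \<in> carrier (path_algebra K Q)"
  shows "a \<otimes>\<^bsub>path_algebra K Q\<^esub> b \<in> carrier (path_algebra K Q)"
proof (rule path_algebra_carrierI[OF _ support_mult finite_composites[OF a b]])
  fix w show "(a \<otimes>\<^bsub>path_algebra K Q\<^esub> b) w \<in> carrier K"
    unfolding path_algebra_mult
    using path_algebra_carrier(1)[OF a] path_algebra_carrier(1)[OF b]
    by (intro K.finsum_closed) auto
qed

text \<open>At most one pair enters the sum that defines a coefficient.\<close>

lemma basis_elt_mult:
  "basis_elt K x \<otimes>\<^bsub>path_algebra K Q\<^esub> basis_elt K y =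
    (if path_source x = path_target y then basis_elt K (path_concat x y) else (\<lambda>w. \<zero>\<^bsub>K\<^esub>))"
proof -
  have "{(x', y'). x' = x \<and> y' = y \<and> path_source x' = path_target y' \<and> path_concat x' y' = w}
      = (if path_source x = path_target y \<and> path_concat x y = w then {(x, y)} else {})" for w
    by auto
  then show ?thesis
    by (auto simp: path_algebra_def fun_eq_iff) (auto simp: basis_elt_def)
qed

text \<open>The multiple \<open>c 1\<close> of the unit as an explicit function, whose support can
  be read off. It makes a scalar act on a module as an element of the algebra.\<close>

definition one_coeff :: "'k \<Rightarrow> ('q, 'e) path \<Rightarrow> 'k" where
  "one_coeff c = (\<lambda>w. if w \<in> trivial_path ` verts Q then c else \<zero>\<^bsub>K\<^esub>)"

lemma one_coeff_closed: "c \<in> carrier K \<Longrightarrow> one_coeff c \<in> carrier (path_algebra K Q)"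
proof -
  assume "c \<in> carrier K"
  moreover have "support K (one_coeff c) \<subseteq> trivial_path ` verts Q"
    by (auto simp: support_def one_coeff_def)
  ultimately show ?thesis
    using finite_subset[OF _ finite_imageI[OF finite_verts]]
    by (auto simp: path_algebra_def one_coeff_def)
qed

lemma smult_one: "c \<in> carrier K \<Longrightarrow> c \<odot>\<^bsub>path_algebra K Q\<^esub> \<one>\<^bsub>path_algebra K Q\<^esub> = one_coeff c"
  by (auto simp: path_algebra_def one_coeff_def)

lemma one_closed: "\<one>\<^bsub>path_algebra K Q\<^esub> \<in> carrier (path_algebra K Q)"
  using one_coeff_closed[of "\<one>\<^bsub>K\<^esub>"] by (simp add: path_algebra_def one_coeff_def)

text \<open>Among the trivial paths only the one at the source of \<open>w\<close> composes with
  \<open>w\<close>, so a single pair contributes; for \<open>c = 0\<close> the support of the right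
  factor is empty and no pair does.\<close>

lemma mult_one_coeff:
  assumes "w \<in> paths Q" "c \<in> carrier K"
  shows "basis_elt K w \<otimes>\<^bsub>path_algebra K Q\<^esub> one_coeff c = c \<odot>\<^bsub>path_algebra K Q\<^esub> basis_elt K w"
proof -
  have "support K (one_coeff c) = (if c = \<zero>\<^bsub>K\<^esub> then {} else trivial_path ` verts Q)"
    by (auto simp: support_def one_coeff_def)
  then have "{(x', y'). x' = w \<and> y' \<in> support K (one_coeff c) \<and> path_source x' = path_target y'
        \<and> path_concat x' y' = w'}
      = (if c \<noteq> \<zero>\<^bsub>K\<^esub> \<and> w' = w then {(w, trivial_path (path_source w))} else {})" for w'
    using path_ends(1)[OF assms(1)] path_concat_trivial(1)[of w] by (auto simp del: split_paired_All)
  moreover have "one_coeff c (trivial_path (path_source w)) = c"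
    using assms by (simp add: one_coeff_def)
  ultimately show ?thesis
    using assms by (auto simp: path_algebra_def fun_eq_iff) (auto simp: basis_elt_def)
qed

end


section \<open>The direct sum of a super-representation\<close>

locale srep_object = finite_quiver K Q p
  for K :: "('k, 'r) ring_scheme" and Q :: "('q, 'e) pre_digraph" and p :: "'q \<Rightarrow> bit" +
  fixes X :: "('q, 'e, 'k, 'v) srep"
  assumes object: "X \<in> srep_objects K Q p"
begin

lemma space_super: "i \<in> verts Q \<Longrightarrow> super_vectorspace K (space X i)"
  and space_fin_dim: "i \<in> verts Q \<Longrightarrow> vectorspace.fin_dim K (space X i)"
  using object by (auto simp: srep_objects_def fd_super_vectorspace_def)

lemma space_vs: "i \<in> verts Q \<Longrightarrow> vectorspace K (space X i)"
  using space_super by (simp add: super_vectorspace_def)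

lemma space_module: "i \<in> verts Q \<Longrightarrow> module K (space X i)"
  using space_vs by (simp add: vectorspace_def)

lemma amap_hom: "e \<in> arcs Q \<Longrightarrow> amap X e \<in> module_hom K (space X (tail Q e)) (space X (head Q e))"
  and amap_degree: "e \<in> arcs Q \<Longrightarrow>
    has_degree (space X (tail Q e)) (space X (head Q e)) (p (tail Q e) + p (head Q e)) (amap X e)"
  using object by (auto simp: srep_objects_def)

lemma fold_amap_hom:
  "Q.awalk u es v \<Longrightarrow> fold (amap X) es \<in> module_hom K (space X u) (space X v)"
proof (induction es arbitrary: u)
  case Nil
  then show ?case by (auto simp: Q.awalk_Nil_iff module_hom_def)
next
  case (Cons e es)
  then have "fold (amap X) es \<in> module_hom K (space X (head Q e)) (space X v)"
    and e: "e \<in> arcs Q" "u = tail Q e"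
    by (auto simp: Q.awalk_Cons_iff)
  from module_hom_comp[OF amap_hom[OF e(1)] this(1)] show ?case
    by (simp add: e(2) comp_def)
qed

end

section \<open>Elements of the direct sum and their components\<close>

lemma component_F_object:
  assumes "i \<in> verts Q"
  shows "component \<zero>\<^bsub>F_object K Q X\<^esub> i = \<zero>\<^bsub>space X i\<^esub>"
    and "component (x \<oplus>\<^bsub>F_object K Q X\<^esub> y) i = component x i \<oplus>\<^bsub>space X i\<^esub> component y i"
    and "component (c \<odot>\<^bsub>F_object K Q X\<^esub> x) i = c \<odot>\<^bsub>space X i\<^esub> component x i"
  using assms by (simp_all add: F_object_def)

lemma F_object_carrier_iff:
  "x \<in> carrier (F_object K Q X) \<longleftrightarrow>
    (\<exists>f \<in> \<Pi>\<^sub>E i \<in> verts Q. carrier (space X i). x = Family f)"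
  by (auto simp: F_object_def)

lemma F_object_grade_iff:
  "x \<in> grade (F_object K Q X) d \<longleftrightarrow>
    (\<exists>f \<in> \<Pi>\<^sub>E i \<in> verts Q. grade (space X i) d. x = Family f)"
  by (auto simp: F_object_def)

text \<open>The underlying families are extensional, so their values at the vertices determine them.
  Practically every equation in \<open>F(X)\<close> is proved through this rule.\<close>

lemma F_object_eqI:
  assumes "x \<in> carrier (F_object K Q X)" "y \<in> carrier (F_object K Q X)"
    and "\<And>i. i \<in> verts Q \<Longrightarrow> component x i = component y i"
  shows "x = y"
  using assms by (auto simp: F_object_carrier_iff intro: PiE_ext)

lemma component_closed:
  "\<lbrakk>x \<in> carrier (F_object K Q X); i \<in> verts Q\<rbrakk> \<Longrightarrow> component x i \<in> carrier (space X i)"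
  by (auto simp: F_object_carrier_iff PiE_iff)

lemma component_grade:
  "\<lbrakk>x \<in> grade (F_object K Q X) d; i \<in> verts Q\<rbrakk> \<Longrightarrow> component x i \<in> grade (space X i) d"
  by (auto simp: F_object_grade_iff PiE_iff)

lemma Family_closed:
  "(\<And>i. i \<in> verts Q \<Longrightarrow> g i \<in> carrier (space X i)) \<Longrightarrow>
    Family (\<lambda>i \<in> verts Q. g i) \<in> carrier (F_object K Q X)"
  by (auto simp: F_object_carrier_iff)

lemma Family_grade:
  "(\<And>i. i \<in> verts Q \<Longrightarrow> g i \<in> grade (space X i) d) \<Longrightarrow>
    Family (\<lambda>i \<in> verts Q. g i) \<in> grade (F_object K Q X) d"
  by (auto simp: F_object_grade_iff)

text \<open>The inclusion of the summand \<open>X(i)\<close> into the direct sum; its image will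
  turn out to be \<open>v\<^sub>i F(X)\<close>.\<close>

definition emb ::
    "('q, 'e) pre_digraph \<Rightarrow> ('q, 'e, 'k, ('q, 'a) vec_univ) srep \<Rightarrow> 'q
      \<Rightarrow> ('q, 'a) vec_univ \<Rightarrow> ('q, 'a) vec_univ" where
  "emb Q X i v = Family (\<lambda>j \<in> verts Q. if j = i then v else \<zero>\<^bsub>space X j\<^esub>)"

lemma component_emb: "j \<in> verts Q \<Longrightarrow> component (emb Q X i v) j = (if j = i then v else \<zero>\<^bsub>space X j\<^esub>)"
  by (simp add: emb_def)

text \<open>The map \<open>x\<^sub>w\<close> applied to the component at the source of
  \<open>w\<close>. The value is a vector at the target of \<open>w\<close>, not yet an element of
  the direct sum.\<close>

definition path_act ::
    "('q, 'e, 'k, ('q, 'a) vec_univ) srep \<Rightarrow> ('q, 'e) path \<Rightarrow> ('q, 'a) vec_univ \<Rightarrow> ('q, 'a) vec_univ" where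
  "path_act X w x = fold (amap X) (fst (snd w)) (component x (path_source w))"

lemma path_act_simps [simp]:
  "path_act X (u, es, v) x = fold (amap X) es (component x u)"
  "path_act X (trivial_path i) x = component x i"
  "path_act X (arrow_path Q e) x = amap X e (component x (tail Q e))"
  by (simp_all add: path_act_def trivial_path_def arrow_path_def path_source_def)

lemma path_act_concat:
  "path_act X (path_concat v w) x = fold (amap X) (fst (snd v)) (path_act X w x)"
  by (cases v; cases w) simp

text \<open>Vectors are taken from \<open>vec_univ\<close> from here on: a family of vectors is
  again a vector there, so \<open>F_object\<close> applies to \<open>X\<close>.\<close>

locale srep_family = srep_object K Q p X
  for K :: "('k, 'r) ring_scheme" and Q :: "('q, 'e) pre_digraph" and p :: "'q \<Rightarrow> bit"
    and X :: "('q, 'e, 'k, ('q, 'a) vec_univ) srep"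
begin

abbreviation F where "F \<equiv> F_object K Q X"

lemmas component_F = component_F_object[where K = K and Q = Q and X = X]
lemmas F_eqI = F_object_eqI[where K = K and Q = Q and X = X]
lemmas F_component_closed = component_closed[where K = K and Q = Q and X = X]
lemmas F_component_grade = component_grade[where K = K and Q = Q and X = X]

lemma F_zero_closed: "\<zero>\<^bsub>F\<^esub> \<in> carrier F"
proof -
  have "\<zero>\<^bsub>space X i\<^esub> \<in> carrier (space X i)" if "i \<in> verts Q" for i
  proof -
    interpret Xi: module K "space X i" by (rule space_module[OF that])
    show ?thesis by simp
  qed
  then have "Family (\<lambda>i\<in>verts Q. \<zero>\<^bsub>space X i\<^esub>) \<in> carrier F" by (rule Family_closed)
  then show ?thesis by (simp add: F_object_def)
qed

lemma F_add_closed: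
  assumes "x \<in> carrier F" "y \<in> carrier F"
  shows "x \<oplus>\<^bsub>F\<^esub> y \<in> carrier F"
proof -
  have "component x i \<oplus>\<^bsub>space X i\<^esub> component y i \<in> carrier (space X i)" if "i \<in> verts Q" for i
  proof -
    interpret Xi: module K "space X i" by (rule space_module[OF that])
    show ?thesis using assms that by (simp add: F_component_closed)
  qed
  then have "Family (\<lambda>i\<in>verts Q. component x i \<oplus>\<^bsub>space X i\<^esub> component y i) \<in> carrier F"
    by (rule Family_closed)
  then show ?thesis by (simp add: F_object_def)
qed

lemma F_smult_closed:
  assumes "c \<in> carrier K" "x \<in> carrier F"
  shows "c \<odot>\<^bsub>F\<^esub> x \<in> carrier F"
proof -
  have "c \<odot>\<^bsub>space X i\<^esub> component x i \<in> carrier (space X i)" if "i \<in> verts Q" for i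
  proof -
    interpret Xi: module K "space X i" by (rule space_module[OF that])
    show ?thesis using assms that by (simp add: F_component_closed)
  qed
  then have "Family (\<lambda>i\<in>verts Q. c \<odot>\<^bsub>space X i\<^esub> component x i) \<in> carrier F"
    by (rule Family_closed)
  then show ?thesis by (simp add: F_object_def)
qed

lemma F_vs: "vectorspace K F"
proof (rule vs_criteria)
  show "field K" by (rule K.field_axioms)
  show "\<forall>v\<in>carrier F. \<exists>w\<in>carrier F. v \<oplus>\<^bsub>F\<^esub> w = \<zero>\<^bsub>F\<^esub>"
  proof
    fix v assume v: "v \<in> carrier F"
    \<comment> \<open>The record has no field for negation, so the inverse is produced as the
      multiple by minus one.\<close>
    let ?w = "(\<ominus>\<^bsub>K\<^esub> \<one>\<^bsub>K\<^esub>) \<odot>\<^bsub>F\<^esub> v"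
    have w: "?w \<in> carrier F" by (intro F_smult_closed v) simp
    have "v \<oplus>\<^bsub>F\<^esub> ?w = \<zero>\<^bsub>F\<^esub>"
    proof (rule F_eqI)
      fix i assume i: "i \<in> verts Q"
      interpret Xi: module K "space X i" by (rule space_module[OF i])
      show "component (v \<oplus>\<^bsub>F\<^esub> ?w) i = component \<zero>\<^bsub>F\<^esub> i"
        using F_component_closed[OF v i] i by (simp add: component_F Xi.smult_minus_1 Xi.r_neg)
    qed (intro F_add_closed F_zero_closed v w)+
    with w show "\<exists>w\<in>carrier F. v \<oplus>\<^bsub>F\<^esub> w = \<zero>\<^bsub>F\<^esub>" ..
  qed
next
  show "\<forall>v w. v \<in> carrier F \<and> w \<in> carrier F \<longrightarrow> v \<oplus>\<^bsub>F\<^esub> w = w \<oplus>\<^bsub>F\<^esub> v"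
  proof (intro allI impI, elim conjE)
    fix v w assume vw: "v \<in> carrier F" "w \<in> carrier F"
    show "v \<oplus>\<^bsub>F\<^esub> w = w \<oplus>\<^bsub>F\<^esub> v"
    proof (rule F_eqI)
      fix i assume i: "i \<in> verts Q"
      interpret Xi: module K "space X i" by (rule space_module[OF i])
      show "component (v \<oplus>\<^bsub>F\<^esub> w) i = component (w \<oplus>\<^bsub>F\<^esub> v) i"
        using i vw F_component_closed[OF _ i] by (simp add: component_F Xi.M.a_comm)
    qed (intro F_add_closed vw)+
  qed
  show "\<forall>v w x. v \<in> carrier F \<and> w \<in> carrier F \<and> x \<in> carrier F \<longrightarrow>
      (v \<oplus>\<^bsub>F\<^esub> w) \<oplus>\<^bsub>F\<^esub> x = v \<oplus>\<^bsub>F\<^esub> (w \<oplus>\<^bsub>F\<^esub> x)"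
  proof (intro allI impI, elim conjE)
    fix v w x assume vw: "v \<in> carrier F" "w \<in> carrier F" "x \<in> carrier F"
    show "(v \<oplus>\<^bsub>F\<^esub> w) \<oplus>\<^bsub>F\<^esub> x = v \<oplus>\<^bsub>F\<^esub> (w \<oplus>\<^bsub>F\<^esub> x)"
    proof (rule F_eqI)
      fix i assume i: "i \<in> verts Q"
      interpret Xi: module K "space X i" by (rule space_module[OF i])
      show "component ((v \<oplus>\<^bsub>F\<^esub> w) \<oplus>\<^bsub>F\<^esub> x) i = component (v \<oplus>\<^bsub>F\<^esub> (w \<oplus>\<^bsub>F\<^esub> x)) i"
        using i vw F_component_closed[OF _ i] by (simp add: component_F Xi.M.a_assoc)
    qed (intro F_add_closed vw)+
  qed
  show "\<forall>v\<in>carrier F. v \<oplus>\<^bsub>F\<^esub> \<zero>\<^bsub>F\<^esub> = v"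
  proof
    fix v assume v: "v \<in> carrier F"
    show "v \<oplus>\<^bsub>F\<^esub> \<zero>\<^bsub>F\<^esub> = v"
    proof (rule F_eqI)
      fix i assume i: "i \<in> verts Q"
      interpret Xi: module K "space X i" by (rule space_module[OF i])
      show "component (v \<oplus>\<^bsub>F\<^esub> \<zero>\<^bsub>F\<^esub>) i = component v i"
        using i F_component_closed[OF v i] by (simp add: component_F)
    qed (intro F_add_closed F_zero_closed v)+
  qed
  show "\<forall>a b v. a \<in> carrier K \<and> b \<in> carrier K \<and> v \<in> carrier F \<longrightarrow>
      (a \<otimes>\<^bsub>K\<^esub> b) \<odot>\<^bsub>F\<^esub> v = a \<odot>\<^bsub>F\<^esub> (b \<odot>\<^bsub>F\<^esub> v)"
  proof (intro allI impI, elim conjE)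
    fix a b v assume v: "a \<in> carrier K" "b \<in> carrier K" "v \<in> carrier F"
    show "(a \<otimes>\<^bsub>K\<^esub> b) \<odot>\<^bsub>F\<^esub> v = a \<odot>\<^bsub>F\<^esub> (b \<odot>\<^bsub>F\<^esub> v)"
    proof (rule F_eqI)
      fix i assume i: "i \<in> verts Q"
      interpret Xi: module K "space X i" by (rule space_module[OF i])
      show "component ((a \<otimes>\<^bsub>K\<^esub> b) \<odot>\<^bsub>F\<^esub> v) i = component (a \<odot>\<^bsub>F\<^esub> (b \<odot>\<^bsub>F\<^esub> v)) i"
        using i v F_component_closed[OF _ i] by (simp add: component_F Xi.smult_assoc1)
    qed (intro F_smult_closed K.m_closed v)+
  qed
  show "\<forall>v\<in>carrier F. \<one>\<^bsub>K\<^esub> \<odot>\<^bsub>F\<^esub> v = v"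
  proof
    fix v assume v: "v \<in> carrier F"
    show "\<one>\<^bsub>K\<^esub> \<odot>\<^bsub>F\<^esub> v = v"
    proof (rule F_eqI)
      fix i assume i: "i \<in> verts Q"
      interpret Xi: module K "space X i" by (rule space_module[OF i])
      show "component (\<one>\<^bsub>K\<^esub> \<odot>\<^bsub>F\<^esub> v) i = component v i"
        using i F_component_closed[OF v i] by (simp add: component_F)
    qed (intro F_smult_closed K.one_closed v)+
  qed
  show "\<forall>a b v. a \<in> carrier K \<and> b \<in> carrier K \<and> v \<in> carrier F \<longrightarrow>
      (a \<oplus>\<^bsub>K\<^esub> b) \<odot>\<^bsub>F\<^esub> v = a \<odot>\<^bsub>F\<^esub> v \<oplus>\<^bsub>F\<^esub> b \<odot>\<^bsub>F\<^esub> v"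
  proof (intro allI impI, elim conjE)
    fix a b v assume v: "a \<in> carrier K" "b \<in> carrier K" "v \<in> carrier F"
    show "(a \<oplus>\<^bsub>K\<^esub> b) \<odot>\<^bsub>F\<^esub> v = a \<odot>\<^bsub>F\<^esub> v \<oplus>\<^bsub>F\<^esub> b \<odot>\<^bsub>F\<^esub> v"
    proof (rule F_eqI)
      fix i assume i: "i \<in> verts Q"
      interpret Xi: module K "space X i" by (rule space_module[OF i])
      show "component ((a \<oplus>\<^bsub>K\<^esub> b) \<odot>\<^bsub>F\<^esub> v) i = component (a \<odot>\<^bsub>F\<^esub> v \<oplus>\<^bsub>F\<^esub> b \<odot>\<^bsub>F\<^esub> v) i"
        using i v F_component_closed[OF _ i] by (simp add: component_F Xi.smult_l_distr)
    qed (intro F_smult_closed F_add_closed K.a_closed v)+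
  qed
  show "\<forall>a v w. a \<in> carrier K \<and> v \<in> carrier F \<and> w \<in> carrier F \<longrightarrow>
      a \<odot>\<^bsub>F\<^esub> (v \<oplus>\<^bsub>F\<^esub> w) = a \<odot>\<^bsub>F\<^esub> v \<oplus>\<^bsub>F\<^esub> a \<odot>\<^bsub>F\<^esub> w"
  proof (intro allI impI, elim conjE)
    fix a v w assume v: "a \<in> carrier K" "v \<in> carrier F" "w \<in> carrier F"
    show "a \<odot>\<^bsub>F\<^esub> (v \<oplus>\<^bsub>F\<^esub> w) = a \<odot>\<^bsub>F\<^esub> v \<oplus>\<^bsub>F\<^esub> a \<odot>\<^bsub>F\<^esub> w"
    proof (rule F_eqI)
      fix i assume i: "i \<in> verts Q"
      interpret Xi: module K "space X i" by (rule space_module[OF i])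
      show "component (a \<odot>\<^bsub>F\<^esub> (v \<oplus>\<^bsub>F\<^esub> w)) i = component (a \<odot>\<^bsub>F\<^esub> v \<oplus>\<^bsub>F\<^esub> a \<odot>\<^bsub>F\<^esub> w) i"
        using i v F_component_closed[OF _ i] by (simp add: component_F Xi.smult_r_distr)
    qed (intro F_smult_closed F_add_closed v)+
  qed
qed (auto intro: F_zero_closed F_add_closed F_smult_closed)

sublocale F: vectorspace K F by (rule F_vs)

lemma component_hom: "i \<in> verts Q \<Longrightarrow> (\<lambda>x. component x i) \<in> module_hom K F (space X i)"
  by (intro module_homI) (simp_all add: component_F F_component_closed)

lemma component_finsum:
  "\<lbrakk>i \<in> verts Q; \<And>a. a \<in> A \<Longrightarrow> g a \<in> carrier F\<rbrakk> \<Longrightarrow>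
    component (finsum F g A) i = finsum (space X i) (\<lambda>a. component (g a) i) A"
  by (rule module_hom_finsum[OF F.module_axioms space_module component_hom])

lemma F_super: "super_vectorspace K F"
proof (rule super_vectorspaceI)
  show "grade F d \<subseteq> carrier F" for d
  proof
    fix x assume "x \<in> grade F d"
    then obtain f where f: "f \<in> (\<Pi>\<^sub>E i \<in> verts Q. grade (space X i) d)" "x = Family f"
      by (auto simp: F_object_grade_iff)
    have "f i \<in> carrier (space X i)" if "i \<in> verts Q" for i
      using super_vectorspace.grade_closed[OF space_super[OF that]] f that by auto
    with f show "x \<in> carrier F" by (auto simp: F_object_carrier_iff PiE_iff)
  qed
  then have gc: "x \<in> carrier F" if "x \<in> grade F d" for x d using that by blast
  show "\<zero>\<^bsub>F\<^esub> \<in> grade F d" for d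
    using Family_grade[of Q "\<lambda>i. \<zero>\<^bsub>space X i\<^esub>" X d K] super_vectorspace.grade_zero[OF space_super]
    by (simp add: F_object_def)
  show "x \<oplus>\<^bsub>F\<^esub> y \<in> grade F d" if "x \<in> grade F d" "y \<in> grade F d" for d x y
    using Family_grade[of Q "\<lambda>i. component x i \<oplus>\<^bsub>space X i\<^esub> component y i" X d K]
      super_vectorspace.grade_add[OF space_super] F_component_grade[OF that(1)] F_component_grade[OF that(2)]
    by (simp add: F_object_def)
  show "c \<odot>\<^bsub>F\<^esub> x \<in> grade F d" if "c \<in> carrier K" "x \<in> grade F d" for d c x
    using Family_grade[of Q "\<lambda>i. c \<odot>\<^bsub>space X i\<^esub> component x i" X d K]
      super_vectorspace.grade_smult[OF space_super that(1)] F_component_grade[OF that(2)]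
    by (simp add: F_object_def)
  show "\<exists>a\<in>grade F 0. \<exists>b\<in>grade F 1. x = a \<oplus>\<^bsub>F\<^esub> b" if x: "x \<in> carrier F" for x
  proof -
    \<comment> \<open>The grading of the direct sum is componentwise, so each component is split
      separately.\<close>
    define part where "part d = Family (\<lambda>i\<in>verts Q. grade_proj (space X i) d (component x i))" for d
    have part: "part d \<in> grade F d" for d
      unfolding part_def
      by (intro Family_grade super_vectorspace.grade_proj_in[OF space_super F_component_closed] x)
    moreover have "x = part 0 \<oplus>\<^bsub>F\<^esub> part 1"
    proof (rule F_eqI)
      fix i assume i: "i \<in> verts Q"
      show "component x i = component (part 0 \<oplus>\<^bsub>F\<^esub> part 1) i"
        using super_vectorspace.grade_proj_decomp[OF space_super F_component_closed, OF i x i, of 0] i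
        by (simp add: component_F part_def)
    qed (intro x F.add.m_closed gc[OF part])+
    ultimately show ?thesis by blast
  qed
  show "x = \<zero>\<^bsub>F\<^esub>" if x: "x \<in> grade F 0" "x \<in> grade F 1" for x
  proof (rule F_eqI)
    fix i assume i: "i \<in> verts Q"
    show "component x i = component \<zero>\<^bsub>F\<^esub> i"
      using super_vectorspace.grade_inter[OF space_super[OF i], of _ 0]
        F_component_grade[OF x(1) i] F_component_grade[OF x(2) i] i
      by (simp add: component_F)
  qed (intro gc[OF x(1)] F.zero_closed)+
qed (rule F_vs)

lemma emb_closed:
  assumes "i \<in> verts Q" "v \<in> carrier (space X i)"
  shows "emb Q X i v \<in> carrier F"
  unfolding emb_def
proof (rule Family_closed)
  fix j assume j: "j \<in> verts Q"
  interpret Xi: module K "space X j" by (rule space_module[OF j])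
  show "(if j = i then v else \<zero>\<^bsub>space X j\<^esub>) \<in> carrier (space X j)" using assms by simp
qed

lemma emb_grade:
  assumes "i \<in> verts Q" "v \<in> grade (space X i) d"
  shows "emb Q X i v \<in> grade F d"
  unfolding emb_def
  using assms super_vectorspace.grade_zero[OF space_super] by (intro Family_grade) auto

lemma emb_hom:
  assumes i: "i \<in> verts Q"
  shows "emb Q X i \<in> module_hom K (space X i) F"
proof -
  interpret Xi: module K "space X i" by (rule space_module[OF i])
  show ?thesis
  proof (intro module_homI emb_closed i; (rule F_eqI)?)
    fix v w j assume v: "v \<in> carrier (space X i)" "w \<in> carrier (space X i)" and j: "j \<in> verts Q"
    interpret Xj: module K "space X j" by (rule space_module[OF j])
    show "component (emb Q X i (v \<oplus>\<^bsub>space X i\<^esub> w)) j = component (emb Q X i v \<oplus>\<^bsub>F\<^esub> emb Q X i w) j"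
      using j by (simp add: component_F component_emb)
  next
    fix c v j assume v: "v \<in> carrier (space X i)" "c \<in> carrier K" and j: "j \<in> verts Q"
    interpret Xj: module K "space X j" by (rule space_module[OF j])
    show "component (emb Q X i (c \<odot>\<^bsub>space X i\<^esub> v)) j = component (c \<odot>\<^bsub>F\<^esub> emb Q X i v) j"
      using j v by (simp add: component_F component_emb)
  qed (auto intro!: emb_closed i F.smult_closed F.add.m_closed)
qed

text \<open>At the vertex \<open>j\<close> all summands but the one with index \<open>j\<close>
  vanish. Together with linearity of \<open>emb\<close> this reduces spanning \<open>F(X)\<close> to
  spanning each \<open>X(i)\<close>.\<close>

lemma sum_emb:
  assumes x: "x \<in> carrier F"
  shows "finsum F (\<lambda>i. emb Q X i (component x i)) (verts Q) = x"
proof (rule F_eqI)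
  have c: "i \<in> verts Q \<Longrightarrow> emb Q X i (component x i) \<in> carrier F" for i
    by (intro emb_closed F_component_closed x)
  then show "finsum F (\<lambda>i. emb Q X i (component x i)) (verts Q) \<in> carrier F"
    by (intro F.finsum_closed) auto
  fix j assume j: "j \<in> verts Q"
  interpret Xj: module K "space X j" by (rule space_module[OF j])
  have "component (finsum F (\<lambda>i. emb Q X i (component x i)) (verts Q)) j =
      (\<Oplus>\<^bsub>space X j\<^esub>i\<in>verts Q. component (emb Q X i (component x i)) j)"
    by (rule component_finsum[OF j c])
  also have "\<dots> = (\<Oplus>\<^bsub>space X j\<^esub>i\<in>verts Q. if j = i then component x j else \<zero>\<^bsub>space X j\<^esub>)"
    using j F_component_closed[OF x j] by (intro Xj.M.finsum_cong') (auto simp: component_emb)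
  also have "\<dots> = component x j"
    using Xj.M.finsum_singleton[OF j finite_verts, of "\<lambda>i. component x j"] F_component_closed[OF x j]
    by simp
  finally show "component (finsum F (\<lambda>i. emb Q X i (component x i)) (verts Q)) j = component x j" .
qed (rule x)

text \<open>The embedded finite spanning sets of the finitely many summands span together.\<close>

lemma F_fin_dim: "F.fin_dim"
proof -
  have "\<exists>B. finite B \<and> B \<subseteq> carrier (space X i) \<and> module.span K (space X i) B = carrier (space X i)"
    if "i \<in> verts Q" for i
    using space_fin_dim[OF that] vectorspace.fin_dim_def[OF space_vs[OF that]] by simp
  then obtain B where B: "\<And>i. i \<in> verts Q \<Longrightarrow> finite (B i) \<and> B i \<subseteq> carrier (space X i) \<and>
      module.span K (space X i) (B i) = carrier (space X i)"
    by metis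
  define A where "A = (\<Union>i\<in>verts Q. emb Q X i ` B i)"
  have A: "finite A" "A \<subseteq> carrier F"
    using B finite_verts by (auto simp: A_def intro!: emb_closed)
  have sub: "submodule K (F.span A) F" by (rule F.span_is_submodule[OF A(2)])
  interpret S: submodule K "F.span A" F by (rule sub)
  have emb_span: "emb Q X i v \<in> F.span A" if i: "i \<in> verts Q" and v: "v \<in> carrier (space X i)" for i v
  proof -
    interpret Xi: module K "space X i" by (rule space_module[OF i])
    have emb0: "emb Q X i \<zero>\<^bsub>space X i\<^esub> = \<zero>\<^bsub>F\<^esub>"
      by (rule module_hom_zero[OF space_module[OF i] F.module_axioms emb_hom[OF i]])
    \<comment> \<open>The preimage of the span under \<open>emb\<close> is a submodule of
      \<open>X(i)\<close>; it contains the spanning set \<open>B i\<close> and is therefore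
      everything.\<close>
    let ?N = "{v \<in> carrier (space X i). emb Q X i v \<in> F.span A}"
    have "submodule K ?N (space X i)"
      by (rule submodule.intro)
        (auto simp: Xi.module_axioms emb0 module_hom_add[OF emb_hom[OF i]]
          module_hom_smult[OF emb_hom[OF i]])
    moreover have "B i \<subseteq> ?N"
      using B[OF i] F.in_own_span[OF A(2)] i by (auto simp: A_def)
    ultimately have "Xi.span (B i) \<subseteq> ?N" by (intro Xi.span_is_subset)
    with B[OF i] v show ?thesis by auto
  qed
  have "x \<in> F.span A" if "x \<in> carrier F" for x
  proof -
    have "finsum F (\<lambda>i. emb Q X i (component x i)) (verts Q) \<in> F.span A"
      by (intro F.submodule_finsum_closed sub emb_span F_component_closed that)
    then show ?thesis by (simp add: sum_emb that)
  qed
  with A F.span_is_subset2[OF A(2)] show ?thesis by (auto simp: F.fin_dim_def)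
qed

end

section \<open>The action of the path algebra on the direct sum\<close>

context srep_family
begin

lemma path_act_hom:
  assumes "w \<in> paths Q"
  shows "path_act X w \<in> module_hom K F (space X (path_target w))"
proof (cases w)
  case (fields u es v)
  with assms have "Q.awalk u es v" "u \<in> verts Q" by (simp_all add: Q.awalk_hd_in_verts)
  moreover have "path_act X w = (\<lambda>x. fold (amap X) es (component x u))"
    by (rule ext) (simp add: fields)
  ultimately show ?thesis
    using module_hom_comp[OF component_hom fold_amap_hom, of u es v] by (simp only: fields path_simps(2))
qed

lemma path_act_closed:
  "\<lbrakk>w \<in> paths Q; x \<in> carrier F\<rbrakk> \<Longrightarrow> path_act X w x \<in> carrier (space X (path_target w))"
  by (rule module_hom_apply_closed[OF path_act_hom])

lemma component_act_support:
  "j \<in> verts Q \<Longrightarrow> component (act F a x) j =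
    (\<Oplus>\<^bsub>space X j\<^esub>w\<in>{w \<in> support K a. path_target w = j}. a w \<odot>\<^bsub>space X j\<^esub> path_act X w x)"
  by (simp add: F_object_def path_act_def)

text \<open>Paths outside the support add zero terms, so the sum may run over any finite set of
  paths containing the support. This gives sums, multiples and products a common index set with the
  elements they are formed from.\<close>

lemma component_act:
  assumes j: "j \<in> verts Q" and a: "\<And>w. a w \<in> carrier K" and x: "x \<in> carrier F"
    and S: "finite S" "support K a \<subseteq> S" "S \<subseteq> paths Q"
  shows "component (act F a x) j =
    (\<Oplus>\<^bsub>space X j\<^esub>w\<in>{w \<in> S. path_target w = j}. a w \<odot>\<^bsub>space X j\<^esub> path_act X w x)"
proof -
  interpret Xj: module K "space X j" by (rule space_module[OF j])
  have c: "path_act X w x \<in> carrier (space X j)" if "w \<in> S" "path_target w = j" for w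
    using path_act_closed[OF _ x] that S(3) by blast
  show ?thesis
    unfolding component_act_support[OF j]
    using S a c by (intro Xj.add.finprod_mono_neutral_cong_left) (auto simp: not_support simp del: split_paired_All)
qed

lemma act_closed:
  assumes a: "a \<in> carrier (path_algebra K Q)" and x: "x \<in> carrier F"
  shows "act F a x \<in> carrier F"
proof -
  have "(\<Oplus>\<^bsub>space X j\<^esub>w\<in>{w \<in> support K a. path_target w = j}. a w \<odot>\<^bsub>space X j\<^esub> path_act X w x)
      \<in> carrier (space X j)" if j: "j \<in> verts Q" for j
  proof -
    interpret Xj: module K "space X j" by (rule space_module[OF j])
    have pc: "path_act X w x \<in> carrier (space X j)"
      if "w \<in> {w \<in> support K a. path_target w = j}" for w
      using path_act_closed[OF _ x, of w] path_algebra_carrier(2)[OF a] that by blast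
    show ?thesis
      by (intro Xj.M.finsum_closed funcsetI Xj.smult_closed path_algebra_carrier(1)[OF a] pc)
  qed
  then have "Family (\<lambda>j\<in>verts Q. \<Oplus>\<^bsub>space X j\<^esub>w\<in>{w \<in> support K a. path_target w = j}.
      a w \<odot>\<^bsub>space X j\<^esub> path_act X w x) \<in> carrier F"
    by (rule Family_closed)
  then show ?thesis by (simp add: F_object_def path_act_def)
qed

lemma component_act_basis:
  assumes j: "j \<in> verts Q" and w: "w \<in> paths Q" and x: "x \<in> carrier F"
  shows "component (act F (basis_elt K w) x) j =
    (if path_target w = j then path_act X w x else \<zero>\<^bsub>space X j\<^esub>)"
proof -
  interpret Xj: module K "space X j" by (rule space_module[OF j])
  have basis_elt_self: "basis_elt K w w = \<one>\<^bsub>K\<^esub>" by (simp add: basis_elt_def)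
  have single: "{w' \<in> {w}. path_target w' = j} = (if path_target w = j then {w} else {})"
    by auto
  then show ?thesis
    unfolding component_act_support[OF j] support_basis_elt single
    using path_act_closed[OF w x] basis_elt_self by (cases "path_target w = j") simp_all
qed

lemma component_act_vertex:
  "\<lbrakk>i \<in> verts Q; j \<in> verts Q; x \<in> carrier F\<rbrakk> \<Longrightarrow>
    component (act F (vertex_elt K i) x) j = (if i = j then component x i else \<zero>\<^bsub>space X j\<^esub>)"
  by (simp add: vertex_elt_def component_act_basis)

lemma component_act_arrow:
  "\<lbrakk>e \<in> arcs Q; j \<in> verts Q; x \<in> carrier F\<rbrakk> \<Longrightarrow>
    component (act F (arrow_elt K Q e) x) j =
      (if head Q e = j then amap X e (component x (tail Q e)) else \<zero>\<^bsub>space X j\<^esub>)"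
  by (simp add: arrow_elt_def component_act_basis)

text \<open>The idempotent \<open>v\<^sub>i\<close> is the projection of the direct sum onto its
  summand at \<open>i\<close>; this identifies \<open>v\<^sub>i F(X)\<close> with the image of
  \<open>emb\<close>.\<close>

lemma act_vertex_emb:
  assumes "i \<in> verts Q" "x \<in> carrier F"
  shows "act F (vertex_elt K i) x = emb Q X i (component x i)"
proof (rule F_eqI)
  show "act F (vertex_elt K i) x \<in> carrier F"
    unfolding vertex_elt_def by (intro act_closed basis_elt_closed trivial_path_in assms)
  show "emb Q X i (component x i) \<in> carrier F"
    by (intro emb_closed F_component_closed assms)
qed (simp add: component_act_vertex component_emb assms)

lemma act_one:
  assumes x: "x \<in> carrier F"
  shows "act F \<one>\<^bsub>path_algebra K Q\<^esub> x = x"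
proof (rule F_eqI)
  fix j assume j: "j \<in> verts Q"
  interpret Xj: module K "space X j" by (rule space_module[OF j])
  \<comment> \<open>Of all trivial paths only the one at \<open>j\<close> ends at
    \<open>j\<close>.\<close>
  have "{w \<in> support K \<one>\<^bsub>path_algebra K Q\<^esub>. path_target w = j} = {trivial_path j}"
    using j by (auto simp: path_algebra_def support_def)
  moreover have "\<one>\<^bsub>path_algebra K Q\<^esub> (trivial_path j) = \<one>\<^bsub>K\<^esub>"
    using j by (simp add: path_algebra_def)
  ultimately show "component (act F \<one>\<^bsub>path_algebra K Q\<^esub> x) j = component x j"
    using F_component_closed[OF x j] by (simp add: component_act_support[OF j])
qed (intro act_closed one_closed x)+

text \<open>The coefficient of \<open>w\<close> in \<open>a b\<close> sums over the factorisations
  \<open>w = u v\<close>. Acting on \<open>x\<close> gives a double sum, in which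
  \<open>x\<^sub>w\<close> is \<open>x\<^sub>u\<close> after \<open>x\<^sub>v\<close>, because
  folding along an appended list is folding twice.\<close>

lemma act_mult:
  assumes a: "a \<in> carrier (path_algebra K Q)" and b: "b \<in> carrier (path_algebra K Q)"
    and x: "x \<in> carrier F"
    and ab: "a \<otimes>\<^bsub>path_algebra K Q\<^esub> b \<in> carrier (path_algebra K Q)"
  shows "act F (a \<otimes>\<^bsub>path_algebra K Q\<^esub> b) x = act F a (act F b x)"
proof (rule F_eqI)
  show "act F (a \<otimes>\<^bsub>path_algebra K Q\<^esub> b) x \<in> carrier F" "act F a (act F b x) \<in> carrier F"
    using assms by (auto intro: act_closed)
  fix j assume j: "j \<in> verts Q"
  interpret Xj: module K "space X j" by (rule space_module[OF j])
  note aK = path_algebra_carrier(1)[OF a] and bK = path_algebra_carrier(1)[OF b]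
  note aQ = path_algebra_carrier(2)[OF a] and bQ = path_algebra_carrier(2)[OF b]
  define S where "S = {u \<in> support K a. path_target u = j}"
  \<comment> \<open>The inner index set varies with \<open>u\<close>, as \<open>v\<close> has to end
    where \<open>u\<close> starts.\<close>
  define T where "T u = {v \<in> support K b. path_source u = path_target v}" for u :: "('q, 'e) path"
  define W where "W = {w. \<exists>u\<in>S. \<exists>v\<in>T u. w = path_concat u v}"
  have fin: "finite S" "\<And>u. finite (T u)"
    using path_algebra_carrier(3)[OF a] path_algebra_carrier(3)[OF b] by (simp_all add: S_def T_def)
  \<comment> \<open>A composite ends where its left factor ends, so prescribing the target of
    \<open>w\<close> prescribes the target of \<open>u\<close>.\<close>
  have W: "{w \<in> composites a b. path_target w = j} = W"
  proof (intro subset_antisym subsetI)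
    fix w assume "w \<in> {w \<in> composites a b. path_target w = j}"
    then obtain u v where "u \<in> support K a" "v \<in> support K b" "path_source u = path_target v"
      "w = path_concat u v" "path_target (path_concat u v) = j"
      by blast
    then show "w \<in> W" unfolding W_def S_def T_def path_simps(9) by blast
  next
    fix w assume "w \<in> W"
    then obtain u v where uv: "u \<in> support K a" "path_target u = j" "v \<in> support K b"
      "path_source u = path_target v" "w = path_concat u v"
      unfolding W_def S_def T_def by blast
    moreover have "path_target w = j" unfolding uv(5) path_simps(9) by (rule uv(2))
    ultimately show "w \<in> {w \<in> composites a b. path_target w = j}" by blast
  qed
  have pc: "path_act X (path_concat u v) x \<in> carrier (space X j)" if "u \<in> S" "v \<in> T u" for u v
  proof -
    have "u \<in> paths Q" "v \<in> paths Q" "path_source u = path_target v" "path_target u = j"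
      using that aQ bQ unfolding S_def T_def by blast+
    then have "path_concat u v \<in> paths Q" "path_target (path_concat u v) = j"
      using path_concat_in by (simp_all only: path_simps(9))
    then show ?thesis using path_act_closed[OF _ x, of "path_concat u v"] by simp
  qed
  have coeff: "(a \<otimes>\<^bsub>path_algebra K Q\<^esub> b) w =
      finsum K (\<lambda>(u, v). a u \<otimes>\<^bsub>K\<^esub> b v) {(u, v). u \<in> S \<and> v \<in> T u \<and> path_concat u v = w}"
    if "w \<in> W" for w
  proof -
    have target: "path_target w = j" using that unfolding W[symmetric] by simp
    have "path_target u = j" if "path_concat u v = w" for u v
      using target path_simps(9)[of u v] unfolding that by simp
    then have "{(u, v). u \<in> support K a \<and> v \<in> support K b \<and> path_source u = path_target v \<and>
        path_concat u v = w} = {(u, v). u \<in> S \<and> v \<in> T u \<and> path_concat u v = w}"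
      unfolding S_def T_def by blast
    then show ?thesis unfolding path_algebra_mult by simp
  qed
  have wc: "path_act X w x \<in> carrier (space X j)" if "w \<in> W" for w
    using that pc unfolding W_def by blast
  have "component (act F (a \<otimes>\<^bsub>path_algebra K Q\<^esub> b) x) j =
      (\<Oplus>\<^bsub>space X j\<^esub>w\<in>W. (a \<otimes>\<^bsub>path_algebra K Q\<^esub> b) w \<odot>\<^bsub>space X j\<^esub> path_act X w x)"
    unfolding component_act[OF j path_algebra_carrier(1)[OF ab] x finite_composites(1)[OF a b]
        support_mult finite_composites(2)[OF a b]] W ..
  also have "\<dots> = (\<Oplus>\<^bsub>space X j\<^esub>w\<in>W.
      finsum K (\<lambda>(u, v). a u \<otimes>\<^bsub>K\<^esub> b v) {(u, v). u \<in> S \<and> v \<in> T u \<and> path_concat u v = w}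
        \<odot>\<^bsub>space X j\<^esub> path_act X w x)"
  proof (rule Xj.M.finsum_cong'[OF refl, symmetric])
    show "(\<lambda>w. (a \<otimes>\<^bsub>path_algebra K Q\<^esub> b) w \<odot>\<^bsub>space X j\<^esub> path_act X w x) \<in> W \<rightarrow> carrier (space X j)"
      by (intro funcsetI Xj.smult_closed wc path_algebra_carrier(1)[OF ab])
  qed (simp only: coeff)
  \<comment> \<open>Summing over composites with convolved coefficients is summing over matching
    pairs, the left factor outside.\<close>
  also have "\<dots> = (\<Oplus>\<^bsub>space X j\<^esub>u\<in>S. a u \<odot>\<^bsub>space X j\<^esub>
      (\<Oplus>\<^bsub>space X j\<^esub>v\<in>T u. b v \<odot>\<^bsub>space X j\<^esub> path_act X (path_concat u v) x))"
    unfolding W_def by (rule Xj.finsum_convolution[where c = path_concat and x = "\<lambda>w. path_act X w x", OF fin aK bK pc])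
  also have "\<dots> = (\<Oplus>\<^bsub>space X j\<^esub>u\<in>S. a u \<odot>\<^bsub>space X j\<^esub> path_act X u (act F b x))"
  proof (rule Xj.M.finsum_cong'[OF refl])
    show "(\<lambda>u. a u \<odot>\<^bsub>space X j\<^esub> path_act X u (act F b x)) \<in> S \<rightarrow> carrier (space X j)"
    proof (intro funcsetI Xj.smult_closed aK)
      fix u assume "u \<in> S"
      then show "path_act X u (act F b x) \<in> carrier (space X j)"
        using path_act_closed[OF _ act_closed[OF b x], of u] aQ by (auto simp: S_def)
    qed
    fix u assume "u \<in> S"
    then have u: "path_target u = j" "u \<in> paths Q" "path_source u \<in> verts Q"
      using aQ path_ends(1)[of u] unfolding S_def by blast+
    let ?i = "path_source u"
    interpret Xi: module K "space X ?i" by (rule space_module[OF u(3)])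
    have h: "fold (amap X) (fst (snd u)) \<in> module_hom K (space X ?i) (space X j)"
      using u(1,2) by (cases u) (auto intro: fold_amap_hom)
    have vc: "path_act X v x \<in> carrier (space X ?i)" if "v \<in> T u" for v
      using path_act_closed[OF _ x, of v] that bQ unfolding T_def by force
    have T: "{v \<in> support K b. path_target v = ?i} = T u" unfolding T_def by auto
    \<comment> \<open>Only the component of the inner vector at the source of \<open>u\<close>
      enters; the paths of \<open>b\<close> that contribute to it form \<open>T u\<close>, and
      linearity moves \<open>x\<^sub>u\<close> under the sum.\<close>
    have "path_act X u (act F b x) = (\<Oplus>\<^bsub>space X j\<^esub>v\<in>T u. fold (amap X) (fst (snd u)) (b v \<odot>\<^bsub>space X ?i\<^esub> path_act X v x))"
      unfolding path_act_def[of X u] component_act_support[OF u(3)] T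
      by (rule module_hom_finsum[OF space_module[OF u(3)] space_module[OF j] h])
        (rule Xi.smult_closed[OF bK vc])
    also have "\<dots> = (\<Oplus>\<^bsub>space X j\<^esub>v\<in>T u. b v \<odot>\<^bsub>space X j\<^esub> path_act X (path_concat u v) x)"
    proof (rule Xj.M.finsum_cong'[OF refl])
      show "(\<lambda>v. b v \<odot>\<^bsub>space X j\<^esub> path_act X (path_concat u v) x) \<in> T u \<rightarrow> carrier (space X j)"
        by (intro funcsetI Xj.smult_closed bK pc \<open>u \<in> S\<close>)
    qed (simp only: path_act_concat module_hom_smult[OF h bK vc])
    finally show "a u \<odot>\<^bsub>space X j\<^esub> (\<Oplus>\<^bsub>space X j\<^esub>v\<in>T u. b v \<odot>\<^bsub>space X j\<^esub> path_act X (path_concat u v) x) =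
        a u \<odot>\<^bsub>space X j\<^esub> path_act X u (act F b x)"
      by simp
  qed
  also have "\<dots> = component (act F a (act F b x)) j"
    by (simp add: component_act_support[OF j] S_def)
  finally show "component (act F (a \<otimes>\<^bsub>path_algebra K Q\<^esub> b) x) j = component (act F a (act F b x)) j" .
qed

text \<open>Additivity and homogeneity in the algebra argument are termwise once the index sets
  agree; additivity in the vector is linearity of each \<open>path_act X w\<close>.\<close>

lemma F_algebra_left_module: "algebra_left_module K (path_algebra K Q) F"
proof (rule algebra_left_module.intro[OF F_vs], unfold_locales)
  fix a x assume a: "a \<in> carrier (path_algebra K Q)" and x: "x \<in> carrier F"
  note aK = path_algebra_carrier(1)[OF a]
  show "act F a x \<in> carrier F" by (rule act_closed[OF a x])
  { fix y assume y: "y \<in> carrier F"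
    show "act F a (x \<oplus>\<^bsub>F\<^esub> y) = act F a x \<oplus>\<^bsub>F\<^esub> act F a y"
    proof (rule F_eqI)
      fix j assume j: "j \<in> verts Q"
      interpret Xj: module K "space X j" by (rule space_module[OF j])
      have pc: "path_act X w z \<in> carrier (space X j)"
        if "w \<in> support K a" "path_target w = j" "z \<in> carrier F" for w z
        using path_act_closed[of w z] path_algebra_carrier(2)[OF a] that by auto
      have "path_act X w (x \<oplus>\<^bsub>F\<^esub> y) = path_act X w x \<oplus>\<^bsub>space X j\<^esub> path_act X w y"
        if "w \<in> support K a" "path_target w = j" for w
        using module_hom_add[OF path_act_hom x y, of w] path_algebra_carrier(2)[OF a] that by auto
      then have "component (act F a (x \<oplus>\<^bsub>F\<^esub> y)) j =
          (\<Oplus>\<^bsub>space X j\<^esub>w\<in>{w \<in> support K a. path_target w = j}.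
            a w \<odot>\<^bsub>space X j\<^esub> path_act X w x \<oplus>\<^bsub>space X j\<^esub> a w \<odot>\<^bsub>space X j\<^esub> path_act X w y)"
        unfolding component_act_support[OF j] using aK pc x y
        by (intro Xj.M.finsum_cong') (auto simp: Xj.smult_r_distr simp del: split_paired_All)
      also have "\<dots> = component (act F a x \<oplus>\<^bsub>F\<^esub> act F a y) j"
        unfolding component_F(2)[OF j] component_act_support[OF j] using aK pc x y
        by (intro Xj.M.finsum_addf) auto
      finally show "component (act F a (x \<oplus>\<^bsub>F\<^esub> y)) j = component (act F a x \<oplus>\<^bsub>F\<^esub> act F a y) j" .
    qed (intro act_closed F.add.m_closed a x y)+ }
  { fix b assume b: "b \<in> carrier (path_algebra K Q)"
    note bK = path_algebra_carrier(1)[OF b]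
    have add: "(a \<oplus>\<^bsub>path_algebra K Q\<^esub> b) w = a w \<oplus>\<^bsub>K\<^esub> b w" for w
      by (simp add: path_algebra_def)
    \<comment> \<open>Cancellation can shrink the support of the sum, so all three actions are
      expanded over the union.\<close>
    let ?S = "support K a \<union> support K b"
    have S: "finite ?S" "?S \<subseteq> paths Q" "support K a \<subseteq> ?S" "support K b \<subseteq> ?S"
      using path_algebra_carrier[OF a] path_algebra_carrier[OF b] by auto
    have supp: "support K (a \<oplus>\<^bsub>path_algebra K Q\<^esub> b) \<subseteq> ?S"
      by (auto simp: support_def add)
    have abc: "(a \<oplus>\<^bsub>path_algebra K Q\<^esub> b) w \<in> carrier K" for w
      unfolding add by (intro K.a_closed aK bK)
    have ab: "a \<oplus>\<^bsub>path_algebra K Q\<^esub> b \<in> carrier (path_algebra K Q)"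
      by (rule path_algebra_carrierI[OF abc supp S(1,2)])
    show "act F (a \<oplus>\<^bsub>path_algebra K Q\<^esub> b) x = act F a x \<oplus>\<^bsub>F\<^esub> act F b x"
    proof (rule F_eqI)
      fix j assume j: "j \<in> verts Q"
      interpret Xj: module K "space X j" by (rule space_module[OF j])
      have pc: "path_act X w x \<in> carrier (space X j)" if "w \<in> ?S" "path_target w = j" for w
        using path_act_closed[OF _ x, of w] S(2) that by blast
      have "component (act F (a \<oplus>\<^bsub>path_algebra K Q\<^esub> b) x) j =
          (\<Oplus>\<^bsub>space X j\<^esub>w\<in>{w \<in> ?S. path_target w = j}.
            a w \<odot>\<^bsub>space X j\<^esub> path_act X w x \<oplus>\<^bsub>space X j\<^esub> b w \<odot>\<^bsub>space X j\<^esub> path_act X w x)"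
        unfolding component_act[OF j abc x S(1) supp S(2)] add
        using aK bK pc by (intro Xj.M.finsum_cong') (auto simp: Xj.smult_l_distr simp del: split_paired_All)
      also have "\<dots> = component (act F a x \<oplus>\<^bsub>F\<^esub> act F b x) j"
        unfolding component_F(2)[OF j] component_act[OF j aK x S(1,3,2)] component_act[OF j bK x S(1,4,2)]
        using aK bK pc by (intro Xj.M.finsum_addf) auto
      finally show "component (act F (a \<oplus>\<^bsub>path_algebra K Q\<^esub> b) x) j = component (act F a x \<oplus>\<^bsub>F\<^esub> act F b x) j" .
    qed (intro act_closed F.add.m_closed a b ab x)+
    show "act F (a \<otimes>\<^bsub>path_algebra K Q\<^esub> b) x = act F a (act F b x)"
      by (intro act_mult path_algebra_mult_closed a b x) }
  { fix c assume c: "c \<in> carrier K"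
    have sm: "(c \<odot>\<^bsub>path_algebra K Q\<^esub> a) w = c \<otimes>\<^bsub>K\<^esub> a w" for w
      by (simp add: path_algebra_def)
    note S = path_algebra_carrier(3,2)[OF a]
    \<comment> \<open>This is only an inclusion, since \<open>c\<close> may be zero; both sides are
      expanded over the support of \<open>a\<close>.\<close>
    have supp: "support K (c \<odot>\<^bsub>path_algebra K Q\<^esub> a) \<subseteq> support K a"
      using c by (auto simp: support_def sm)
    have cac: "(c \<odot>\<^bsub>path_algebra K Q\<^esub> a) w \<in> carrier K" for w
      unfolding sm by (intro K.m_closed aK c)
    have ca: "c \<odot>\<^bsub>path_algebra K Q\<^esub> a \<in> carrier (path_algebra K Q)"
      by (rule path_algebra_carrierI[OF cac supp S])
    show "act F (c \<odot>\<^bsub>path_algebra K Q\<^esub> a) x = c \<odot>\<^bsub>F\<^esub> act F a x"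
    proof (rule F_eqI)
      fix j assume j: "j \<in> verts Q"
      interpret Xj: module K "space X j" by (rule space_module[OF j])
      have pc: "path_act X w x \<in> carrier (space X j)" if "w \<in> support K a" "path_target w = j" for w
        using path_act_closed[OF _ x, of w] S(2) that by blast
      have "component (act F (c \<odot>\<^bsub>path_algebra K Q\<^esub> a) x) j =
          (\<Oplus>\<^bsub>space X j\<^esub>w\<in>{w \<in> support K a. path_target w = j}.
            c \<odot>\<^bsub>space X j\<^esub> (a w \<odot>\<^bsub>space X j\<^esub> path_act X w x))"
        unfolding component_act[OF j cac x S(1) supp S(2)] sm
        using aK c pc by (intro Xj.M.finsum_cong') (auto simp: Xj.smult_assoc1 simp del: split_paired_All)
      also have "\<dots> = component (c \<odot>\<^bsub>F\<^esub> act F a x) j"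
        unfolding component_F(3)[OF j] component_act_support[OF j]
        using aK c pc by (intro Xj.finsum_smult[symmetric]) auto
      finally show "component (act F (c \<odot>\<^bsub>path_algebra K Q\<^esub> a) x) j = component (c \<odot>\<^bsub>F\<^esub> act F a x) j" .
    qed (intro act_closed F.smult_closed a c ca x)+ }
qed (rule act_one)

text \<open>A vertex acts as \<open>emb\<close> after a component, an arrow as \<open>emb\<close>
  after \<open>amap X e\<close> after a component. Components and \<open>emb\<close> preserve
  degrees, so the degree of the action is that of the middle map.\<close>

lemma F_object_in: "F \<in> smod_objects K Q p"
proof -
  have "has_degree F F (path_parity Q p (trivial_path i)) (act F (vertex_elt K i))"
    if i: "i \<in> verts Q" for i
  proof (rule has_degreeI)
    fix a x assume x: "x \<in> grade F a"
    then have "act F (vertex_elt K i) x = emb Q X i (component x i)"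
      using super_vectorspace.grade_closed[OF F_super x] by (intro act_vertex_emb i)
    then show "act F (vertex_elt K i) x \<in> grade F (a + path_parity Q p (trivial_path i))"
      using emb_grade[OF i F_component_grade[OF x i]] by (simp only: path_parity_trivial add_0_right)
  qed
  moreover have "has_degree F F (path_parity Q p (arrow_path Q e)) (act F (arrow_elt K Q e))"
    if e: "e \<in> arcs Q" for e
  proof (rule has_degreeI)
    fix a x assume x: "x \<in> grade F a"
    have xc: "x \<in> carrier F" by (rule super_vectorspace.grade_closed[OF F_super x])
    have t: "tail Q e \<in> verts Q" and h: "head Q e \<in> verts Q"
      using e by auto
    have am: "amap X e (component x (tail Q e)) \<in> grade (space X (head Q e)) (a + (p (tail Q e) + p (head Q e)))"
      by (rule has_degreeD[OF amap_degree[OF e] F_component_grade[OF x t]])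
    have "act F (arrow_elt K Q e) x = emb Q X (head Q e) (amap X e (component x (tail Q e)))"
    proof (rule F_eqI)
      show "act F (arrow_elt K Q e) x \<in> carrier F"
        unfolding arrow_elt_def by (intro act_closed basis_elt_closed arrow_path_in e xc)
      show "emb Q X (head Q e) (amap X e (component x (tail Q e))) \<in> carrier F"
        by (intro emb_closed h module_hom_apply_closed[OF amap_hom[OF e]] F_component_closed xc t)
    qed (simp add: component_act_arrow component_emb e xc)
    then show "act F (arrow_elt K Q e) x \<in> grade F (a + path_parity Q p (arrow_path Q e))"
      using emb_grade[OF h am] by (simp only: path_parity_arrow)
  qed
  ultimately show ?thesis
    using F_super F_fin_dim F_algebra_left_module
    by (simp add: smod_objects_def fd_super_vectorspace_def)
qed

end

section \<open>The vertex spaces of a super-module\<close>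

locale smod_object = finite_quiver K Q p
  for K :: "('k, 'r) ring_scheme" and Q :: "('q, 'e) pre_digraph" and p :: "'q \<Rightarrow> bit" +
  fixes M :: "('k, ('q, 'e) path \<Rightarrow> 'k, 'v) smod"
  assumes smod_object: "M \<in> smod_objects K Q p"
begin

lemma M_super: "super_vectorspace K M"
  and M_fin_dim: "vectorspace.fin_dim K M"
  and M_algebra_left_module: "algebra_left_module K (path_algebra K Q) M"
  and vertex_degree: "i \<in> verts Q \<Longrightarrow> has_degree M M 0 (act M (vertex_elt K i))"
  and arrow_degree: "e \<in> arcs Q \<Longrightarrow>
    has_degree M M (p (tail Q e) + p (head Q e)) (act M (arrow_elt K Q e))"
  using smod_object by (auto simp: smod_objects_def fd_super_vectorspace_def)

sublocale M: algebra_left_module K "path_algebra K Q" M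
  by (rule M_algebra_left_module)

text \<open>The zero function is the multiple of the unit by the scalar zero, and
  \<open>act_smult\<close> turns this into the zero multiple of a vector.\<close>

lemma act_zero: "x \<in> carrier M \<Longrightarrow> act M (\<lambda>w. \<zero>\<^bsub>K\<^esub>) x = \<zero>\<^bsub>M\<^esub>"
proof -
  assume x: "x \<in> carrier M"
  have "one_coeff \<zero>\<^bsub>K\<^esub> = (\<lambda>w. \<zero>\<^bsub>K\<^esub>)" by (simp add: one_coeff_def)
  then have "act M (\<lambda>w. \<zero>\<^bsub>K\<^esub>) x = act M (\<zero>\<^bsub>K\<^esub> \<odot>\<^bsub>path_algebra K Q\<^esub> \<one>\<^bsub>path_algebra K Q\<^esub>) x"
    by (simp add: smult_one)
  also have "\<dots> = \<zero>\<^bsub>K\<^esub> \<odot>\<^bsub>M\<^esub> act M \<one>\<^bsub>path_algebra K Q\<^esub> x"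
    by (intro M.act_smult one_closed x K.zero_closed)
  finally show ?thesis using x by (simp add: M.act_one)
qed

text \<open>Compatibility with scalars is not among the axioms of an algebra module: it follows by letting
  \<open>c\<close> act as the multiple \<open>c 1\<close> of the unit.\<close>

lemma act_basis_hom:
  assumes w: "w \<in> paths Q"
  shows "act M (basis_elt K w) \<in> module_hom K M M"
proof (rule module_homI)
  fix c x assume c: "c \<in> carrier K" and x: "x \<in> carrier M"
  note bw = basis_elt_closed[OF w]
  have "c \<odot>\<^bsub>M\<^esub> x = act M (one_coeff c) x"
    using M.act_smult[OF c one_closed x] x by (simp add: M.act_one smult_one[OF c])
  then have "act M (basis_elt K w) (c \<odot>\<^bsub>M\<^esub> x) =
      act M (basis_elt K w \<otimes>\<^bsub>path_algebra K Q\<^esub> one_coeff c) x"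
    by (simp add: M.act_mult[OF bw one_coeff_closed[OF c] x])
  also have "\<dots> = c \<odot>\<^bsub>M\<^esub> act M (basis_elt K w) x"
    by (simp add: mult_one_coeff[OF w c] M.act_smult[OF c bw x])
  finally show "act M (basis_elt K w) (c \<odot>\<^bsub>M\<^esub> x) = c \<odot>\<^bsub>M\<^esub> act M (basis_elt K w) x" .
qed (auto intro: M.act_closed M.act_add_right basis_elt_closed w)

lemma act_basis_closed: "\<lbrakk>w \<in> paths Q; x \<in> carrier M\<rbrakk> \<Longrightarrow> act M (basis_elt K w) x \<in> carrier M"
  by (intro M.act_closed basis_elt_closed)

lemma vertex_hom: "i \<in> verts Q \<Longrightarrow> act M (vertex_elt K i) \<in> module_hom K M M"
  unfolding vertex_elt_def by (intro act_basis_hom trivial_path_in)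

lemma arrow_hom: "e \<in> arcs Q \<Longrightarrow> act M (arrow_elt K Q e) \<in> module_hom K M M"
  unfolding arrow_elt_def by (intro act_basis_hom arrow_path_in)

lemma vertex_closed: "\<lbrakk>i \<in> verts Q; x \<in> carrier M\<rbrakk> \<Longrightarrow> act M (vertex_elt K i) x \<in> carrier M"
  by (rule module_hom_apply_closed[OF vertex_hom])

lemma act_basis_mult:
  assumes "u \<in> paths Q" "v \<in> paths Q" "x \<in> carrier M"
  shows "act M (basis_elt K u) (act M (basis_elt K v) x) =
    (if path_source u = path_target v then act M (basis_elt K (path_concat u v)) x else \<zero>\<^bsub>M\<^esub>)"
  using M.act_mult[OF basis_elt_closed[OF assms(1)] basis_elt_closed[OF assms(2)] assms(3)]
  by (simp add: basis_elt_mult act_zero assms(3) split: if_splits)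

lemma act_vertex_path:
  assumes "w \<in> paths Q" "i \<in> verts Q" "x \<in> carrier M"
  shows "act M (vertex_elt K i) (act M (basis_elt K w) x) =
    (if i = path_target w then act M (basis_elt K w) x else \<zero>\<^bsub>M\<^esub>)"
  using act_basis_mult[OF trivial_path_in[OF assms(2)] assms(1,3)]
  by (auto simp: vertex_elt_def path_concat_trivial)

lemma act_path_vertex:
  assumes "w \<in> paths Q" "i \<in> verts Q" "x \<in> carrier M"
  shows "act M (basis_elt K w) (act M (vertex_elt K i) x) =
    (if i = path_source w then act M (basis_elt K w) x else \<zero>\<^bsub>M\<^esub>)"
  using act_basis_mult[OF assms(1) trivial_path_in[OF assms(2)] assms(3)]
  by (auto simp: vertex_elt_def path_concat_trivial)

lemma act_vertex_vertex:
  assumes "i \<in> verts Q" "j \<in> verts Q" "x \<in> carrier M"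
  shows "act M (vertex_elt K i) (act M (vertex_elt K j) x) =
    (if i = j then act M (vertex_elt K i) x else \<zero>\<^bsub>M\<^esub>)"
  using act_vertex_path[OF trivial_path_in[OF assms(2)] assms(1,3)]
  by (simp add: vertex_elt_def)

text \<open>Induction over sets \<open>S\<close> of vertices: the partial sum of the
  \<open>v\<^sub>i\<close> over \<open>S\<close> is the indicator function of the trivial paths in
  \<open>S\<close>. It starts from the zero element and ends, for all vertices, with the
  unit.\<close>

lemma vertex_sum:
  assumes x: "x \<in> carrier M"
  shows "finsum M (\<lambda>i. act M (vertex_elt K i) x) (verts Q) = x"
proof -
  let ?part = "\<lambda>S w. if w \<in> trivial_path ` S then \<one>\<^bsub>K\<^esub> else \<zero>\<^bsub>K\<^esub>"
  have "finsum M (\<lambda>i. act M (vertex_elt K i) x) S = act M (?part S) x" if "S \<subseteq> verts Q" for S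
    using finite_subset[OF that finite_verts] that
  proof (induction S)
    case empty
    then show ?case by (simp add: act_zero x)
  next
    case (insert i S)
    have part: "?part S \<in> carrier (path_algebra K Q)"
    proof (rule path_algebra_carrierI)
      show "support K (?part S) \<subseteq> trivial_path ` S" by (auto simp: support_def)
    qed (use insert in auto)
    have i: "i \<in> verts Q" "vertex_elt K i \<in> carrier (path_algebra K Q)"
      using insert.prems by (simp_all add: vertex_elt_def)
    have "?part (insert i S) = vertex_elt K i \<oplus>\<^bsub>path_algebra K Q\<^esub> ?part S"
      using insert.hyps by (auto simp: path_algebra_def vertex_elt_def basis_elt_def fun_eq_iff)
    then have "act M (?part (insert i S)) x = act M (vertex_elt K i) x \<oplus>\<^bsub>M\<^esub> act M (?part S) x"
      using M.act_add_left[OF i(2) part x] by (simp only:)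
    moreover have "finsum M (\<lambda>i. act M (vertex_elt K i) x) (insert i S) =
        act M (vertex_elt K i) x \<oplus>\<^bsub>M\<^esub> finsum M (\<lambda>i. act M (vertex_elt K i) x) S"
      using insert vertex_closed[OF _ x] by (intro M.finsum_insert) auto
    ultimately show ?case using insert by simp
  qed
  from this[OF subset_refl] show ?thesis
    using M.act_one[OF x] by (simp add: path_algebra_def)
qed

text \<open>The image of an idempotent is the set of its fixed vectors, and being fixed is the
  easier condition to verify and to use.\<close>

lemma vertex_space_carrier_iff:
  "i \<in> verts Q \<Longrightarrow> x \<in> carrier (vertex_space K M i) \<longleftrightarrow>
    x \<in> carrier M \<and> act M (vertex_elt K i) x = x"
  by (auto simp: vertex_space_def act_vertex_vertex vertex_closed intro: rev_image_eqI)

lemma vertex_in_vertex_space: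
  "\<lbrakk>i \<in> verts Q; x \<in> carrier M\<rbrakk> \<Longrightarrow> act M (vertex_elt K i) x \<in> carrier (vertex_space K M i)"
  by (simp add: vertex_space_def)

text \<open>For the target \<open>t\<close> of \<open>w\<close> one has
  \<open>v\<^sub>t w = w\<close>, so everything produced by \<open>w\<close> is fixed by
  \<open>v\<^sub>t\<close>.\<close>

lemma path_in_vertex_space:
  "\<lbrakk>w \<in> paths Q; x \<in> carrier M\<rbrakk> \<Longrightarrow>
    act M (basis_elt K w) x \<in> carrier (vertex_space K M (path_target w))"
  by (simp add: vertex_space_carrier_iff act_vertex_path act_basis_closed)

end

lemma vertex_space_simps [simp]:
  "x \<oplus>\<^bsub>vertex_space K M i\<^esub> y = x \<oplus>\<^bsub>M\<^esub> y" "\<zero>\<^bsub>vertex_space K M i\<^esub> = \<zero>\<^bsub>M\<^esub>"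
  "c \<odot>\<^bsub>vertex_space K M i\<^esub> x = c \<odot>\<^bsub>M\<^esub> x"
  "grade (vertex_space K M i) d = grade M d \<inter> carrier (vertex_space K M i)"
  by (simp_all add: vertex_space_def)

lemma G_object_simps [simp]:
  "space (G_object K Q M) i = vertex_space K M i"
  "amap (G_object K Q M) e = act M (arrow_elt K Q e)"
  by (simp_all add: G_object_def)

section \<open>Grading and dimension of the vertex spaces, and the arrows between them\<close>

context smod_object
begin

text \<open>The fixed vectors of the linear map given by \<open>v\<^sub>i\<close> are closed under
  the operations of \<open>M\<close>, which the vertex space inherits.\<close>

lemma vertex_space_vs:
  assumes i: "i \<in> verts Q"
  shows "vectorspace K (vertex_space K M i)"
proof (rule vs_criteria)
  note v = vertex_space_carrier_iff[OF i] and h = vertex_hom[OF i]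
  have z: "act M (vertex_elt K i) \<zero>\<^bsub>M\<^esub> = \<zero>\<^bsub>M\<^esub>"
    by (rule module_hom_zero[OF M.module_axioms M.module_axioms h])
  have s: "c \<odot>\<^bsub>M\<^esub> x \<in> carrier (vertex_space K M i)"
    if "c \<in> carrier K" "x \<in> carrier (vertex_space K M i)" for c x
    using that by (simp add: v module_hom_smult[OF h])
  show "\<forall>x\<in>carrier (vertex_space K M i). \<exists>y\<in>carrier (vertex_space K M i).
      x \<oplus>\<^bsub>vertex_space K M i\<^esub> y = \<zero>\<^bsub>vertex_space K M i\<^esub>"
  proof
    fix x assume x: "x \<in> carrier (vertex_space K M i)"
    have "\<ominus>\<^bsub>M\<^esub> x \<in> carrier (vertex_space K M i)"
      using s[OF _ x, of "\<ominus>\<^bsub>K\<^esub> \<one>\<^bsub>K\<^esub>"] x by (simp add: v M.smult_minus_1)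
    moreover have "x \<oplus>\<^bsub>M\<^esub> \<ominus>\<^bsub>M\<^esub> x = \<zero>\<^bsub>M\<^esub>" using x by (simp add: v M.M.r_neg)
    ultimately show "\<exists>y\<in>carrier (vertex_space K M i).
        x \<oplus>\<^bsub>vertex_space K M i\<^esub> y = \<zero>\<^bsub>vertex_space K M i\<^esub>"
      by auto
  qed
  show "\<forall>a b x. a \<in> carrier K \<and> b \<in> carrier K \<and> x \<in> carrier (vertex_space K M i) \<longrightarrow>
      (a \<otimes>\<^bsub>K\<^esub> b) \<odot>\<^bsub>vertex_space K M i\<^esub> x =
        a \<odot>\<^bsub>vertex_space K M i\<^esub> (b \<odot>\<^bsub>vertex_space K M i\<^esub> x)"
    by (auto simp: v M.smult_assoc1)
qed (auto simp: vertex_space_carrier_iff[OF i] module_hom_add[OF vertex_hom[OF i]]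
    module_hom_smult[OF vertex_hom[OF i]] module_hom_zero[OF M.module_axioms M.module_axioms vertex_hom[OF i]]
    M.M.a_ac M.smult_r_distr M.smult_l_distr K.field_axioms)

lemma vertex_hom_vertex_space:
  "i \<in> verts Q \<Longrightarrow> act M (vertex_elt K i) \<in> module_hom K M (vertex_space K M i)"
  by (intro module_homI)
    (simp_all add: vertex_in_vertex_space module_hom_add[OF vertex_hom] module_hom_smult[OF vertex_hom])

lemma vertex_grade:
  "\<lbrakk>i \<in> verts Q; x \<in> grade M d\<rbrakk> \<Longrightarrow> act M (vertex_elt K i) x \<in> grade M d"
  using has_degreeD[OF vertex_degree, of i x d] by (simp only: add_0_right)

text \<open>Since \<open>v\<^sub>i\<close> acts with degree zero, applying it to the homogeneous
  components in \<open>M\<close> of a fixed vector gives homogeneous components inside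
  \<open>v\<^sub>i M\<close>.\<close>

lemma vertex_space_super:
  assumes i: "i \<in> verts Q"
  shows "super_vectorspace K (vertex_space K M i)"
proof -
  interpret Ms: super_vectorspace K M by (rule M_super)
  interpret Vi: vectorspace K "vertex_space K M i" by (rule vertex_space_vs[OF i])
  show ?thesis
  proof (rule super_vectorspaceI[OF vertex_space_vs[OF i]])
    fix x assume x: "x \<in> carrier (vertex_space K M i)"
    then have xM: "x \<in> carrier M" and ex: "act M (vertex_elt K i) x = x"
      by (simp_all add: vertex_space_carrier_iff[OF i])
    obtain a b where ab: "a \<in> grade M 0" "b \<in> grade M (0 + 1)" "x = a \<oplus>\<^bsub>M\<^esub> b"
      by (rule Ms.grade_decomp[OF xM])
    then have ab': "a \<in> carrier M" "b \<in> carrier M" using Ms.grade_closed by auto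
    have "x = act M (vertex_elt K i) a \<oplus>\<^bsub>M\<^esub> act M (vertex_elt K i) b"
      using ex module_hom_add[OF vertex_hom[OF i] ab'] by (simp add: ab(3))
    moreover have "act M (vertex_elt K i) a \<in> grade (vertex_space K M i) 0"
      "act M (vertex_elt K i) b \<in> grade (vertex_space K M i) 1"
      using ab(1,2) ab' vertex_in_vertex_space[OF i] vertex_grade[OF i] by auto
    ultimately show "\<exists>a\<in>grade (vertex_space K M i) 0. \<exists>b\<in>grade (vertex_space K M i) 1.
        x = a \<oplus>\<^bsub>vertex_space K M i\<^esub> b"
      unfolding vertex_space_simps(1) by blast
  next
    fix x assume "x \<in> grade (vertex_space K M i) 0" "x \<in> grade (vertex_space K M i) 1"
    then show "x = \<zero>\<^bsub>vertex_space K M i\<^esub>"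
      using Ms.grade_inter[of x 0] by simp
  qed (use Vi.M.a_closed Vi.smult_closed Vi.M.zero_closed in
      \<open>auto intro: Ms.grade_zero Ms.grade_add Ms.grade_smult\<close>)
qed

lemma vertex_space_fin_dim:
  assumes i: "i \<in> verts Q"
  shows "vectorspace.fin_dim K (vertex_space K M i)"
  by (rule vectorspace_surj_fin_dim[OF M.vectorspace_axioms vertex_space_vs[OF i]
        vertex_hom_vertex_space[OF i] _ M_fin_dim])
    (simp add: vertex_space_def)

lemma arrow_in_vertex_space:
  "\<lbrakk>e \<in> arcs Q; x \<in> carrier M\<rbrakk> \<Longrightarrow> act M (arrow_elt K Q e) x \<in> carrier (vertex_space K M (head Q e))"
  using path_in_vertex_space[OF arrow_path_in] by (simp add: arrow_elt_def)

lemma G_object_in: "G_object K Q M \<in> srep_objects K Q p"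
proof -
  have "act M (arrow_elt K Q e) \<in> module_hom K (vertex_space K M (tail Q e)) (vertex_space K M (head Q e))"
    and "has_degree (vertex_space K M (tail Q e)) (vertex_space K M (head Q e))
      (p (tail Q e) + p (head Q e)) (act M (arrow_elt K Q e))" if e: "e \<in> arcs Q" for e
  proof -
    have t: "tail Q e \<in> verts Q" using e by simp
    have c: "x \<in> carrier M" if "x \<in> carrier (vertex_space K M (tail Q e))" for x
      using that by (simp add: vertex_space_carrier_iff[OF t])
    show "act M (arrow_elt K Q e) \<in> module_hom K (vertex_space K M (tail Q e)) (vertex_space K M (head Q e))"
      using e c by (intro module_homI)
        (simp_all add: arrow_in_vertex_space module_hom_add[OF arrow_hom] module_hom_smult[OF arrow_hom])
    show "has_degree (vertex_space K M (tail Q e)) (vertex_space K M (head Q e))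
      (p (tail Q e) + p (head Q e)) (act M (arrow_elt K Q e))"
    proof (rule has_degreeI)
      fix a x assume "x \<in> grade (vertex_space K M (tail Q e)) a"
      then have "x \<in> grade M a" "x \<in> carrier M" using c by auto
      then show "act M (arrow_elt K Q e) x
          \<in> grade (vertex_space K M (head Q e)) (a + (p (tail Q e) + p (head Q e)))"
        unfolding vertex_space_simps
        using has_degreeD[OF arrow_degree[OF e]] arrow_in_vertex_space[OF e] by blast
    qed
  qed
  then show ?thesis
    using vertex_space_super vertex_space_fin_dim
    by (simp add: srep_objects_def fd_super_vectorspace_def)
qed

text \<open>The link between the module structure and the representation \<open>G(M)\<close>. A
  nonempty path is the rest of the path times its first arrow; the empty path is
  \<open>v\<^sub>u\<close>, which acts as the identity precisely on the vectors of
  \<open>v\<^sub>u M\<close>.\<close>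

lemma act_path_fold:
  "\<lbrakk>Q.awalk u es v; x \<in> carrier (vertex_space K M u)\<rbrakk> \<Longrightarrow>
    act M (basis_elt K (u, es, v)) x = fold (amap (G_object K Q M)) es x"
proof (induction es arbitrary: u x)
  case Nil
  then have "u = v" "u \<in> verts Q" by (auto simp: Q.awalk_Nil_iff)
  with Nil.prems(2) have "act M (vertex_elt K u) x = x" by (simp add: vertex_space_carrier_iff)
  with \<open>u = v\<close> show ?case by (simp add: vertex_elt_def trivial_path_def)
next
  case (Cons e es)
  from Cons.prems(1) have e: "e \<in> arcs Q" "u = tail Q e" and es: "Q.awalk (head Q e) es v"
    and u: "u \<in> verts Q"
    by (auto simp: Q.awalk_Cons_iff)
  have x: "x \<in> carrier M" using Cons.prems(2) by (simp add: vertex_space_carrier_iff[OF u])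
  have "act M (basis_elt K (head Q e, es, v)) (act M (arrow_elt K Q e) x) =
      act M (basis_elt K (u, e # es, v)) x"
    using act_basis_mult[of "(head Q e, es, v)" "arrow_path Q e" x] es e x
    by (simp add: arrow_elt_def) (simp add: arrow_path_def)
  moreover have "act M (basis_elt K (head Q e, es, v)) (act M (arrow_elt K Q e) x) =
      fold (amap (G_object K Q M)) es (act M (arrow_elt K Q e) x)"
    by (rule Cons.IH[OF es arrow_in_vertex_space[OF e(1) x]])
  moreover have "fold (amap (G_object K Q M)) (e # es) x =
      fold (amap (G_object K Q M)) es (act M (arrow_elt K Q e) x)"
    by simp
  ultimately show ?case by (simp only:)
qed

end

section \<open>Morphisms\<close>

lemma has_degree_compose:
  assumes "super_vectorspace K V" "has_degree V W d f" "has_degree W U d' g"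
  shows "has_degree V U (d + d') (compose (carrier V) g f)"
proof (rule has_degreeI)
  fix a x assume x: "x \<in> grade V a"
  have "g (f x) \<in> grade U (a + d + d')"
    by (intro has_degreeD[OF assms(3)] has_degreeD[OF assms(2)] x)
  moreover have "compose (carrier V) g f x = g (f x)"
    using super_vectorspace.grade_closed[OF assms(1) x] by (rule compose_eq)
  ultimately show "compose (carrier V) g f x \<in> grade U (a + (d + d'))"
    by (simp only: add.assoc)
qed

text \<open>Degrees are tested on homogeneous vectors, which lie in the carrier, so normalising a
  map outside the carrier preserves its degree.\<close>

lemma has_degree_cong:
  assumes "super_vectorspace K V" "\<And>x. x \<in> carrier V \<Longrightarrow> f x = g x" "has_degree V W d f"
  shows "has_degree V W d g"
  using super_vectorspace.grade_closed[OF assms(1)] assms(2) has_degreeD[OF assms(3)]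
  by (intro has_degreeI) metis

lemma has_degree_id:
  assumes "super_vectorspace K V"
  shows "has_degree V V 0 (\<lambda>x \<in> carrier V. x)"
  using super_vectorspace.grade_closed[OF assms]
  by (intro has_degreeI) (simp only: add_0_right restrict_apply' if_True)

lemma intertwinerD:
  assumes "\<phi> \<in> srep_intertwiners K Q X Y"
  shows "\<phi> \<in> extensional (verts Q)"
    and "i \<in> verts Q \<Longrightarrow> \<phi> i \<in> module_hom K (space X i) (space Y i)"
    and "i \<in> verts Q \<Longrightarrow> \<phi> i \<in> extensional (carrier (space X i))"
    and "\<lbrakk>e \<in> arcs Q; x \<in> carrier (space X (tail Q e))\<rbrakk> \<Longrightarrow>
      \<phi> (head Q e) (amap X e x) = amap Y e (\<phi> (tail Q e) x)"
  using assms by (auto simp: srep_intertwiners_def)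

text \<open>The family \<open>f\<close> need not be normalised. The maps of \<open>X\<close> send
  carriers to carriers, so restricting \<open>f\<close> does not disturb the commuting
  squares.\<close>

lemma intertwinerI:
  assumes "\<And>i. i \<in> verts Q \<Longrightarrow> f i \<in> module_hom K (space X i) (space Y i)"
    and "\<And>e x. \<lbrakk>e \<in> arcs Q; x \<in> carrier (space X (tail Q e))\<rbrakk> \<Longrightarrow>
      f (head Q e) (amap X e x) = amap Y e (f (tail Q e) x)"
    and X: "srep_object K Q p X"
  shows "(\<lambda>i \<in> verts Q. \<lambda>x \<in> carrier (space X i). f i x) \<in> srep_intertwiners K Q X Y"
proof -
  interpret X: srep_object K Q p X by fact
  have "restrict (f i) (carrier (space X i)) \<in> module_hom K (space X i) (space Y i)"
    if "i \<in> verts Q" for i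
    using module_hom_restrict[OF X.space_module assms(1)] that by blast
  then show ?thesis
    unfolding srep_intertwiners_def
    using assms(2) module_hom_apply_closed[OF X.amap_hom] by auto
qed

lemma smod_homD:
  assumes "\<Phi> \<in> smod_hom K Q M N"
  shows "\<Phi> \<in> module_hom K M N" and "\<Phi> \<in> extensional (carrier M)"
    and "\<lbrakk>w \<in> paths Q; x \<in> carrier M\<rbrakk> \<Longrightarrow> \<Phi> (act M (basis_elt K w) x) = act N (basis_elt K w) (\<Phi> x)"
  using assms by (auto simp: smod_hom_def simp del: split_paired_All)

lemma (in finite_quiver) smod_hom_vertex:
  "\<lbrakk>\<Phi> \<in> smod_hom K Q M N; i \<in> verts Q; x \<in> carrier M\<rbrakk> \<Longrightarrow>
    \<Phi> (act M (vertex_elt K i) x) = act N (vertex_elt K i) (\<Phi> x)"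
  unfolding vertex_elt_def by (rule smod_homD(3)[OF _ trivial_path_in])

lemma (in finite_quiver) smod_hom_arrow:
  "\<lbrakk>\<Phi> \<in> smod_hom K Q M N; e \<in> arcs Q; x \<in> carrier M\<rbrakk> \<Longrightarrow>
    \<Phi> (act M (arrow_elt K Q e) x) = act N (arrow_elt K Q e) (\<Phi> x)"
  unfolding arrow_elt_def by (rule smod_homD(3)[OF _ arrow_path_in])

lemma smod_homI:
  assumes M: "module K M" and f: "f \<in> module_hom K M N"
    and comm: "\<And>w x. \<lbrakk>w \<in> paths Q; x \<in> carrier M\<rbrakk> \<Longrightarrow> f (act M (basis_elt K w) x) = act N (basis_elt K w) (f x)"
    and closed: "\<And>w x. \<lbrakk>w \<in> paths Q; x \<in> carrier M\<rbrakk> \<Longrightarrow> act M (basis_elt K w) x \<in> carrier M"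
  shows "(\<lambda>x \<in> carrier M. f x) \<in> smod_hom K Q M N"
  using module_hom_restrict[OF M f] comm closed
  unfolding smod_hom_def by (simp del: split_paired_All)

section \<open>Identities, sums and composites of morphisms\<close>

context finite_quiver
begin

lemma srep_objectI: "X \<in> srep_objects K Q p \<Longrightarrow> srep_object K Q p X"
  by (simp add: srep_object_def srep_object_axioms_def finite_quiver_axioms)

lemma srep_familyI: "X \<in> srep_objects K Q p \<Longrightarrow> srep_family K Q p X"
  by (simp add: srep_family_def srep_objectI)

lemma smod_objectI: "M \<in> smod_objects K Q p \<Longrightarrow> smod_object K Q p M"
  by (simp add: smod_object_def smod_object_axioms_def finite_quiver_axioms)

lemma intertwiner_id:
  assumes "X \<in> srep_objects K Q p"
  shows "(\<lambda>i \<in> verts Q. \<lambda>x \<in> carrier (space X i). x) \<in> srep_intertwiners K Q X X"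
  by (rule intertwinerI[OF _ _ srep_objectI[OF assms]]) (auto simp: module_hom_def)

lemma intertwiner_compose:
  assumes X: "X \<in> srep_objects K Q p"
    and \<phi>: "\<phi> \<in> srep_intertwiners K Q X Y" and \<psi>: "\<psi> \<in> srep_intertwiners K Q Y Z"
  shows "(\<lambda>i \<in> verts Q. compose (carrier (space X i)) (\<psi> i) (\<phi> i)) \<in> srep_intertwiners K Q X Z"
proof -
  have "(\<lambda>i \<in> verts Q. \<lambda>x \<in> carrier (space X i). \<psi> i (\<phi> i x)) \<in> srep_intertwiners K Q X Z"
  proof (rule intertwinerI[OF _ _ srep_objectI[OF X]])
    show "(\<lambda>x. \<psi> i (\<phi> i x)) \<in> module_hom K (space X i) (space Z i)" if "i \<in> verts Q" for i
      using module_hom_comp intertwinerD(2)[OF \<phi> that] intertwinerD(2)[OF \<psi> that] by blast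
    fix e x assume e: "e \<in> arcs Q" and x: "x \<in> carrier (space X (tail Q e))"
    have "\<phi> (tail Q e) x \<in> carrier (space Y (tail Q e))"
      using module_hom_apply_closed[OF intertwinerD(2)[OF \<phi>] x] e by simp
    then show "\<psi> (head Q e) (\<phi> (head Q e) (amap X e x)) = amap Z e (\<psi> (tail Q e) (\<phi> (tail Q e) x))"
      using intertwinerD(4)[OF \<phi> e x] intertwinerD(4)[OF \<psi> e] by simp
  qed
  then show ?thesis by (simp add: compose_def)
qed

lemma intertwiner_sum:
  assumes X: "X \<in> srep_objects K Q p" and Y: "Y \<in> srep_objects K Q p"
    and \<phi>: "\<phi> \<in> srep_intertwiners K Q X Y" and \<psi>: "\<psi> \<in> srep_intertwiners K Q X Y"
  shows "(\<lambda>i \<in> verts Q. \<lambda>x \<in> carrier (space X i). \<phi> i x \<oplus>\<^bsub>space Y i\<^esub> \<psi> i x) \<in> srep_intertwiners K Q X Y"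
proof -
  interpret Y: srep_object K Q p Y by (rule srep_objectI[OF Y])
  show ?thesis
  proof (rule intertwinerI[OF _ _ srep_objectI[OF X]])
    show "(\<lambda>x. \<phi> i x \<oplus>\<^bsub>space Y i\<^esub> \<psi> i x) \<in> module_hom K (space X i) (space Y i)" if "i \<in> verts Q" for i
      by (intro module_hom_sum Y.space_module intertwinerD(2)[OF \<phi>] intertwinerD(2)[OF \<psi>] that)
    fix e x assume e: "e \<in> arcs Q" and x: "x \<in> carrier (space X (tail Q e))"
    have "\<phi> (tail Q e) x \<in> carrier (space Y (tail Q e))" "\<psi> (tail Q e) x \<in> carrier (space Y (tail Q e))"
      using module_hom_apply_closed[OF intertwinerD(2)[OF \<phi>] x]
        module_hom_apply_closed[OF intertwinerD(2)[OF \<psi>] x] e by simp_all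
    then show "\<phi> (head Q e) (amap X e x) \<oplus>\<^bsub>space Y (head Q e)\<^esub> \<psi> (head Q e) (amap X e x) =
        amap Y e (\<phi> (tail Q e) x \<oplus>\<^bsub>space Y (tail Q e)\<^esub> \<psi> (tail Q e) x)"
      by (simp add: intertwinerD(4)[OF \<phi> e x] intertwinerD(4)[OF \<psi> e x] module_hom_add[OF Y.amap_hom[OF e]])
  qed
qed

text \<open>Every intertwiner is the sum of its even and odd parts, so passing to the span of the
  homogeneous morphisms gives all intertwiners.\<close>

lemma srep_hom_eq_intertwiners:
  assumes X: "X \<in> srep_objects K Q p" and Y: "Y \<in> srep_objects K Q p"
  shows "srep_hom K Q X Y = srep_intertwiners K Q X Y"
proof (intro subset_antisym subsetI)
  fix \<phi> assume "\<phi> \<in> srep_hom K Q X Y"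
  then show "\<phi> \<in> srep_intertwiners K Q X Y"
  proof induction
    case (homog \<phi>)
    then show ?case by (simp add: srep_homog_def)
  next
    case (sum \<phi> \<psi>)
    then show ?case by (intro intertwiner_sum X Y)
  qed
next
  fix \<phi> assume \<phi>: "\<phi> \<in> srep_intertwiners K Q X Y"
  interpret X: srep_object K Q p X by (rule srep_objectI[OF X])
  interpret Y: srep_object K Q p Y by (rule srep_objectI[OF Y])
  define part where "part d = (\<lambda>i \<in> verts Q. \<lambda>x \<in> carrier (space X i).
    degree_part (space X i) (space Y i) d (\<phi> i) x)" for d
  have "part d \<in> srep_homog K Q X Y" for d
  proof -
    have "part d \<in> srep_intertwiners K Q X Y"
      unfolding part_def
    proof (rule intertwinerI[OF _ _ srep_objectI[OF X]])
      show "degree_part (space X i) (space Y i) d (\<phi> i) \<in> module_hom K (space X i) (space Y i)"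
        if "i \<in> verts Q" for i
        by (intro degree_part_hom X.space_super Y.space_super intertwinerD(2)[OF \<phi>] that)
      fix e x assume e: "e \<in> arcs Q" and x: "x \<in> carrier (space X (tail Q e))"
      have t: "tail Q e \<in> verts Q" and h: "head Q e \<in> verts Q" using e by simp_all
      \<comment> \<open>The maps of \<open>X\<close> and of \<open>Y\<close> at \<open>e\<close>
        have the same degree, the sum of the parities of the two ends, so the square of
        \<open>e\<close> passes to the parts.\<close>
      show "degree_part (space X (head Q e)) (space Y (head Q e)) d (\<phi> (head Q e)) (amap X e x) =
          amap Y e (degree_part (space X (tail Q e)) (space Y (tail Q e)) d (\<phi> (tail Q e)) x)"
        by (rule degree_part_natural[OF X.space_super[OF t] X.space_super[OF h] Y.space_super[OF t]
              Y.space_super[OF h] intertwinerD(2)[OF \<phi> t] intertwinerD(2)[OF \<phi> h]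
              X.amap_hom[OF e] X.amap_degree[OF e] Y.amap_hom[OF e] Y.amap_degree[OF e]
              intertwinerD(4)[OF \<phi> e] x])
    qed
    moreover have "has_degree (space X i) (space Y i) d (part d i)" if i: "i \<in> verts Q" for i
      by (rule has_degree_cong[OF X.space_super[OF i] _
            degree_part_degree[OF X.space_super[OF i] Y.space_super[OF i] intertwinerD(2)[OF \<phi> i]]])
        (simp add: part_def i)
    ultimately show ?thesis by (auto simp: srep_homog_def)
  qed
  then have "(\<lambda>i \<in> verts Q. \<lambda>x \<in> carrier (space X i). part 0 i x \<oplus>\<^bsub>space Y i\<^esub> part 1 i x) \<in> srep_hom K Q X Y"
    by (intro srep_hom.intros)
  also have "(\<lambda>i \<in> verts Q. \<lambda>x \<in> carrier (space X i). part 0 i x \<oplus>\<^bsub>space Y i\<^esub> part 1 i x) = \<phi>"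
  proof (rule extensionalityI[OF restrict_extensional intertwinerD(1)[OF \<phi>]])
    fix i assume i: "i \<in> verts Q"
    have "(\<lambda>x \<in> carrier (space X i). part 0 i x \<oplus>\<^bsub>space Y i\<^esub> part 1 i x) = \<phi> i"
    proof (rule extensionalityI[OF restrict_extensional intertwinerD(3)[OF \<phi> i]])
      fix x assume x: "x \<in> carrier (space X i)"
      then show "(\<lambda>x \<in> carrier (space X i). part 0 i x \<oplus>\<^bsub>space Y i\<^esub> part 1 i x) x = \<phi> i x"
        using degree_part_sum[OF X.space_super[OF i] Y.space_super[OF i] intertwinerD(2)[OF \<phi> i] x] i
        by (simp add: part_def)
    qed
    with i show "(\<lambda>i \<in> verts Q. \<lambda>x \<in> carrier (space X i). part 0 i x \<oplus>\<^bsub>space Y i\<^esub> part 1 i x) i = \<phi> i"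
      by simp
  qed
  finally show "\<phi> \<in> srep_hom K Q X Y" .
qed

lemma srep_homog_common_compose:
  assumes X: "X \<in> srep_objects K Q p"
    and \<phi>: "\<phi> \<in> srep_homog_common K Q X Y" and \<psi>: "\<psi> \<in> srep_homog_common K Q Y Z"
  shows "(\<lambda>i \<in> verts Q. compose (carrier (space X i)) (\<psi> i) (\<phi> i)) \<in> srep_homog_common K Q X Z"
proof -
  interpret X: srep_object K Q p X by (rule srep_objectI[OF X])
  obtain d d' where "\<And>i. i \<in> verts Q \<Longrightarrow> has_degree (space X i) (space Y i) d (\<phi> i)"
    "\<And>i. i \<in> verts Q \<Longrightarrow> has_degree (space Y i) (space Z i) d' (\<psi> i)"
    using \<phi> \<psi> by (auto simp: srep_homog_common_def)
  then have "has_degree (space X i) (space Z i) (d + d') (compose (carrier (space X i)) (\<psi> i) (\<phi> i))"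
    if "i \<in> verts Q" for i
    using has_degree_compose[OF X.space_super] that by blast
  then show ?thesis
    using \<phi> \<psi> intertwiner_compose[OF X] by (auto simp: srep_homog_common_def)
qed

lemma srep_homog_compose:
  assumes X: "X \<in> srep_objects K Q p"
    and \<phi>: "\<phi> \<in> srep_homog K Q X Y" and \<psi>: "\<psi> \<in> srep_homog K Q Y Z"
  shows "(\<lambda>i \<in> verts Q. compose (carrier (space X i)) (\<psi> i) (\<phi> i)) \<in> srep_homog K Q X Z"
proof -
  interpret X: srep_object K Q p X by (rule srep_objectI[OF X])
  have "\<exists>d. has_degree (space X i) (space Z i) d (compose (carrier (space X i)) (\<psi> i) (\<phi> i))"
    if "i \<in> verts Q" for i
    using \<phi> \<psi> that has_degree_compose[OF X.space_super[OF that]] unfolding srep_homog_def by blast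
  then show ?thesis
    using \<phi> \<psi> intertwiner_compose[OF X] by (auto simp: srep_homog_def)
qed

lemma srep_homog_common_id:
  assumes "X \<in> srep_objects K Q p"
  shows "(\<lambda>i \<in> verts Q. \<lambda>x \<in> carrier (space X i). x) \<in> srep_homog_common K Q X X"
proof -
  interpret X: srep_object K Q p X by (rule srep_objectI[OF assms])
  show ?thesis
    using intertwiner_id[OF assms] has_degree_id[OF X.space_super]
    by (auto simp: srep_homog_common_def intro!: exI[of _ 0])
qed

lemma srep_homog_common_subset: "srep_homog_common K Q X Y \<subseteq> srep_homog K Q X Y"
  by (auto simp: srep_homog_common_def srep_homog_def)

lemma smod_hom_id:
  assumes "M \<in> smod_objects K Q p"
  shows "(\<lambda>x \<in> carrier M. x) \<in> smod_hom K Q M M"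
proof -
  interpret M: smod_object K Q p M by (rule smod_objectI[OF assms])
  show ?thesis
    by (rule smod_homI[OF M.M.module_axioms]) (auto simp: module_hom_def intro: M.act_basis_closed)
qed

lemma smod_hom_compose:
  assumes "L \<in> smod_objects K Q p"
    and \<Phi>: "\<Phi> \<in> smod_hom K Q L M" and \<Psi>: "\<Psi> \<in> smod_hom K Q M N"
  shows "compose (carrier L) \<Psi> \<Phi> \<in> smod_hom K Q L N"
proof -
  interpret L: smod_object K Q p L by (rule smod_objectI[OF assms(1)])
  have "(\<lambda>x \<in> carrier L. \<Psi> (\<Phi> x)) \<in> smod_hom K Q L N"
  proof (rule smod_homI[OF L.M.module_axioms module_hom_comp[OF smod_homD(1)[OF \<Phi>] smod_homD(1)[OF \<Psi>]]])
    fix w x assume w: "w \<in> paths Q" and x: "x \<in> carrier L"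
    show "\<Psi> (\<Phi> (act L (basis_elt K w) x)) = act N (basis_elt K w) (\<Psi> (\<Phi> x))"
      using smod_homD(3)[OF \<Phi> w x] smod_homD(3)[OF \<Psi> w module_hom_apply_closed[OF smod_homD(1)[OF \<Phi>] x]]
      by simp
  qed (rule L.act_basis_closed)
  then show ?thesis by (simp add: compose_def)
qed

text \<open>A module map commutes with \<open>v\<^sub>i\<close>, so it sends fixed vectors to fixed
  vectors.\<close>

lemma smod_hom_vertex_space:
  assumes M: "M \<in> smod_objects K Q p" and N: "N \<in> smod_objects K Q p"
    and \<Phi>: "\<Phi> \<in> smod_hom K Q M N" and i: "i \<in> verts Q"
    and x: "x \<in> carrier (vertex_space K M i)"
  shows "\<Phi> x \<in> carrier (vertex_space K N i)"
proof -
  interpret M: smod_object K Q p M by (rule smod_objectI[OF M])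
  interpret N: smod_object K Q p N by (rule smod_objectI[OF N])
  have x': "x \<in> carrier M" "act M (vertex_elt K i) x = x"
    using x by (simp_all add: M.vertex_space_carrier_iff[OF i])
  then have "act N (vertex_elt K i) (\<Phi> x) = \<Phi> x"
    using smod_hom_vertex[OF \<Phi> i x'(1)] by simp
  then show ?thesis
    using module_hom_apply_closed[OF smod_homD(1)[OF \<Phi>] x'(1)] by (simp add: N.vertex_space_carrier_iff[OF i])
qed

text \<open>A degree on all of \<open>M\<close> passes to each \<open>v\<^sub>i M\<close>, because
  the restricted map takes values in \<open>v\<^sub>i N\<close>.\<close>

lemma smod_homog_common_subset:
  assumes M: "M \<in> smod_objects K Q p" and N: "N \<in> smod_objects K Q p"
  shows "smod_homog_common K Q M N \<subseteq> smod_homog K Q M N"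
proof
  fix \<Phi> assume "\<Phi> \<in> smod_homog_common K Q M N"
  then obtain d where \<Phi>: "\<Phi> \<in> smod_hom K Q M N" and d: "has_degree M N d \<Phi>"
    by (auto simp: smod_homog_common_def)
  have "has_degree (vertex_space K M i) (vertex_space K N i) d \<Phi>" if i: "i \<in> verts Q" for i
    using smod_hom_vertex_space[OF M N \<Phi> i] has_degreeD[OF d] by (intro has_degreeI) auto
  with \<Phi> show "\<Phi> \<in> smod_homog K Q M N" by (auto simp: smod_homog_def)
qed

lemma smod_homog_common_compose:
  assumes L: "L \<in> smod_objects K Q p"
    and \<Phi>: "\<Phi> \<in> smod_homog_common K Q L M" and \<Psi>: "\<Psi> \<in> smod_homog_common K Q M N"
  shows "compose (carrier L) \<Psi> \<Phi> \<in> smod_homog_common K Q L N"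
proof -
  interpret L: smod_object K Q p L by (rule smod_objectI[OF L])
  show ?thesis
    using \<Phi> \<Psi> smod_hom_compose[OF L] has_degree_compose[OF L.M_super]
    unfolding smod_homog_common_def by blast
qed

lemma smod_homog_compose:
  assumes L: "L \<in> smod_objects K Q p"
    and \<Phi>: "\<Phi> \<in> smod_homog K Q L M" and \<Psi>: "\<Psi> \<in> smod_homog K Q M N"
  shows "compose (carrier L) \<Psi> \<Phi> \<in> smod_homog K Q L N"
proof -
  interpret L: smod_object K Q p L by (rule smod_objectI[OF L])
  have "\<exists>d. has_degree (vertex_space K L i) (vertex_space K N i) d (compose (carrier L) \<Psi> \<Phi>)"
    if i: "i \<in> verts Q" for i
  proof -
    obtain d d' where d: "has_degree (vertex_space K L i) (vertex_space K M i) d \<Phi>"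
      "has_degree (vertex_space K M i) (vertex_space K N i) d' \<Psi>"
      using \<Phi> \<Psi> i unfolding smod_homog_def by blast
    have "has_degree (vertex_space K L i) (vertex_space K N i) (d + d') (compose (carrier L) \<Psi> \<Phi>)"
      \<comment> \<open>The composite is normalised on all of \<open>L\<close>, the one in
        \<open>has_degree_compose\<close> on \<open>v\<^sub>i L\<close>; they agree on the
        latter.\<close>
      by (rule has_degree_cong[OF L.vertex_space_super[OF i] _
            has_degree_compose[OF L.vertex_space_super[OF i] d]])
        (simp add: compose_eq L.vertex_space_carrier_iff[OF i])
    then show ?thesis ..
  qed
  then show ?thesis using \<Phi> \<Psi> smod_hom_compose[OF L] by (auto simp: smod_homog_def)
qed

lemma smod_homog_common_id:
  assumes "M \<in> smod_objects K Q p"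
  shows "(\<lambda>x \<in> carrier M. x) \<in> smod_homog_common K Q M M"
proof -
  interpret M: smod_object K Q p M by (rule smod_objectI[OF assms])
  show ?thesis
    using smod_hom_id[OF assms] has_degree_id[OF M.M_super] by (auto simp: smod_homog_common_def)
qed

text \<open>The lower bound on \<open>H\<close> puts the identities, which have degree zero, into
  \<open>H\<close>. The upper bound provides the extensionality and the typing from which the unit
  and associativity laws follow.\<close>

lemma srep_category_category:
  fixes H :: "('q, 'e, 'k, 'v) srep \<Rightarrow> ('q, 'e, 'k, 'v) srep \<Rightarrow> ('q \<Rightarrow> 'v \<Rightarrow> 'v) set"
  assumes sub: "\<And>X Y. \<lbrakk>X \<in> srep_objects K Q p; Y \<in> srep_objects K Q p\<rbrakk> \<Longrightarrow>
      srep_homog_common K Q X Y \<subseteq> H X Y \<and> H X Y \<subseteq> srep_intertwiners K Q X Y"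
    and comp: "\<And>X Y Z \<phi> \<psi>. \<lbrakk>X \<in> srep_objects K Q p; Y \<in> srep_objects K Q p; Z \<in> srep_objects K Q p;
      \<phi> \<in> H X Y; \<psi> \<in> H Y Z\<rbrakk> \<Longrightarrow>
      (\<lambda>i \<in> verts Q. compose (carrier (space X i)) (\<psi> i) (\<phi> i)) \<in> H X Z"
  shows "category (srep_category K Q p H)"
proof (unfold_locales; simp only: srep_category_def cat.simps)
  fix X :: "('q, 'e, 'k, 'v) srep" assume "X \<in> srep_objects K Q p"
  then show "(\<lambda>i \<in> verts Q. \<lambda>x \<in> carrier (space X i). x) \<in> H X X"
    using sub srep_homog_common_id by blast
next
  fix X Y Z \<phi> \<psi>
  assume "X \<in> srep_objects K Q p" "Y \<in> srep_objects K Q p" "Z \<in> srep_objects K Q p"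
    "\<phi> \<in> H X Y" "\<psi> \<in> H Y Z"
  then show "(\<lambda>i \<in> verts Q. compose (carrier (space X i)) (\<psi> i) (\<phi> i)) \<in> H X Z" by (rule comp)
next
  fix X Y \<phi> assume "X \<in> srep_objects K Q p" "Y \<in> srep_objects K Q p" "\<phi> \<in> H X Y"
  then have \<phi>: "\<phi> \<in> srep_intertwiners K Q X Y" using sub by blast
  have fc: "\<phi> i \<in> carrier (space X i) \<rightarrow> carrier (space Y i)" if "i \<in> verts Q" for i
    using module_hom_closed intertwinerD(2)[OF \<phi> that] by blast
  show "(\<lambda>i \<in> verts Q. compose (carrier (space X i)) (\<phi> i)
      ((\<lambda>i \<in> verts Q. \<lambda>x \<in> carrier (space X i). x) i)) = \<phi>"
    by (rule extensionalityI[OF restrict_extensional intertwinerD(1)[OF \<phi>]])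
      (simp only: restrict_apply' compose_Id[OF fc intertwinerD(3)[OF \<phi>]])
  show "(\<lambda>i \<in> verts Q. compose (carrier (space X i)) ((\<lambda>i \<in> verts Q. \<lambda>x \<in> carrier (space Y i). x) i)
      (\<phi> i)) = \<phi>"
    by (rule extensionalityI[OF restrict_extensional intertwinerD(1)[OF \<phi>]])
      (simp only: restrict_apply' Id_compose[OF fc intertwinerD(3)[OF \<phi>]])
next
  fix W X Y Z f g h
  assume W: "W \<in> srep_objects K Q p" "X \<in> srep_objects K Q p" "f \<in> H W X"
  then have "f \<in> srep_intertwiners K Q W X" using sub[OF W(1,2)] by blast
  then have fc: "f i \<in> carrier (space W i) \<rightarrow> carrier (space X i)" if "i \<in> verts Q" for i
    using that by (intro module_hom_closed intertwinerD(2))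
  show "(\<lambda>i \<in> verts Q. compose (carrier (space W i)) (h i)
      ((\<lambda>i \<in> verts Q. compose (carrier (space W i)) (g i) (f i)) i)) =
    (\<lambda>i \<in> verts Q. compose (carrier (space W i))
      ((\<lambda>i \<in> verts Q. compose (carrier (space X i)) (h i) (g i)) i) (f i))"
    by (rule restrict_ext) (simp only: restrict_apply' compose_assoc[OF fc])
qed

lemma smod_category_category:
  fixes H :: "('k, ('q, 'e) path \<Rightarrow> 'k, 'v) smod \<Rightarrow> ('k, ('q, 'e) path \<Rightarrow> 'k, 'v) smod \<Rightarrow> ('v \<Rightarrow> 'v) set"
  assumes sub: "\<And>M N. \<lbrakk>M \<in> smod_objects K Q p; N \<in> smod_objects K Q p\<rbrakk> \<Longrightarrow>
      smod_homog_common K Q M N \<subseteq> H M N \<and> H M N \<subseteq> smod_hom K Q M N"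
    and comp: "\<And>L M N \<Phi> \<Psi>. \<lbrakk>L \<in> smod_objects K Q p; M \<in> smod_objects K Q p; N \<in> smod_objects K Q p;
      \<Phi> \<in> H L M; \<Psi> \<in> H M N\<rbrakk> \<Longrightarrow> compose (carrier L) \<Psi> \<Phi> \<in> H L N"
  shows "category (smod_category K Q p H)"
proof (unfold_locales; simp only: smod_category_def cat.simps)
  fix M :: "('k, ('q, 'e) path \<Rightarrow> 'k, 'v) smod" assume "M \<in> smod_objects K Q p"
  then show "(\<lambda>x \<in> carrier M. x) \<in> H M M"
    using sub smod_homog_common_id by blast
next
  fix L M N \<Phi> \<Psi>
  assume "L \<in> smod_objects K Q p" "M \<in> smod_objects K Q p" "N \<in> smod_objects K Q p"
    "\<Phi> \<in> H L M" "\<Psi> \<in> H M N"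
  then show "compose (carrier L) \<Psi> \<Phi> \<in> H L N" by (rule comp)
next
  fix M N \<Phi> assume "M \<in> smod_objects K Q p" "N \<in> smod_objects K Q p" "\<Phi> \<in> H M N"
  then have \<Phi>: "\<Phi> \<in> smod_hom K Q M N" using sub by blast
  note fc = module_hom_closed[OF smod_homD(1)[OF \<Phi>]] smod_homD(2)[OF \<Phi>]
  show "compose (carrier M) \<Phi> (\<lambda>x \<in> carrier M. x) = \<Phi>" by (rule compose_Id[OF fc])
  show "compose (carrier M) (\<lambda>x \<in> carrier N. x) \<Phi> = \<Phi>" by (rule Id_compose[OF fc])
next
  fix L M N N' f g h
  assume L: "L \<in> smod_objects K Q p" "M \<in> smod_objects K Q p" "f \<in> H L M"
  then have "f \<in> smod_hom K Q L M" using sub[OF L(1,2)] by blast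
  then have "f \<in> carrier L \<rightarrow> carrier M" by (intro module_hom_closed smod_homD(1))
  then show "compose (carrier L) h (compose (carrier L) g f) =
      compose (carrier L) (compose (carrier M) h g) f"
    by (rule compose_assoc)
qed

end

section \<open>The functors on morphisms\<close>

lemma F_functor_simps [simp]:
  "on_ob (F_functor K Q) = F_object K Q"
  "on_hom (F_functor K Q) X Y \<phi> =
    (\<lambda>x \<in> carrier (F_object K Q X). Family (\<lambda>i \<in> verts Q. \<phi> i (component x i)))"
  by (simp_all add: F_functor_def)

lemma G_functor_simps [simp]:
  "on_ob (G_functor K Q) = G_object K Q"
  "on_hom (G_functor K Q) M N \<Phi> = (\<lambda>i \<in> verts Q. restrict \<Phi> (carrier (vertex_space K M i)))"
  by (simp_all add: G_functor_def)

context finite_quiver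
begin

text \<open>The squares of the successive arrows are pasted along the path.\<close>

lemma intertwiner_fold:
  assumes X: "X \<in> srep_objects K Q p" and \<phi>: "\<phi> \<in> srep_intertwiners K Q X Y"
  shows "\<lbrakk>Q.awalk u es v; x \<in> carrier (space X u)\<rbrakk> \<Longrightarrow>
    \<phi> v (fold (amap X) es x) = fold (amap Y) es (\<phi> u x)"
proof (induction es arbitrary: u x)
  case Nil
  then show ?case by (simp add: Q.awalk_Nil_iff)
next
  case (Cons e es)
  interpret X: srep_object K Q p X by (rule srep_objectI[OF X])
  from Cons.prems(1) have e: "e \<in> arcs Q" "u = tail Q e" and es: "Q.awalk (head Q e) es v"
    by (auto simp: Q.awalk_Cons_iff)
  have x: "x \<in> carrier (space X (tail Q e))" using Cons.prems(2) by (simp add: e(2))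
  show ?case
    using Cons.IH[OF es module_hom_apply_closed[OF X.amap_hom[OF e(1)] x]] intertwinerD(4)[OF \<phi> e(1) x]
    by (simp add: e(2))
qed

lemma component_hom_closed:
  assumes "\<phi> \<in> srep_intertwiners K Q X Y" "x \<in> carrier (F_object K Q X)" "i \<in> verts Q"
  shows "\<phi> i (component x i) \<in> carrier (space Y i)"
  by (rule module_hom_apply_closed[OF intertwinerD(2)[OF assms(1,3)] component_closed[OF assms(2,3)]])

text \<open>Compatibility with a path \<open>w\<close> is checked in each component: at the target
  of \<open>w\<close> it is \<open>intertwiner_fold\<close>, elsewhere both sides are zero, as
  \<open>\<phi> j\<close> preserves zero.\<close>

lemma F_hom:
  assumes X: "X \<in> srep_objects K Q p" and Y: "Y \<in> srep_objects K Q p"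
    and \<phi>: "\<phi> \<in> srep_intertwiners K Q X Y"
  shows "on_hom (F_functor K Q) X Y \<phi> \<in> smod_hom K Q (F_object K Q X) (F_object K Q Y)"
proof -
  interpret X: srep_family K Q p X by (rule srep_familyI[OF X])
  interpret Y: srep_family K Q p Y by (rule srep_familyI[OF Y])
  let ?f = "\<lambda>x. Family (\<lambda>i \<in> verts Q. \<phi> i (component x i))"
  have closed: "?f x \<in> carrier Y.F" if "x \<in> carrier X.F" for x
    by (intro Family_closed component_hom_closed[OF \<phi> that])
  have linear: "?f \<in> module_hom K X.F Y.F"
  proof (intro module_homI closed; (rule Y.F_eqI)?)
    fix x y i assume xy: "x \<in> carrier X.F" "y \<in> carrier X.F" and i: "i \<in> verts Q"
    show "component (?f (x \<oplus>\<^bsub>X.F\<^esub> y)) i = component (?f x \<oplus>\<^bsub>Y.F\<^esub> ?f y) i"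
      using i X.F_component_closed[OF xy(1) i] X.F_component_closed[OF xy(2) i]
      by (simp add: component_F_object module_hom_add[OF intertwinerD(2)[OF \<phi> i]])
  next
    fix c x i assume cx: "c \<in> carrier K" "x \<in> carrier X.F" and i: "i \<in> verts Q"
    show "component (?f (c \<odot>\<^bsub>X.F\<^esub> x)) i = component (c \<odot>\<^bsub>Y.F\<^esub> ?f x) i"
      using i X.F_component_closed[OF cx(2) i] cx(1)
      by (simp add: component_F_object module_hom_smult[OF intertwinerD(2)[OF \<phi> i]])
  qed (blast intro: closed X.F.M.a_closed X.F.smult_closed Y.F.M.a_closed Y.F.smult_closed)+
  have commute: "?f (act X.F (basis_elt K w) x) = act Y.F (basis_elt K w) (?f x)"
    if w: "w \<in> paths Q" and x: "x \<in> carrier X.F" for w x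
  proof (rule Y.F_eqI)
    show "?f (act X.F (basis_elt K w) x) \<in> carrier Y.F"
      by (intro closed X.act_closed basis_elt_closed w x)
    show "act Y.F (basis_elt K w) (?f x) \<in> carrier Y.F"
      by (intro closed Y.act_closed basis_elt_closed w x)
    fix j assume j: "j \<in> verts Q"
    have zero: "\<phi> j \<zero>\<^bsub>space X j\<^esub> = \<zero>\<^bsub>space Y j\<^esub>"
      by (rule module_hom_zero[OF X.space_module[OF j] Y.space_module[OF j] intertwinerD(2)[OF \<phi> j]])
    have "\<phi> (path_target w) (path_act X w x) = path_act Y w (?f x)"
    proof (cases w)
      case (fields u es v)
      then have "Q.awalk u es v" "u \<in> verts Q" using w by (auto dest: Q.awalk_hd_in_verts)
      then show ?thesis
        using intertwiner_fold[OF X \<phi> _ X.F_component_closed[OF x], of u es v] by (simp add: fields)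
    qed
    then show "component (?f (act X.F (basis_elt K w) x)) j =
        component (act Y.F (basis_elt K w) (?f x)) j"
      using j zero by (auto simp: X.component_act_basis[OF j w x] Y.component_act_basis[OF j w closed[OF x]])
  qed
  show ?thesis
    unfolding F_functor_simps
    by (rule smod_homI[OF X.F.module_axioms linear commute]) (blast intro: X.act_closed basis_elt_closed)+
qed

lemma G_hom:
  assumes M: "M \<in> smod_objects K Q p" and N: "N \<in> smod_objects K Q p"
    and \<Phi>: "\<Phi> \<in> smod_hom K Q M N"
  shows "on_hom (G_functor K Q) M N \<Phi> \<in> srep_intertwiners K Q (G_object K Q M) (G_object K Q N)"
proof -
  interpret M: smod_object K Q p M by (rule smod_objectI[OF M])
  have "(\<lambda>i \<in> verts Q. \<lambda>x \<in> carrier (space (G_object K Q M) i). \<Phi> x)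
      \<in> srep_intertwiners K Q (G_object K Q M) (G_object K Q N)"
  proof (rule intertwinerI[OF _ _ srep_objectI[OF M.G_object_in]])
    fix i assume i: "i \<in> verts Q"
    show "\<Phi> \<in> module_hom K (space (G_object K Q M) i) (space (G_object K Q N) i)"
      using smod_hom_vertex_space[OF M N \<Phi> i]
        module_hom_add[OF smod_homD(1)[OF \<Phi>]] module_hom_smult[OF smod_homD(1)[OF \<Phi>]]
      by (intro module_homI) (simp_all add: M.vertex_space_carrier_iff[OF i])
  next
    fix e x assume e: "e \<in> arcs Q" and x: "x \<in> carrier (space (G_object K Q M) (tail Q e))"
    have t: "tail Q e \<in> verts Q" using e by simp
    show "\<Phi> (amap (G_object K Q M) e x) = amap (G_object K Q N) e (\<Phi> x)"
      using smod_hom_arrow[OF \<Phi> e] x by (simp add: M.vertex_space_carrier_iff[OF t])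
  qed
  then show ?thesis by simp
qed

lemma F_homog_common:
  assumes X: "X \<in> srep_objects K Q p" and Y: "Y \<in> srep_objects K Q p"
    and \<phi>: "\<phi> \<in> srep_homog_common K Q X Y"
  shows "on_hom (F_functor K Q) X Y \<phi> \<in> smod_homog_common K Q (F_object K Q X) (F_object K Q Y)"
proof -
  interpret X: srep_family K Q p X by (rule srep_familyI[OF X])
  obtain d where \<phi>': "\<phi> \<in> srep_intertwiners K Q X Y"
    and d: "\<And>i. i \<in> verts Q \<Longrightarrow> has_degree (space X i) (space Y i) d (\<phi> i)"
    using \<phi> by (auto simp: srep_homog_common_def)
  have "has_degree X.F (F_object K Q Y) d (on_hom (F_functor K Q) X Y \<phi>)"
  proof (rule has_degreeI)
    fix a x assume x: "x \<in> grade X.F a"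
    then have "x \<in> carrier X.F" by (rule super_vectorspace.grade_closed[OF X.F_super])
    moreover have "Family (\<lambda>i \<in> verts Q. \<phi> i (component x i)) \<in> grade (F_object K Q Y) (a + d)"
      by (rule Family_grade) (rule has_degreeD[OF d X.F_component_grade[OF x]])
    ultimately show "on_hom (F_functor K Q) X Y \<phi> x \<in> grade (F_object K Q Y) (a + d)"
      by (simp only: F_functor_simps restrict_apply')
  qed
  with F_hom[OF X Y \<phi>'] show ?thesis unfolding smod_homog_common_def by blast
qed

lemma G_homog_common:
  assumes M: "M \<in> smod_objects K Q p" and N: "N \<in> smod_objects K Q p"
    and \<Phi>: "\<Phi> \<in> smod_homog_common K Q M N"
  shows "on_hom (G_functor K Q) M N \<Phi> \<in> srep_homog_common K Q (G_object K Q M) (G_object K Q N)"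
proof -
  obtain d where \<Phi>': "\<Phi> \<in> smod_hom K Q M N" and d: "has_degree M N d \<Phi>"
    using \<Phi> by (auto simp: smod_homog_common_def)
  have "has_degree (vertex_space K M i) (vertex_space K N i) d (on_hom (G_functor K Q) M N \<Phi> i)"
    if i: "i \<in> verts Q" for i
  proof (rule has_degreeI)
    fix a x assume "x \<in> grade (vertex_space K M i) a"
    then have x: "x \<in> grade M a" "x \<in> carrier (vertex_space K M i)" by simp_all
    then show "on_hom (G_functor K Q) M N \<Phi> i x \<in> grade (vertex_space K N i) (a + d)"
      unfolding vertex_space_simps(4)
      using has_degreeD[OF d x(1)] smod_hom_vertex_space[OF M N \<Phi>' i x(2)] i
      by (simp only: G_functor_simps restrict_apply' Int_iff)
  qed
  with G_hom[OF M N \<Phi>'] show ?thesis unfolding srep_homog_common_def G_object_simps by blast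
qed

lemma G_homog:
  assumes M: "M \<in> smod_objects K Q p" and N: "N \<in> smod_objects K Q p"
    and \<Phi>: "\<Phi> \<in> smod_homog K Q M N"
  shows "on_hom (G_functor K Q) M N \<Phi> \<in> srep_homog K Q (G_object K Q M) (G_object K Q N)"
proof -
  interpret M: smod_object K Q p M by (rule smod_objectI[OF M])
  have \<Phi>': "\<Phi> \<in> smod_hom K Q M N" using \<Phi> by (simp add: smod_homog_def)
  have "\<exists>d. has_degree (vertex_space K M i) (vertex_space K N i) d (on_hom (G_functor K Q) M N \<Phi> i)"
    if i: "i \<in> verts Q" for i
  proof -
    obtain d where d: "has_degree (vertex_space K M i) (vertex_space K N i) d \<Phi>"
      using \<Phi> i by (auto simp: smod_homog_def)
    have "has_degree (vertex_space K M i) (vertex_space K N i) d (on_hom (G_functor K Q) M N \<Phi> i)"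
      by (rule has_degree_cong[OF M.vertex_space_super[OF i] _ d]) (simp add: i)
    then show ?thesis ..
  qed
  with G_hom[OF M N \<Phi>'] show ?thesis unfolding srep_homog_def G_object_simps by blast
qed

end

context srep_family
begin

lemma F_smod_object: "smod_object K Q p F"
  by (rule smod_objectI[OF F_object_in])

lemma F_vertex_space_iff:
  assumes i: "i \<in> verts Q"
  shows "x \<in> carrier (vertex_space K F i) \<longleftrightarrow> x \<in> carrier F \<and> x = emb Q X i (component x i)"
  using smod_object.vertex_space_carrier_iff[OF F_smod_object i] act_vertex_emb[OF i] by metis

lemma emb_in_vertex_space:
  assumes "i \<in> verts Q" "v \<in> carrier (space X i)"
  shows "emb Q X i v \<in> carrier (vertex_space K F i)"
  using assms by (simp add: F_vertex_space_iff emb_closed component_emb)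

end

context finite_quiver
begin

text \<open>In the components other than \<open>i\<close> the map \<open>\<phi> j\<close> is applied
  to zero. Both the vertexwise degrees of \<open>F(\<phi>)\<close> and the naturality of the unit
  rest on this identity.\<close>

lemma F_hom_emb:
  assumes X: "X \<in> srep_objects K Q p" and Y: "Y \<in> srep_objects K Q p"
    and \<phi>: "\<phi> \<in> srep_intertwiners K Q X Y" and i: "i \<in> verts Q" and v: "v \<in> carrier (space X i)"
  shows "on_hom (F_functor K Q) X Y \<phi> (emb Q X i v) = emb Q Y i (\<phi> i v)"
proof -
  interpret X: srep_family K Q p X by (rule srep_familyI[OF X])
  interpret Y: srep_family K Q p Y by (rule srep_familyI[OF Y])
  have "\<phi> j \<zero>\<^bsub>space X j\<^esub> = \<zero>\<^bsub>space Y j\<^esub>" if "j \<in> verts Q" for j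
    by (rule module_hom_zero[OF X.space_module[OF that] Y.space_module[OF that] intertwinerD(2)[OF \<phi> that]])
  then have "(\<lambda>j \<in> verts Q. \<phi> j (component (emb Q X i v) j)) =
      (\<lambda>j \<in> verts Q. if j = i then \<phi> i v else \<zero>\<^bsub>space Y j\<^esub>)"
    by (intro restrict_ext) (simp add: component_emb)
  then show ?thesis
    using X.emb_closed[OF i v] by (simp add: emb_def[of Q Y])
qed

text \<open>A vector of \<open>v\<^sub>i F(X)\<close> is an embedded vector of \<open>X(i)\<close>,
  on which \<open>F(\<phi>)\<close> is just \<open>\<phi> i\<close>. Hence only the degree at
  \<open>i\<close> matters, and the degrees may vary with the vertex.\<close>

lemma F_homog:
  assumes X: "X \<in> srep_objects K Q p" and Y: "Y \<in> srep_objects K Q p"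
    and \<phi>: "\<phi> \<in> srep_homog K Q X Y"
  shows "on_hom (F_functor K Q) X Y \<phi> \<in> smod_homog K Q (F_object K Q X) (F_object K Q Y)"
proof -
  interpret X: srep_family K Q p X by (rule srep_familyI[OF X])
  interpret Y: srep_family K Q p Y by (rule srep_familyI[OF Y])
  have \<phi>': "\<phi> \<in> srep_intertwiners K Q X Y" using \<phi> by (simp add: srep_homog_def)
  have "\<exists>d. has_degree (vertex_space K X.F i) (vertex_space K Y.F i) d (on_hom (F_functor K Q) X Y \<phi>)"
    if i: "i \<in> verts Q" for i
  proof -
    obtain d where d: "has_degree (space X i) (space Y i) d (\<phi> i)"
      using \<phi> i by (auto simp: srep_homog_def)
    have "has_degree (vertex_space K X.F i) (vertex_space K Y.F i) d (on_hom (F_functor K Q) X Y \<phi>)"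
    proof (rule has_degreeI)
      fix a x assume "x \<in> grade (vertex_space K X.F i) a"
      then have x: "x \<in> grade X.F a" "x \<in> carrier X.F" "x = emb Q X i (component x i)"
        using X.F_vertex_space_iff[OF i] by auto
      have v: "component x i \<in> carrier (space X i)" by (rule X.F_component_closed[OF x(2) i])
      have Fx: "on_hom (F_functor K Q) X Y \<phi> x = emb Q Y i (\<phi> i (component x i))"
        using F_hom_emb[OF X Y \<phi>' i v] by (simp only: x(3)[symmetric])
      show "on_hom (F_functor K Q) X Y \<phi> x \<in> grade (vertex_space K Y.F i) (a + d)"
        unfolding vertex_space_simps(4) Fx
        by (intro IntI Y.emb_grade Y.emb_in_vertex_space i component_hom_closed[OF \<phi>' x(2)]
            has_degreeD[OF d] X.F_component_grade x(1))
    qed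
    then show ?thesis ..
  qed
  with F_hom[OF X Y \<phi>'] show ?thesis unfolding smod_homog_def by blast
qed

end


section \<open>Unit and counit\<close>

definition unit_iso ::
    "('k, 'r) ring_scheme \<Rightarrow> ('q, 'e) pre_digraph \<Rightarrow> ('q, 'e, 'k, ('q, 'a) vec_univ) srep
      \<Rightarrow> 'q \<Rightarrow> ('q, 'a) vec_univ \<Rightarrow> ('q, 'a) vec_univ" where
  "unit_iso K Q X = (\<lambda>i \<in> verts Q. \<lambda>v \<in> carrier (space X i). emb Q X i v)"

definition unit_inv ::
    "('k, 'r) ring_scheme \<Rightarrow> ('q, 'e) pre_digraph \<Rightarrow> ('q, 'e, 'k, ('q, 'a) vec_univ) srep
      \<Rightarrow> 'q \<Rightarrow> ('q, 'a) vec_univ \<Rightarrow> ('q, 'a) vec_univ" where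
  "unit_inv K Q X =
    (\<lambda>i \<in> verts Q. \<lambda>x \<in> carrier (vertex_space K (F_object K Q X) i). component x i)"

context srep_family
begin

text \<open>Membership in the smallest of the admissible classes of morphisms puts the unit into
  each of them.\<close>

lemma unit_iso_homog: "unit_iso K Q X \<in> srep_homog_common K Q X (G_object K Q F)"
proof -
  have "unit_iso K Q X \<in> srep_intertwiners K Q X (G_object K Q F)"
    unfolding unit_iso_def
  proof (rule intertwinerI[OF _ _ srep_object_axioms])
    fix i assume i: "i \<in> verts Q"
    show "emb Q X i \<in> module_hom K (space X i) (space (G_object K Q F) i)"
      using module_hom_add[OF emb_hom[OF i]] module_hom_smult[OF emb_hom[OF i]]
      by (intro module_homI) (simp_all add: emb_in_vertex_space[OF i])
  next
    fix e x assume e: "e \<in> arcs Q" and x: "x \<in> carrier (space X (tail Q e))"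
    have t: "tail Q e \<in> verts Q" and h: "head Q e \<in> verts Q" using e by simp_all
    note ex = emb_closed[OF t x]
    \<comment> \<open>Both sides vanish outside the component at the head of \<open>e\<close>; there
      the arrow acts on the component at its tail, which is \<open>x\<close>.\<close>
    have "emb Q X (head Q e) (amap X e x) = act F (arrow_elt K Q e) (emb Q X (tail Q e) x)"
    proof (rule F_eqI)
      show "emb Q X (head Q e) (amap X e x) \<in> carrier F"
        by (intro emb_closed h module_hom_apply_closed[OF amap_hom[OF e] x])
      show "act F (arrow_elt K Q e) (emb Q X (tail Q e) x) \<in> carrier F"
        unfolding arrow_elt_def by (intro act_closed basis_elt_closed arrow_path_in e ex)
    qed (simp add: component_act_arrow[OF e _ ex] component_emb t)
    then show "emb Q X (head Q e) (amap X e x) = amap (G_object K Q F) e (emb Q X (tail Q e) x)"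
      by simp
  qed
  moreover have "has_degree (space X i) (vertex_space K F i) 0 (unit_iso K Q X i)" if i: "i \<in> verts Q" for i
  proof (rule has_degreeI)
    fix a v assume v: "v \<in> grade (space X i) a"
    then have "v \<in> carrier (space X i)" by (rule super_vectorspace.grade_closed[OF space_super[OF i]])
    then have "emb Q X i v \<in> grade (vertex_space K F i) a" "unit_iso K Q X i v = emb Q X i v"
      using emb_grade[OF i v] emb_in_vertex_space[OF i] by (simp_all add: unit_iso_def i)
    then show "unit_iso K Q X i v \<in> grade (vertex_space K F i) (a + 0)" by (simp only: add_0_right)
  qed
  ultimately show ?thesis unfolding srep_homog_common_def G_object_simps by blast
qed

text \<open>An isomorphism needs its inverse in the same class of morphisms, so the inverse gets a
  common degree too.\<close>

lemma unit_inv_homog: "unit_inv K Q X \<in> srep_homog_common K Q (G_object K Q F) X"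
proof -
  have "(\<lambda>i \<in> verts Q. \<lambda>x \<in> carrier (space (G_object K Q F) i). component x i)
      \<in> srep_intertwiners K Q (G_object K Q F) X"
  proof (rule intertwinerI[OF _ _ srep_objectI[OF smod_object.G_object_in[OF F_smod_object]]])
    fix i assume i: "i \<in> verts Q"
    show "(\<lambda>x. component x i) \<in> module_hom K (space (G_object K Q F) i) (space X i)"
      using module_hom_add[OF component_hom[OF i]] module_hom_smult[OF component_hom[OF i]]
      by (intro module_homI) (simp_all add: F_vertex_space_iff[OF i] F_component_closed i)
  next
    fix e x assume e: "e \<in> arcs Q" and x: "x \<in> carrier (space (G_object K Q F) (tail Q e))"
    have t: "tail Q e \<in> verts Q" and h: "head Q e \<in> verts Q" using e by simp_all
    have "x \<in> carrier F" using x by (simp add: F_vertex_space_iff[OF t])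
    then show "component (amap (G_object K Q F) e x) (head Q e) = amap X e (component x (tail Q e))"
      by (simp add: component_act_arrow[OF e h])
  qed
  then have "unit_inv K Q X \<in> srep_intertwiners K Q (G_object K Q F) X"
    by (simp add: unit_inv_def)
  moreover have "has_degree (vertex_space K F i) (space X i) 0 (unit_inv K Q X i)" if i: "i \<in> verts Q" for i
  proof (rule has_degreeI)
    fix a x assume "x \<in> grade (vertex_space K F i) a"
    then have x: "x \<in> grade F a" "x \<in> carrier (vertex_space K F i)" by simp_all
    then show "unit_inv K Q X i x \<in> grade (space X i) (a + 0)"
      using F_component_grade[OF x(1) i] i by (simp only: unit_inv_def restrict_apply' add_0_right)
  qed
  ultimately show ?thesis unfolding srep_homog_common_def G_object_simps by blast
qed

lemma unit_inv_unit:
  "(\<lambda>i \<in> verts Q. compose (carrier (space X i)) (unit_inv K Q X i) (unit_iso K Q X i)) =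
    (\<lambda>i \<in> verts Q. \<lambda>x \<in> carrier (space X i). x)"
  by (intro restrict_ext)
    (simp add: compose_def unit_inv_def unit_iso_def emb_in_vertex_space component_emb cong: restrict_cong)

lemma unit_unit_inv:
  "(\<lambda>i \<in> verts Q. compose (carrier (vertex_space K F i)) (unit_iso K Q X i) (unit_inv K Q X i)) =
    (\<lambda>i \<in> verts Q. \<lambda>x \<in> carrier (vertex_space K F i). x)"
proof (intro restrict_ext)
  fix i assume i: "i \<in> verts Q"
  have "unit_iso K Q X i (unit_inv K Q X i x) = x" if x: "x \<in> carrier (vertex_space K F i)" for x
  proof -
    have x': "x \<in> carrier F" "x = emb Q X i (component x i)"
      using x by (simp_all only: F_vertex_space_iff[OF i])
    show ?thesis
      using x i F_component_closed[OF x'(1) i] x'(2)[symmetric] by (simp add: unit_iso_def unit_inv_def)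
  qed
  then show "compose (carrier (vertex_space K F i)) (unit_iso K Q X i) (unit_inv K Q X i) =
      (\<lambda>x \<in> carrier (vertex_space K F i). x)"
    by (simp add: compose_def cong: restrict_cong)
qed

end

section \<open>The summation map onto a super-module and its inverse\<close>

definition counit_iso ::
    "('k, 'r) ring_scheme \<Rightarrow> ('q, 'e) pre_digraph
      \<Rightarrow> ('k, ('q, 'e) path \<Rightarrow> 'k, ('q, 'a) vec_univ) smod
      \<Rightarrow> ('q, 'a) vec_univ \<Rightarrow> ('q, 'a) vec_univ" where
  "counit_iso K Q M =
    (\<lambda>x \<in> carrier (F_object K Q (G_object K Q M)). finsum M (component x) (verts Q))"

definition counit_inv ::
    "('k, 'r) ring_scheme \<Rightarrow> ('q, 'e) pre_digraph
      \<Rightarrow> ('k, ('q, 'e) path \<Rightarrow> 'k, ('q, 'a) vec_univ) smod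
      \<Rightarrow> ('q, 'a) vec_univ \<Rightarrow> ('q, 'a) vec_univ" where
  "counit_inv K Q M =
    (\<lambda>m \<in> carrier M. Family (\<lambda>i \<in> verts Q. act M (vertex_elt K i) m))"

text \<open>Treating \<open>G(M)\<close> as the representation of \<open>srep_family\<close> makes
  \<open>X.F\<close> the module \<open>F(G(M))\<close>, with all facts about direct sums.\<close>

locale smod_family = smod_object K Q p M
  for K :: "('k, 'r) ring_scheme" and Q :: "('q, 'e) pre_digraph" and p :: "'q \<Rightarrow> bit"
    and M :: "('k, ('q, 'e) path \<Rightarrow> 'k, ('q, 'a) vec_univ) smod"
begin

abbreviation X where "X \<equiv> G_object K Q M"

sublocale X: srep_family K Q p X
  by (rule srep_familyI[OF G_object_in])

lemma component_vertex:
  assumes "x \<in> carrier X.F" "i \<in> verts Q"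
  shows "component x i \<in> carrier (vertex_space K M i)"
    and "component x i \<in> carrier M"
    and "act M (vertex_elt K i) (component x i) = component x i"
  using X.F_component_closed[OF assms] by (simp_all add: vertex_space_carrier_iff[OF assms(2)])

lemma component_X_add:
  "i \<in> verts Q \<Longrightarrow> component (x \<oplus>\<^bsub>X.F\<^esub> y) i = component x i \<oplus>\<^bsub>M\<^esub> component y i"
  and component_X_smult: "i \<in> verts Q \<Longrightarrow> component (c \<odot>\<^bsub>X.F\<^esub> x) i = c \<odot>\<^bsub>M\<^esub> component x i"
  by (simp_all add: component_F_object)

lemma sum_closed: "x \<in> carrier X.F \<Longrightarrow> finsum M (component x) (verts Q) \<in> carrier M"
  by (intro M.M.finsum_closed funcsetI component_vertex(2))

text \<open>The component at the source of \<open>w\<close> is fixed by the idempotent there, so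
  \<open>act_path_fold\<close> turns the composite of the arrow maps into the action of
  \<open>w\<close> in \<open>M\<close>.\<close>

lemma path_act_G:
  assumes w: "w \<in> paths Q" and x: "x \<in> carrier X.F"
  shows "path_act X w x = act M (basis_elt K w) (component x (path_source w))"
proof (cases w)
  case (fields u es v)
  then have "Q.awalk u es v" "u \<in> verts Q" using w by (auto dest: Q.awalk_hd_in_verts)
  then show ?thesis
    using act_path_fold[OF _ component_vertex(1)[OF x], of u es v] by (simp add: fields del: G_object_simps)
qed

text \<open>For the source \<open>s\<close> of \<open>w\<close> one has
  \<open>w = w v\<^sub>s\<close>, so \<open>w\<close> kills the components at all other vertices.
  For general \<open>w\<close> this makes the summation map a module map; for trivial paths it
  recovers the components from their sum.\<close>

lemma act_path_sum:
  assumes w: "w \<in> paths Q" and x: "x \<in> carrier X.F"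
  shows "act M (basis_elt K w) (finsum M (component x) (verts Q)) =
    act M (basis_elt K w) (component x (path_source w))"
proof -
  let ?s = "path_source w"
  have s: "?s \<in> verts Q" by (rule path_ends(1)[OF w])
  have "act M (basis_elt K w) (finsum M (component x) (verts Q)) =
      finsum M (\<lambda>i. act M (basis_elt K w) (component x i)) (verts Q)"
    by (intro module_hom_finsum[OF M.module_axioms M.module_axioms act_basis_hom[OF w]] component_vertex(2) x)
  also have "\<dots> = finsum M (\<lambda>i. if ?s = i then act M (basis_elt K w) (component x i) else \<zero>\<^bsub>M\<^esub>) (verts Q)"
  proof (rule M.M.finsum_cong'[OF refl])
    show "(\<lambda>i. if ?s = i then act M (basis_elt K w) (component x i) else \<zero>\<^bsub>M\<^esub>) \<in> verts Q \<rightarrow> carrier M"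
      using act_basis_closed[OF w component_vertex(2)[OF x]] by auto
    fix i assume i: "i \<in> verts Q"
    show "act M (basis_elt K w) (component x i) =
        (if ?s = i then act M (basis_elt K w) (component x i) else \<zero>\<^bsub>M\<^esub>)"
      using act_path_vertex[OF w i component_vertex(2)[OF x i]] component_vertex(3)[OF x i] by auto
  qed
  also have "\<dots> = act M (basis_elt K w) (component x ?s)"
    using act_basis_closed[OF w component_vertex(2)[OF x]]
    by (intro M.M.finsum_singleton[OF s finite_verts]) auto
  finally show ?thesis .
qed

lemma counit_iso_homog: "counit_iso K Q M \<in> smod_homog_common K Q X.F M"
proof -
  have "counit_iso K Q M \<in> smod_hom K Q X.F M"
    unfolding counit_iso_def
  proof (rule smod_homI[OF X.F.module_axioms])
    show "(\<lambda>x. finsum M (component x) (verts Q)) \<in> module_hom K X.F M"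
    proof (rule module_homI)
      fix x y assume xy: "x \<in> carrier X.F" "y \<in> carrier X.F"
      have "finsum M (component (x \<oplus>\<^bsub>X.F\<^esub> y)) (verts Q) =
          finsum M (\<lambda>i. component x i \<oplus>\<^bsub>M\<^esub> component y i) (verts Q)"
        by (rule M.M.finsum_cong'[OF refl])
          (auto intro: M.M.a_closed component_vertex(2) xy component_X_add)
      also have "\<dots> = finsum M (component x) (verts Q) \<oplus>\<^bsub>M\<^esub> finsum M (component y) (verts Q)"
        by (intro M.M.finsum_addf funcsetI component_vertex(2) xy)
      finally show "finsum M (component (x \<oplus>\<^bsub>X.F\<^esub> y)) (verts Q) =
          finsum M (component x) (verts Q) \<oplus>\<^bsub>M\<^esub> finsum M (component y) (verts Q)" .
    next
      fix c x assume c: "c \<in> carrier K" and x: "x \<in> carrier X.F"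
      have "finsum M (component (c \<odot>\<^bsub>X.F\<^esub> x)) (verts Q) =
          finsum M (\<lambda>i. c \<odot>\<^bsub>M\<^esub> component x i) (verts Q)"
        by (rule M.M.finsum_cong'[OF refl])
          (auto intro: M.smult_closed component_vertex(2) c x component_X_smult)
      also have "\<dots> = c \<odot>\<^bsub>M\<^esub> finsum M (component x) (verts Q)"
        by (intro M.finsum_smult[symmetric] funcsetI component_vertex(2) c x)
      finally show "finsum M (component (c \<odot>\<^bsub>X.F\<^esub> x)) (verts Q) =
          c \<odot>\<^bsub>M\<^esub> finsum M (component x) (verts Q)" .
    qed (rule sum_closed)
  next
    fix w x assume w: "w \<in> paths Q" and x: "x \<in> carrier X.F"
    let ?t = "path_target w"
    have t: "?t \<in> verts Q" by (rule path_ends(2)[OF w])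
    have pc: "path_act X w x \<in> carrier M"
      using act_basis_closed[OF w component_vertex(2)[OF x path_ends(1)[OF w]]] by (simp only: path_act_G[OF w x])
    \<comment> \<open>A path produces a single possibly nonzero component, at its target, so the sum
      reduces to that component.\<close>
    have "finsum M (component (act X.F (basis_elt K w) x)) (verts Q) =
        finsum M (\<lambda>j. if ?t = j then path_act X w x else \<zero>\<^bsub>M\<^esub>) (verts Q)"
      using pc by (intro M.M.finsum_cong'[OF refl]) (auto simp: X.component_act_basis[OF _ w x])
    also have "\<dots> = path_act X w x"
      using pc by (intro M.M.finsum_singleton[OF t finite_verts]) auto
    also have "\<dots> = act M (basis_elt K w) (finsum M (component x) (verts Q))"
      by (simp only: path_act_G[OF w x] act_path_sum[OF w x])
    finally show "finsum M (component (act X.F (basis_elt K w) x)) (verts Q) =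
        act M (basis_elt K w) (finsum M (component x) (verts Q))" .
  next
    fix w x assume "w \<in> paths Q" "x \<in> carrier X.F"
    then show "act X.F (basis_elt K w) x \<in> carrier X.F"
      by (intro X.act_closed basis_elt_closed)
  qed
  moreover have "has_degree X.F M 0 (counit_iso K Q M)"
  proof (rule has_degreeI)
    fix a x assume x: "x \<in> grade X.F a"
    then have xc: "x \<in> carrier X.F" by (rule super_vectorspace.grade_closed[OF X.F_super])
    have "submodule K (grade M a) M"
      using super_vectorspace.grade_subspace[OF M_super, of a] by (simp add: subspace_def)
    then have "finsum M (component x) (verts Q) \<in> grade M a"
      using X.F_component_grade[OF x] by (intro M.submodule_finsum_closed) auto
    then show "counit_iso K Q M x \<in> grade M (a + 0)"
      using xc by (simp only: counit_iso_def restrict_apply' add_0_right)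
  qed
  ultimately show ?thesis unfolding smod_homog_common_def by blast
qed

lemma counit_inv_closed:
  "m \<in> carrier M \<Longrightarrow> Family (\<lambda>i \<in> verts Q. act M (vertex_elt K i) m) \<in> carrier X.F"
  by (intro Family_closed) (simp add: vertex_in_vertex_space)

lemma counit_inv_homog: "counit_inv K Q M \<in> smod_homog_common K Q M X.F"
proof -
  let ?f = "\<lambda>m. Family (\<lambda>i \<in> verts Q. act M (vertex_elt K i) m)"
  have "counit_inv K Q M \<in> smod_hom K Q M X.F"
    unfolding counit_inv_def
  proof (rule smod_homI[OF M.module_axioms])
    show "?f \<in> module_hom K M X.F"
    proof (intro module_homI counit_inv_closed; (rule X.F_eqI)?)
      fix x y i assume "x \<in> carrier M" "y \<in> carrier M" "i \<in> verts Q"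
      then show "component (?f (x \<oplus>\<^bsub>M\<^esub> y)) i = component (?f x \<oplus>\<^bsub>X.F\<^esub> ?f y) i"
        by (simp add: component_X_add module_hom_add[OF vertex_hom])
    next
      fix c x i assume "c \<in> carrier K" "x \<in> carrier M" "i \<in> verts Q"
      then show "component (?f (c \<odot>\<^bsub>M\<^esub> x)) i = component (c \<odot>\<^bsub>X.F\<^esub> ?f x) i"
        by (simp add: component_X_smult module_hom_smult[OF vertex_hom])
    qed (blast intro: counit_inv_closed M.M.a_closed M.smult_closed X.F.M.a_closed X.F.smult_closed)+
  next
    fix w m assume w: "w \<in> paths Q" and m: "m \<in> carrier M"
    show "?f (act M (basis_elt K w) m) = act X.F (basis_elt K w) (?f m)"
    proof (rule X.F_eqI)
      show "?f (act M (basis_elt K w) m) \<in> carrier X.F"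
        by (intro counit_inv_closed act_basis_closed w m)
      show "act X.F (basis_elt K w) (?f m) \<in> carrier X.F"
        by (intro X.act_closed basis_elt_closed counit_inv_closed w m)
      fix j assume j: "j \<in> verts Q"
      \<comment> \<open>The component of the family at the source \<open>s\<close> of
        \<open>w\<close> is \<open>v\<^sub>s m\<close>, and \<open>w v\<^sub>s = w\<close>.\<close>
      have "path_act X w (?f m) = act M (basis_elt K w) m"
        using path_act_G[OF w counit_inv_closed[OF m]] act_path_vertex[OF w _ m] path_ends(1)[OF w] by simp
      then show "component (?f (act M (basis_elt K w) m)) j = component (act X.F (basis_elt K w) (?f m)) j"
        using j by (simp add: X.component_act_basis[OF j w counit_inv_closed[OF m]] act_vertex_path[OF w j m])
    qed
  qed (rule act_basis_closed)
  moreover have "has_degree M X.F 0 (counit_inv K Q M)"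
  proof (rule has_degreeI)
    fix a m assume m: "m \<in> grade M a"
    then have mc: "m \<in> carrier M" by (rule super_vectorspace.grade_closed[OF M_super])
    have "?f m \<in> grade X.F a"
      using vertex_grade[OF _ m] vertex_in_vertex_space[OF _ mc] by (intro Family_grade) simp
    then show "counit_inv K Q M m \<in> grade X.F (a + 0)"
      using mc by (simp only: counit_inv_def restrict_apply' add_0_right)
  qed
  ultimately show ?thesis unfolding smod_homog_common_def by blast
qed

lemma counit_counit_inv: "compose (carrier M) (counit_iso K Q M) (counit_inv K Q M) = (\<lambda>x \<in> carrier M. x)"
  unfolding compose_def
proof (rule restrict_ext)
  fix m assume m: "m \<in> carrier M"
  have "finsum M (component (Family (\<lambda>i \<in> verts Q. act M (vertex_elt K i) m))) (verts Q) =
      finsum M (\<lambda>i. act M (vertex_elt K i) m) (verts Q)"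
    by (rule M.M.finsum_cong'[OF refl]) (simp_all add: vertex_closed m)
  then show "counit_iso K Q M (counit_inv K Q M m) = m"
    by (simp add: counit_iso_def counit_inv_def m counit_inv_closed vertex_sum)
qed

lemma counit_inv_counit:
  "compose (carrier X.F) (counit_inv K Q M) (counit_iso K Q M) = (\<lambda>x \<in> carrier X.F. x)"
  unfolding compose_def
proof (rule restrict_ext)
  fix x assume x: "x \<in> carrier X.F"
  let ?m = "finsum M (component x) (verts Q)"
  have "Family (\<lambda>i \<in> verts Q. act M (vertex_elt K i) ?m) = x"
  proof (rule X.F_eqI[OF counit_inv_closed[OF sum_closed[OF x]] x])
    fix i assume i: "i \<in> verts Q"
    \<comment> \<open>The trivial path at \<open>i\<close> extracts the component at
      \<open>i\<close> from the sum, and that component is fixed by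
      \<open>v\<^sub>i\<close>.\<close>
    have "act M (vertex_elt K i) ?m = component x i"
      using act_path_sum[OF trivial_path_in[OF i] x] component_vertex(3)[OF x i] by (simp add: vertex_elt_def)
    with i show "component (Family (\<lambda>i \<in> verts Q. act M (vertex_elt K i) ?m)) i = component x i"
      by simp
  qed
  then show "counit_inv K Q M (counit_iso K Q M x) = x"
    by (simp add: counit_iso_def counit_inv_def x sum_closed)
qed

end


section \<open>The equivalence\<close>

context finite_quiver
begin

lemma smod_familyI: "M \<in> smod_objects K Q p \<Longrightarrow> smod_family K Q p M"
  by (simp add: smod_family_def smod_objectI)

text \<open>The lower bounds supply the identities and the unit and counit with their inverses; the
  upper bounds supply the linearity and compatibility needed for functoriality and naturality. What
  depends on the class itself is closure under composition and preservation by \<open>F\<close> and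
  \<open>G\<close>.\<close>

lemma inverse_equivalences_F_G:
  fixes HR :: "('q, 'e, 'k, ('q, 'a) vec_univ) srep \<Rightarrow> ('q, 'e, 'k, ('q, 'a) vec_univ) srep
      \<Rightarrow> ('q \<Rightarrow> ('q, 'a) vec_univ \<Rightarrow> ('q, 'a) vec_univ) set"
    and HM :: "('k, ('q, 'e) path \<Rightarrow> 'k, ('q, 'a) vec_univ) smod
      \<Rightarrow> ('k, ('q, 'e) path \<Rightarrow> 'k, ('q, 'a) vec_univ) smod
      \<Rightarrow> (('q, 'a) vec_univ \<Rightarrow> ('q, 'a) vec_univ) set"
  assumes HR: "\<And>X Y. \<lbrakk>X \<in> srep_objects K Q p; Y \<in> srep_objects K Q p\<rbrakk> \<Longrightarrow>
      srep_homog_common K Q X Y \<subseteq> HR X Y \<and> HR X Y \<subseteq> srep_intertwiners K Q X Y"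
    and HR_comp: "\<And>X Y Z \<phi> \<psi>. \<lbrakk>X \<in> srep_objects K Q p; Y \<in> srep_objects K Q p; Z \<in> srep_objects K Q p;
      \<phi> \<in> HR X Y; \<psi> \<in> HR Y Z\<rbrakk> \<Longrightarrow>
      (\<lambda>i \<in> verts Q. compose (carrier (space X i)) (\<psi> i) (\<phi> i)) \<in> HR X Z"
    and HM: "\<And>M N. \<lbrakk>M \<in> smod_objects K Q p; N \<in> smod_objects K Q p\<rbrakk> \<Longrightarrow>
      smod_homog_common K Q M N \<subseteq> HM M N \<and> HM M N \<subseteq> smod_hom K Q M N"
    and HM_comp: "\<And>L M N \<Phi> \<Psi>. \<lbrakk>L \<in> smod_objects K Q p; M \<in> smod_objects K Q p; N \<in> smod_objects K Q p;
      \<Phi> \<in> HM L M; \<Psi> \<in> HM M N\<rbrakk> \<Longrightarrow> compose (carrier L) \<Psi> \<Phi> \<in> HM L N"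
    and F: "\<And>X Y \<phi>. \<lbrakk>X \<in> srep_objects K Q p; Y \<in> srep_objects K Q p; \<phi> \<in> HR X Y\<rbrakk> \<Longrightarrow>
      on_hom (F_functor K Q) X Y \<phi> \<in> HM (F_object K Q X) (F_object K Q Y)"
    and G: "\<And>M N \<Phi>. \<lbrakk>M \<in> smod_objects K Q p; N \<in> smod_objects K Q p; \<Phi> \<in> HM M N\<rbrakk> \<Longrightarrow>
      on_hom (G_functor K Q) M N \<Phi> \<in> HR (G_object K Q M) (G_object K Q N)"
  shows "inverse_equivalences (srep_category K Q p HR) (smod_category K Q p HM) (F_functor K Q) (G_functor K Q)"
proof -
  let ?R = "srep_category K Q p HR" and ?M = "smod_category K Q p HM"
  have srep_sel: "Ob ?R = srep_objects K Q p" "Hom ?R = HR"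
    "Ident ?R = (\<lambda>X. \<lambda>i \<in> verts Q. \<lambda>x \<in> carrier (space X i). x)"
    "Comp ?R = (\<lambda>X Y Z \<psi> \<phi>. \<lambda>i \<in> verts Q. compose (carrier (space X i)) (\<psi> i) (\<phi> i))"
    by (simp_all only: srep_category_def cat.simps)
  have smod_sel: "Ob ?M = smod_objects K Q p" "Hom ?M = HM"
    "Ident ?M = (\<lambda>M. \<lambda>x \<in> carrier M. x)"
    "Comp ?M = (\<lambda>L M N \<Psi> \<Phi>. compose (carrier L) \<Psi> \<Phi>)"
    by (simp_all only: smod_category_def cat.simps)
  note sel = srep_sel smod_sel
  have R: "category ?R" by (rule srep_category_category[OF HR HR_comp])
  have M: "category ?M" by (rule smod_category_category[OF HM HM_comp])
  have FX: "F_object K Q X \<in> smod_objects K Q p" if "X \<in> srep_objects K Q p"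
    for X :: "('q, 'e, 'k, ('q, 'a) vec_univ) srep"
    by (rule srep_family.F_object_in[OF srep_familyI[OF that]])
  have GM: "G_object K Q M \<in> srep_objects K Q p" if "M \<in> smod_objects K Q p"
    for M :: "('k, ('q, 'e) path \<Rightarrow> 'k, ('q, 'a) vec_univ) smod"
    by (rule smod_object.G_object_in[OF smod_objectI[OF that]])
  have "category_functor ?R ?M (F_functor K Q)"
  proof (intro category_functor.intro R M category_functor_axioms.intro; unfold sel)
    fix X :: "('q, 'e, 'k, ('q, 'a) vec_univ) srep" assume X: "X \<in> srep_objects K Q p"
    show "on_ob (F_functor K Q) X \<in> smod_objects K Q p" using FX[OF X] by simp
    \<comment> \<open>Elements of the direct sum are extensional families, so restricting the
      components again changes nothing.\<close>
    have "Family (\<lambda>i \<in> verts Q. component x i) = x" if x: "x \<in> carrier (F_object K Q X)" for x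
    proof (rule F_object_eqI[OF _ x])
      show "Family (\<lambda>i \<in> verts Q. component x i) \<in> carrier (F_object K Q X)"
        by (intro Family_closed component_closed[OF x])
    qed simp
    then show "on_hom (F_functor K Q) X X (\<lambda>i \<in> verts Q. \<lambda>x \<in> carrier (space X i). x) =
        (\<lambda>x \<in> carrier (on_ob (F_functor K Q) X). x)"
      using component_closed[of _ K Q X] by (auto simp: restrict_def fun_eq_iff cong: if_cong)
  next
    fix X Y :: "('q, 'e, 'k, ('q, 'a) vec_univ) srep" and \<phi>
    assume "X \<in> srep_objects K Q p" "Y \<in> srep_objects K Q p" "\<phi> \<in> HR X Y"
    from F[OF this] show "on_hom (F_functor K Q) X Y \<phi> \<in> HM (on_ob (F_functor K Q) X) (on_ob (F_functor K Q) Y)"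
      by (simp only: F_functor_simps(1))
  next
    fix X Y Z :: "('q, 'e, 'k, ('q, 'a) vec_univ) srep" and \<phi> \<psi>
    assume X: "X \<in> srep_objects K Q p" "Y \<in> srep_objects K Q p" and "Z \<in> srep_objects K Q p"
      and "\<phi> \<in> HR X Y" and "\<psi> \<in> HR Y Z"
    then have \<phi>: "\<phi> \<in> srep_intertwiners K Q X Y" using HR by blast
    show "on_hom (F_functor K Q) X Z (\<lambda>i \<in> verts Q. compose (carrier (space X i)) (\<psi> i) (\<phi> i)) =
        compose (carrier (on_ob (F_functor K Q) X)) (on_hom (F_functor K Q) Y Z \<psi>) (on_hom (F_functor K Q) X Y \<phi>)"
      unfolding F_functor_simps compose_def
    proof (rule restrict_ext)
      fix x assume x: "x \<in> carrier (F_object K Q X)"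
      have "Family (\<lambda>i \<in> verts Q. \<phi> i (component x i)) \<in> carrier (F_object K Q Y)"
        by (intro Family_closed component_hom_closed[OF \<phi> x])
      then show "Family (\<lambda>i \<in> verts Q. (\<lambda>i \<in> verts Q. \<lambda>x \<in> carrier (space X i). \<psi> i (\<phi> i x)) i (component x i)) =
          (\<lambda>x \<in> carrier (F_object K Q Y). Family (\<lambda>i \<in> verts Q. \<psi> i (component x i)))
            ((\<lambda>x \<in> carrier (F_object K Q X). Family (\<lambda>i \<in> verts Q. \<phi> i (component x i))) x)"
        using x component_closed[OF x] by (simp cong: restrict_cong)
    qed
  qed
  moreover have "category_functor ?M ?R (G_functor K Q)"
  proof (intro category_functor.intro R M category_functor_axioms.intro; unfold sel)
    fix M :: "('k, ('q, 'e) path \<Rightarrow> 'k, ('q, 'a) vec_univ) smod" assume M: "M \<in> smod_objects K Q p"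
    interpret M: smod_object K Q p M by (rule smod_objectI[OF M])
    show "on_ob (G_functor K Q) M \<in> srep_objects K Q p" using GM[OF M] by simp
    show "on_hom (G_functor K Q) M M (\<lambda>x \<in> carrier M. x) =
        (\<lambda>i \<in> verts Q. \<lambda>x \<in> carrier (space (on_ob (G_functor K Q) M) i). x)"
      unfolding G_functor_simps G_object_simps
      by (intro restrict_ext) (simp add: M.vertex_space_carrier_iff)
  next
    fix M N :: "('k, ('q, 'e) path \<Rightarrow> 'k, ('q, 'a) vec_univ) smod" and \<Phi>
    assume "M \<in> smod_objects K Q p" "N \<in> smod_objects K Q p" "\<Phi> \<in> HM M N"
    from G[OF this] show "on_hom (G_functor K Q) M N \<Phi> \<in> HR (on_ob (G_functor K Q) M) (on_ob (G_functor K Q) N)"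
      by (simp only: G_functor_simps(1))
  next
    fix L M N :: "('k, ('q, 'e) path \<Rightarrow> 'k, ('q, 'a) vec_univ) smod" and \<Phi> \<Psi>
    assume L: "L \<in> smod_objects K Q p" "M \<in> smod_objects K Q p" and "N \<in> smod_objects K Q p"
      and "\<Phi> \<in> HM L M" and "\<Psi> \<in> HM M N"
    then have \<Phi>: "\<Phi> \<in> smod_hom K Q L M" using HM by blast
    interpret L: smod_object K Q p L by (rule smod_objectI[OF L(1)])
    show "on_hom (G_functor K Q) L N (compose (carrier L) \<Psi> \<Phi>) =
        (\<lambda>i \<in> verts Q. compose (carrier (space (on_ob (G_functor K Q) L) i))
          (on_hom (G_functor K Q) M N \<Psi> i) (on_hom (G_functor K Q) L M \<Phi> i))"
      unfolding G_functor_simps G_object_simps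
    proof (rule restrict_ext)
      fix i assume i: "i \<in> verts Q"
      show "restrict (compose (carrier L) \<Psi> \<Phi>) (carrier (vertex_space K L i)) =
          compose (carrier (vertex_space K L i))
            ((\<lambda>i \<in> verts Q. restrict \<Psi> (carrier (vertex_space K M i))) i)
            ((\<lambda>i \<in> verts Q. restrict \<Phi> (carrier (vertex_space K L i))) i)"
        unfolding compose_def
      proof (rule restrict_ext)
        fix x assume x: "x \<in> carrier (vertex_space K L i)"
        then have "x \<in> carrier L" by (simp add: L.vertex_space_carrier_iff[OF i])
        then show "(\<lambda>x \<in> carrier L. \<Psi> (\<Phi> x)) x =
            (\<lambda>i \<in> verts Q. restrict \<Psi> (carrier (vertex_space K M i))) i
              ((\<lambda>i \<in> verts Q. restrict \<Phi> (carrier (vertex_space K L i))) i x)"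
          using x i smod_hom_vertex_space[OF L \<Phi> i x] by simp
      qed
    qed
  qed
  moreover have "naturally_isomorphic ?R ?R id_functor (comp_functor (G_functor K Q) (F_functor K Q))"
    unfolding naturally_isomorphic_def id_functor_def comp_functor_def cat_functor.simps sel
  proof (intro exI[of _ "unit_iso K Q"] conjI ballI)
    fix X :: "('q, 'e, 'k, ('q, 'a) vec_univ) srep" assume X: "X \<in> srep_objects K Q p"
    interpret X: srep_family K Q p X by (rule srep_familyI[OF X])
    \<comment> \<open>The bounds on \<open>HR\<close> hold between objects, so
      \<open>G(F(X))\<close> must be one before the unit and its inverse can be placed in
      \<open>HR\<close>.\<close>
    have GF: "G_object K Q X.F \<in> srep_objects K Q p" by (rule GM[OF FX[OF X]])
    show "iso_in ?R X (on_ob (G_functor K Q) (on_ob (F_functor K Q) X)) (unit_iso K Q X)"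
      unfolding iso_in_def sel G_functor_simps F_functor_simps G_object_simps
      using X.unit_iso_homog X.unit_inv_homog HR[OF X GF] HR[OF GF X] X.unit_inv_unit X.unit_unit_inv
      by blast
  next
    fix X Y :: "('q, 'e, 'k, ('q, 'a) vec_univ) srep" and \<phi>
    assume X: "X \<in> srep_objects K Q p" and Y: "Y \<in> srep_objects K Q p" and "\<phi> \<in> HR X Y"
    then have \<phi>: "\<phi> \<in> srep_intertwiners K Q X Y" using HR by blast
    interpret X: srep_family K Q p X by (rule srep_familyI[OF X])
    show "(\<lambda>i \<in> verts Q. compose (carrier (space X i)) (unit_iso K Q Y i) (\<phi> i)) =
        (\<lambda>i \<in> verts Q. compose (carrier (space X i))
          (on_hom (G_functor K Q) (on_ob (F_functor K Q) X) (on_ob (F_functor K Q) Y)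
            (on_hom (F_functor K Q) X Y \<phi>) i) (unit_iso K Q X i))"
    proof (rule restrict_ext)
      fix i assume i: "i \<in> verts Q"
      show "compose (carrier (space X i)) (unit_iso K Q Y i) (\<phi> i) =
          compose (carrier (space X i)) (on_hom (G_functor K Q) (on_ob (F_functor K Q) X)
            (on_ob (F_functor K Q) Y) (on_hom (F_functor K Q) X Y \<phi>) i) (unit_iso K Q X i)"
        unfolding compose_def
      proof (rule restrict_ext)
        fix v assume v: "v \<in> carrier (space X i)"
        have "\<phi> i v \<in> carrier (space Y i)"
          by (rule module_hom_apply_closed[OF intertwinerD(2)[OF \<phi> i] v])
        then show "unit_iso K Q Y i (\<phi> i v) = on_hom (G_functor K Q) (on_ob (F_functor K Q) X)
            (on_ob (F_functor K Q) Y) (on_hom (F_functor K Q) X Y \<phi>) i (unit_iso K Q X i v)"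
          \<comment> \<open>\<open>F(\<phi>)\<close> carries the embedded \<open>v\<close> to the
            embedded \<open>\<phi> i v\<close>, which is the naturality square.\<close>
          using F_hom_emb[OF X Y \<phi> i v] X.emb_in_vertex_space[OF i v] i v
          by (simp add: unit_iso_def del: F_functor_simps(2))
      qed
    qed
  qed
  moreover have "naturally_isomorphic ?M ?M (comp_functor (F_functor K Q) (G_functor K Q)) id_functor"
    unfolding naturally_isomorphic_def id_functor_def comp_functor_def cat_functor.simps sel
  proof (intro exI[of _ "counit_iso K Q"] conjI ballI)
    fix M :: "('k, ('q, 'e) path \<Rightarrow> 'k, ('q, 'a) vec_univ) smod" assume M: "M \<in> smod_objects K Q p"
    interpret M: smod_family K Q p M by (rule smod_familyI[OF M])
    have FG: "M.X.F \<in> smod_objects K Q p" by (rule FX[OF GM[OF M]])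
    show "iso_in ?M (on_ob (F_functor K Q) (on_ob (G_functor K Q) M)) M (counit_iso K Q M)"
      unfolding iso_in_def sel G_functor_simps F_functor_simps
      using M.counit_iso_homog M.counit_inv_homog HM[OF M FG] HM[OF FG M]
        M.counit_inv_counit M.counit_counit_inv
      by blast
  next
    fix M N :: "('k, ('q, 'e) path \<Rightarrow> 'k, ('q, 'a) vec_univ) smod" and \<Phi>
    assume M: "M \<in> smod_objects K Q p" and N: "N \<in> smod_objects K Q p" and "\<Phi> \<in> HM M N"
    then have \<Phi>: "\<Phi> \<in> smod_hom K Q M N" using HM by blast
    interpret M: smod_family K Q p M by (rule smod_familyI[OF M])
    interpret N: smod_family K Q p N by (rule smod_familyI[OF N])
    let ?\<phi> = "on_hom (G_functor K Q) M N \<Phi>"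
    let ?F = "on_hom (F_functor K Q) (G_object K Q M) (G_object K Q N) ?\<phi>"
    \<comment> \<open>Naturality is linearity of \<open>\<Phi>\<close>: applying it to each
      component and then summing is the same as summing first.\<close>
    have "counit_iso K Q N (?F x) = \<Phi> (counit_iso K Q M x)" if x: "x \<in> carrier M.X.F" for x
    proof -
      have Fx: "?F x = Family (\<lambda>i \<in> verts Q. \<Phi> (component x i))"
        using x M.component_vertex(1)[OF x] by (simp cong: restrict_cong)
      have "?F x \<in> carrier N.X.F"
        using module_hom_apply_closed[OF smod_homD(1)[OF F_hom[OF GM[OF M] GM[OF N] G_hom[OF M N \<Phi>]]] x] .
      then have "counit_iso K Q N (?F x) = finsum N (component (?F x)) (verts Q)"
        by (simp only: counit_iso_def restrict_apply')
      also have "\<dots> = finsum N (\<lambda>i. \<Phi> (component x i)) (verts Q)"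
        unfolding Fx
        by (rule N.M.M.finsum_cong'[OF refl])
          (auto intro: module_hom_apply_closed[OF smod_homD(1)[OF \<Phi>]] M.component_vertex(2)[OF x])
      also have "\<dots> = \<Phi> (finsum M (component x) (verts Q))"
        by (rule module_hom_finsum[OF M.M.module_axioms N.M.module_axioms smod_homD(1)[OF \<Phi>], symmetric])
          (rule M.component_vertex(2)[OF x])
      finally show ?thesis using x by (simp only: counit_iso_def restrict_apply')
    qed
    then show "compose (carrier (on_ob (F_functor K Q) (on_ob (G_functor K Q) M))) (counit_iso K Q N)
          (on_hom (F_functor K Q) (on_ob (G_functor K Q) M) (on_ob (G_functor K Q) N)
            (on_hom (G_functor K Q) M N \<Phi>)) =
        compose (carrier (on_ob (F_functor K Q) (on_ob (G_functor K Q) M))) \<Phi> (counit_iso K Q M)"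
      unfolding compose_def F_functor_simps(1) G_functor_simps(1) by (intro restrict_ext)
  qed
  ultimately show ?thesis by (simp add: inverse_equivalences_def)
qed

end

theorem proposition6p3:
  fixes K :: "('k, 'r) ring_scheme"
    and Q :: "('q, 'e) pre_digraph"
    and p :: "'q \<Rightarrow> bit"
  assumes "field K"
    and "wf_digraph Q"
    and "finite (verts Q)"
  shows "inverse_equivalences
           (SRep K Q p :: ('q, 'e, 'k, ('q, 'a) vec_univ) srep_cat)
           (SMod K Q p :: ('q, 'e, 'k, ('q, 'a) vec_univ) smod_cat)
           (F_functor K Q) (G_functor K Q) \<and>
         inverse_equivalences
           (SRep_homog K Q p :: ('q, 'e, 'k, ('q, 'a) vec_univ) srep_cat)
           (SMod_homog K Q p :: ('q, 'e, 'k, ('q, 'a) vec_univ) smod_cat)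
           (F_functor K Q) (G_functor K Q) \<and>
         inverse_equivalences
           (SRep_homog_common K Q p :: ('q, 'e, 'k, ('q, 'a) vec_univ) srep_cat)
           (SMod_homog_common K Q p :: ('q, 'e, 'k, ('q, 'a) vec_univ) smod_cat)
           (F_functor K Q) (G_functor K Q)"
proof -
  interpret finite_quiver K Q p
    using assms by (simp add: finite_quiver_def finite_quiver_axioms_def)
  have srep_sub: "srep_homog_common K Q X Y \<subseteq> srep_homog K Q X Y"
    "srep_homog K Q X Y \<subseteq> srep_intertwiners K Q X Y" for X Y :: "('q, 'e, 'k, ('q, 'a) vec_univ) srep"
    by (rule srep_homog_common_subset) (auto simp: srep_homog_def)
  have smod_sub: "smod_homog K Q M N \<subseteq> smod_hom K Q M N"
    "smod_homog_common K Q M N \<subseteq> smod_hom K Q M N"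
    for M N :: "('k, ('q, 'e) path \<Rightarrow> 'k, ('q, 'a) vec_univ) smod"
    by (auto simp: smod_homog_def smod_homog_common_def)
  have "inverse_equivalences
      (SRep K Q p :: ('q, 'e, 'k, ('q, 'a) vec_univ) srep_cat)
      (SMod K Q p :: ('q, 'e, 'k, ('q, 'a) vec_univ) smod_cat)
      (F_functor K Q) (G_functor K Q)"
    \<comment> \<open>Module maps are subject to no homogeneity, and their counterpart is the class
      of all intertwiners, to which the span is reduced.\<close>
    unfolding SRep_def SMod_def
  proof (rule inverse_equivalences_F_G)
    fix X Y :: "('q, 'e, 'k, ('q, 'a) vec_univ) srep"
    assume "X \<in> srep_objects K Q p" "Y \<in> srep_objects K Q p"
    then show "srep_homog_common K Q X Y \<subseteq> srep_hom K Q X Y \<and> srep_hom K Q X Y \<subseteq> srep_intertwiners K Q X Y"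
      using srep_sub by (simp only: srep_hom_eq_intertwiners) blast
  next
    fix X Y Z :: "('q, 'e, 'k, ('q, 'a) vec_univ) srep" and \<phi> \<psi>
    assume "X \<in> srep_objects K Q p" "Y \<in> srep_objects K Q p" "Z \<in> srep_objects K Q p"
      "\<phi> \<in> srep_hom K Q X Y" "\<psi> \<in> srep_hom K Q Y Z"
    then show "(\<lambda>i \<in> verts Q. compose (carrier (space X i)) (\<psi> i) (\<phi> i)) \<in> srep_hom K Q X Z"
      using intertwiner_compose by (simp only: srep_hom_eq_intertwiners)
  next
    fix M N :: "('k, ('q, 'e) path \<Rightarrow> 'k, ('q, 'a) vec_univ) smod" and \<Phi>
    assume MN: "M \<in> smod_objects K Q p" "N \<in> smod_objects K Q p" "\<Phi> \<in> smod_hom K Q M N"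
    \<comment> \<open>The span is identified with the intertwiners between objects, so the images
      under \<open>G\<close> are first shown to be objects.\<close>
    then have "G_object K Q M \<in> srep_objects K Q p" "G_object K Q N \<in> srep_objects K Q p"
      using smod_object.G_object_in[OF smod_objectI] by blast+
    then show "on_hom (G_functor K Q) M N \<Phi> \<in> srep_hom K Q (G_object K Q M) (G_object K Q N)"
      using G_hom[OF MN] srep_hom_eq_intertwiners by blast
  next
    fix X Y :: "('q, 'e, 'k, ('q, 'a) vec_univ) srep" and \<phi>
    assume XY: "X \<in> srep_objects K Q p" "Y \<in> srep_objects K Q p" and "\<phi> \<in> srep_hom K Q X Y"
    then have "\<phi> \<in> srep_intertwiners K Q X Y" by (simp only: srep_hom_eq_intertwiners)
    then show "on_hom (F_functor K Q) X Y \<phi> \<in> smod_hom K Q (F_object K Q X) (F_object K Q Y)"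
      by (rule F_hom[OF XY])
  qed (use smod_sub smod_hom_compose in blast)+
  moreover have "inverse_equivalences
      (SRep_homog K Q p :: ('q, 'e, 'k, ('q, 'a) vec_univ) srep_cat)
      (SMod_homog K Q p :: ('q, 'e, 'k, ('q, 'a) vec_univ) smod_cat)
      (F_functor K Q) (G_functor K Q)"
    unfolding SRep_homog_def SMod_homog_def
    by (rule inverse_equivalences_F_G)
      (use srep_sub smod_sub smod_homog_common_subset in \<open>blast intro: srep_homog_compose smod_homog_compose F_homog G_homog\<close>)+
  moreover have "inverse_equivalences
      (SRep_homog_common K Q p :: ('q, 'e, 'k, ('q, 'a) vec_univ) srep_cat)
      (SMod_homog_common K Q p :: ('q, 'e, 'k, ('q, 'a) vec_univ) smod_cat)
      (F_functor K Q) (G_functor K Q)"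
    unfolding SRep_homog_common_def SMod_homog_common_def
    by (rule inverse_equivalences_F_G)
      (use srep_sub smod_sub in \<open>blast intro: srep_homog_common_compose smod_homog_common_compose
        F_homog_common G_homog_common\<close>)+
  ultimately show ?thesis by blast
qed

end
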